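(* Let $k_1,k_2,p\in[0,1)$ and let $f\in\Sigma_{k_1}(p)$ and $g\in\Sigma_{k_2}(p)$. If $\alpha=k_1k_2(1-p)^{-2}<1$, then the modified Hadamard product $f\star g$ belongs to $\Sigma_\alpha(p)$.
   Context: $\widehat{\mathbb C}=\mathbb C\cup\{\infty\}$ is the extended complex plane and $\mathbb D=\{z\in\mathbb C:|z|<1\}$. For $p\in[0,1)$, $\Sigma(p)$ is the class of meromorphic univalent (injective) functions $f$ in $\mathbb D$ with a simple pole at $z=p$ of residue $1$; since $f(z)-1/(z-p)$ is analytic in $\mathbb D$, each such $f$ has an expansion $f(z)=\frac1{z-p}+\sum_{n=0}^\infty a_nz^n$, $|z|<1$ (the power series converging in $\mathbb D$). For $0\le k<1$, a mapping $F:\widehat{\mathbb C}\to\widehat{\mathbb C}$ is called $k$-quasiconformal if $F$ is a homeomorphism and has locally $L^2$ distributional derivatives on $\mathbb C\setminus\{F^{-1}(\infty)\}$ satisfying $|\bar\partial F|\le k|\partial F|$ a.e., where $\partial F=\partial F/\partial z$ and $\bar\partial F=\partial F/\partial\bar z$. $\Sigma_k(p)$ is the class of those $f\in\Sigma(p)$ which admit a $k$-quasiconformal extension to $\widehat{\mathbb C}$, i.e. for which there is a $k$-quasiconformal $F:\widehat{\mathbb C}\to\widehat{\mathbb C}$ with $F|_{\mathbb D}=f$. The modified Hadamard product (modified convolution) $f\star g$ of $f,g\in\Sigma(p)$ with expansions $f(z)=\frac1{z-p}+\sum_{n=0}^\infty a_nz^n$ and $g(z)=\frac1{z-p}+\sum_{n=0}^\infty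 b_nz^n$, $z\in\mathbb D$, is defined by $$(f\star g)(z)=\frac1{z-p}+\sum_{n=0}^\infty a_nb_nz^n,\qquad z\in\mathbb D.$$ *)

theory Defs
  imports "HOL-Analysis.Analysis" "HOL-Complex_Analysis.Complex_Analysis"
begin

(* The extended plane: points are of type complex option, with None as the point at infinity. *)

abbreviation riemann_sphere :: "complex option topology" where
  "riemann_sphere \<equiv> Alexandroff_compactification euclidean"

abbreviation unit_disc :: "complex set" where
  "unit_disc \<equiv> ball 0 1"

(* Infinity is attained exactly at the poles. *)

definition meromorphic_into_sphere :: "(complex \<Rightarrow> complex option) \<Rightarrow> complex set \<Rightarrow> bool" where
  "meromorphic_into_sphere f A \<longleftrightarrow>
     (\<forall>z\<in>A. if f z = None then is_pole (\<lambda>w. the (f w)) z else (\<lambda>w. the (f w)) analytic_on {z})"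

(* A function on the disc is represented by a total function; its values outside unit_disc
   play no role below. *)

definition Sigma_class :: "real \<Rightarrow> (complex \<Rightarrow> complex option) set" where
  "Sigma_class p = {f.
     meromorphic_into_sphere f unit_disc \<and>
     inj_on f unit_disc \<and>
     f (of_real p) = None \<and>
     zorder (\<lambda>z. the (f z)) (of_real p) = -1 \<and>
     residue (\<lambda>z. the (f z)) (of_real p) = 1}"

fun Ck_function :: "nat \<Rightarrow> ('a::real_normed_vector \<Rightarrow> 'b::real_normed_vector) \<Rightarrow> bool" where
  "Ck_function 0 f \<longleftrightarrow> continuous_on UNIV f"
| "Ck_function (Suc n) f \<longleftrightarrow>
     (\<forall>x. f differentiable (at x)) \<and> (\<forall>v. Ck_function n (\<lambda>x. frechet_derivative f (at x) v))"

definition test_functions :: "complex set \<Rightarrow> (complex \<Rightarrow> complex) set" where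
  "test_functions U = {\<phi>. (\<forall>n. Ck_function n \<phi>) \<and>
     compact (closure (support_on UNIV \<phi>)) \<and> closure (support_on UNIV \<phi>) \<subseteq> U}"

definition wirtinger_dz :: "(complex \<Rightarrow> complex) \<Rightarrow> complex \<Rightarrow> complex" where
  "wirtinger_dz \<phi> z =
     (frechet_derivative \<phi> (at z) 1 - \<i> * frechet_derivative \<phi> (at z) \<i>) / 2"

definition wirtinger_dzbar :: "(complex \<Rightarrow> complex) \<Rightarrow> complex \<Rightarrow> complex" where
  "wirtinger_dzbar \<phi> z =
     (frechet_derivative \<phi> (at z) 1 + \<i> * frechet_derivative \<phi> (at z) \<i>) / 2"

definition locally_L2 :: "complex set \<Rightarrow> (complex \<Rightarrow> complex) \<Rightarrow> bool" where
  "locally_L2 U g \<longleftrightarrow> g \<in> borel_measurable (lebesgue_on U) \<and>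
     (\<forall>K. compact K \<and> K \<subseteq> U \<longrightarrow> set_integrable lebesgue K (\<lambda>z. (norm (g z))\<^sup>2))"

(* Bochner integrals of non-integrable functions are 0, so the next two definitions are meant
   for open U and locally integrable f and g. This holds where they are used: there f is
   continuous on U and g is locally L2. *)

definition distributional_dz ::
    "complex set \<Rightarrow> (complex \<Rightarrow> complex) \<Rightarrow> (complex \<Rightarrow> complex) \<Rightarrow> bool" where
  "distributional_dz U f g \<longleftrightarrow> (\<forall>\<phi>\<in>test_functions U.
     (LINT z:U|lebesgue. f z * wirtinger_dz \<phi> z) = - (LINT z:U|lebesgue. g z * \<phi> z))"

definition distributional_dzbar ::
    "complex set \<Rightarrow> (complex \<Rightarrow> complex) \<Rightarrow> (complex \<Rightarrow> complex) \<Rightarrow> bool" where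
  "distributional_dzbar U f g \<longleftrightarrow> (\<forall>\<phi>\<in>test_functions U.
     (LINT z:U|lebesgue. f z * wirtinger_dzbar \<phi> z) = - (LINT z:U|lebesgue. g z * \<phi> z))"

definition quasiconformal :: "real \<Rightarrow> (complex option \<Rightarrow> complex option) \<Rightarrow> bool" where
  "quasiconformal k F \<longleftrightarrow>
     homeomorphic_map riemann_sphere riemann_sphere F \<and>
     (let U = {z. F (Some z) \<noteq> None} in
      \<exists>Fz Fzbar.
        locally_L2 U Fz \<and> distributional_dz U (\<lambda>z. the (F (Some z))) Fz \<and>
        locally_L2 U Fzbar \<and> distributional_dzbar U (\<lambda>z. the (F (Some z))) Fzbar \<and>
        (AE z in lebesgue_on U. norm (Fzbar z) \<le> k * norm (Fz z)))"

definition Sigma_qc_class :: "real \<Rightarrow> real \<Rightarrow> (complex \<Rightarrow> complex option) set" where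
  "Sigma_qc_class k p =
     {f \<in> Sigma_class p. \<exists>F. quasiconformal k F \<and> (\<forall>z\<in>unit_disc. F (Some z) = f z)}"

(* The coefficient sequence exists and is unique for every f in Sigma_class p with 0 <= p < 1. *)

definition Sigma_coeff :: "real \<Rightarrow> (complex \<Rightarrow> complex option) \<Rightarrow> nat \<Rightarrow> complex" where
  "Sigma_coeff p f = (THE a. \<forall>z \<in> unit_disc - {of_real p}.
     (\<lambda>n. a n * z ^ n) sums (the (f z) - 1 / (z - of_real p)))"

definition modified_hadamard ::
    "real \<Rightarrow> (complex \<Rightarrow> complex option) \<Rightarrow> (complex \<Rightarrow> complex option) \<Rightarrow>
     complex \<Rightarrow> complex option" where
  "modified_hadamard p f g = (\<lambda>z.
     if z = of_real p then None
     else Some (1 / (z - of_real p) + (\<Sum>n. Sigma_coeff p f n * Sigma_coeff p g n * z ^ n)))"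

end

theory Submission
  imports Defs
begin

text \<open>
The constant \<open>\<alpha> = k1 k2 / (1 - p)\<^sup>2\<close> splits into two factors, each of which belongs to one half of the
argument: \<open>1 / (1 - p\<^sup>2)\<^sup>2\<close> comes from an area theorem and \<open>(1 + p)\<^sup>2\<close> from an explicit extension.

Area theorem (\<open>Sigma_qc_area\<close>): if \<open>f\<close> has a \<open>k\<close>-quasiconformal extension, its coefficients satisfy
\<open>\<Sum> n |a\<^sub>n|\<^sup>2 \<le> k\<^sup>2 / (1 - p\<^sup>2)\<^sup>2\<close>. Up to the factor \<open>\<pi>\<close> the left side is the Dirichlet integral over the
disc of the regular part of \<open>f\<close>. Subtracting \<open>1 / (z - p)\<close> and the value at infinity from the extension
gives a continuous function \<open>H\<close> on the plane that vanishes at infinity. For such a function the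
\<open>\<partial>\<close>-energy is at most the \<open>\<partial>\<close>-bar-energy (\<open>dz_energy_le_dzbar_energy\<close>): after cutting off, both
derivatives have Fourier coefficients on a torus that differ by unimodular factors. The Beltrami
inequality bounds the \<open>\<partial>\<close>-bar-energy of \<open>H\<close>, which lives outside the disc, by \<open>k\<^sup>2\<close> times the energy of
\<open>\<partial>H - 1 / (z - p)\<^sup>2\<close> there. Expanding the square leaves a cross term; it has the right sign because
the same energy inequality holds for \<open>H + t G\<close> with every real \<open>t\<close>, where \<open>G\<close> equals \<open>1 / (z - p)\<close> outside
the disc and its reflection inside. What remains is the energy of \<open>1 / (z - p)\<close> outside the disc, which is
\<open>\<pi> / (1 - p\<^sup>2)\<^sup>2\<close> (\<open>refl_kernel_energy\<close>, \<open>qc_disc_energy_le\<close>).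

The Cauchy-Schwarz inequality turns the two area theorems into
\<open>\<Sum> n |a\<^sub>n b\<^sub>n| \<le> k1 k2 / (1 - p\<^sup>2)\<^sup>2 = \<alpha> / (1 + p)\<^sup>2\<close>. So the regular part \<open>\<Omega>\<close> of the Hadamard product is
Lipschitz on the closed disc with this constant, and its derivative is bounded by it.

Extension (\<open>reflection_extension_quasiconformal\<close>): outside the disc replace \<open>\<Omega>(z)\<close> by \<open>\<Omega>(1 / cnj z)\<close>. In
the coordinate \<open>1 / (z - p)\<close> folding the sphere into the disc has Lipschitz constant \<open>(1 + p)\<^sup>2\<close>, so the
extended map is the identity plus a contraction with constant \<open>\<alpha> < 1\<close>. By the fixed point theorem it is a
bijection of the sphere, hence a homeomorphism, which also gives univalence in the disc. The same two
bounds, used infinitesimally, give the Beltrami inequality with constant \<open>\<alpha>\<close>.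
\<close>

section \<open>Smooth functions from an explicit calculus\<close>

text \<open>The classical flat function with the extra factor \<open>1 / t\<^sup>k\<close>: with these factors the derivative is a
combination of functions of the same family.\<close>

definition flat :: "nat \<Rightarrow> real \<Rightarrow> real" where
  "flat k t = (if t > 0 then exp (- (1 / t)) / t ^ k else 0)"

lemma flat_pos: "t > 0 \<Longrightarrow> flat k t > 0"
  and flat_nonneg: "flat k t \<ge> 0"
  and flat_zero: "t \<le> 0 \<Longrightarrow> flat k t = 0"
  by (simp_all add: flat_def)

lemma flat_le_fact: "flat k t \<le> fact k"
proof (cases "t > 0")
  case True
  define x where "x = 1 / t"
  have x: "x > 0" "t = 1 / x" using True by (simp_all add: x_def)
  have "(\<Sum>n\<in>{k}. x ^ n /\<^sub>R fact n) \<le> (\<Sum>n. x ^ n /\<^sub>R fact n)"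
    by (rule sum_le_suminf[OF summable_exp_generic]) (use x in auto)
  then have "x ^ k / fact k \<le> exp x"
    by (simp add: exp_def divide_inverse mult.commute)
  then have "x ^ k \<le> fact k * exp x"
    by (simp add: divide_le_eq mult.commute)
  then have "exp (- x) * x ^ k \<le> fact k"
    by (simp add: exp_minus field_simps)
  then show ?thesis using True x
    by (simp add: flat_def power_one_over)
qed (simp add: flat_def)

text \<open>On the positive axis \<open>flat k t / t = t * flat (k + 2) t\<close>, and \<open>flat (k + 2)\<close> is bounded; this makes the
difference quotient at 0 tend to 0.\<close>

lemma flat_has_derivative_0: "(flat k has_real_derivative 0) (at 0)"
proof -
  have bound: "\<bar>flat k y / y\<bar> \<le> \<bar>y\<bar> * fact (k + 2)" for y
  proof (cases "y > 0")
    case True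
    then have "flat k y / y = y * flat (k + 2) y"
      by (simp add: flat_def power2_eq_square)
    then show ?thesis
      using True flat_le_fact[of "k + 2" y] flat_nonneg[of "k + 2" y]
      by (simp only: abs_mult) (simp add: mult_left_mono)
  next
    case False
    then have "flat k y / y = 0" by (simp add: flat_zero)
    then show ?thesis
      by (simp only: abs_zero) (intro mult_nonneg_nonneg abs_ge_zero fact_ge_zero)
  qed
  have "((\<lambda>y::real. \<bar>y\<bar> * fact (k + 2)) \<longlongrightarrow> \<bar>0\<bar> * fact (k + 2)) (at 0)"
    by (intro tendsto_mult tendsto_rabs tendsto_ident_at tendsto_const)
  then have "((\<lambda>y::real. \<bar>y\<bar> * fact (k + 2)) \<longlongrightarrow> 0) (at 0)"
    by (simp del: fact_Suc add_2_eq_Suc')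
  then have "((\<lambda>y. flat k y / y) \<longlongrightarrow> 0) (at 0)"
    by (rule Lim_null_comparison[rotated]) (use bound in \<open>auto simp del: fact_Suc intro!: always_eventually\<close>)
  then show ?thesis
    by (simp add: has_field_derivative_iff flat_zero)
qed

lemma flat_has_derivative:
  "(flat k has_real_derivative (flat (k + 2) t - of_nat k * flat (k + 1) t)) (at t)"
proof -
  consider "t < 0" | "t = 0" | "t > 0" by linarith
  then show ?thesis
  proof cases
    case 1
    then have "((\<lambda>_. 0) has_real_derivative 0) (at t)" by simp
    then have "(flat k has_real_derivative 0) (at t)"
      by (rule has_field_derivative_transform_within_open[where S="{..<0}"])
         (use 1 in \<open>auto simp: flat_def\<close>)
    then show ?thesis using 1 by (simp add: flat_def)
  next
    case 2
    then show ?thesis using flat_has_derivative_0 by (simp add: flat_zero)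
  next
    case 3
    have k: "of_nat k * t ^ (k - Suc 0) = of_nat k * t ^ k / t"
      using 3 by (cases k) simp_all
    have "((\<lambda>t. exp (- (1 / t)) / t ^ k) has_real_derivative
        (exp (- (1 / t)) * (1 / (t * t)) * t ^ k - exp (- (1 / t)) * (of_nat k * t ^ (k - Suc 0))) / (t ^ k * t ^ k)) (at t)"
      using 3 by (auto intro!: derivative_eq_intros)
    also have "(exp (- (1 / t)) * (1 / (t * t)) * t ^ k - exp (- (1 / t)) * (of_nat k * t ^ (k - Suc 0))) / (t ^ k * t ^ k)
        = flat (k + 2) t - of_nat k * flat (k + 1) t"
      unfolding k using 3 by (simp add: flat_def diff_divide_distrib)
    finally have "((\<lambda>t. exp (- (1 / t)) / t ^ k) has_real_derivative
        flat (k + 2) t - of_nat k * flat (k + 1) t) (at t)" .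
    then show ?thesis
      by (rule has_field_derivative_transform_within_open[where S="{0<..}"])
         (use 3 in \<open>auto simp: flat_def\<close>)
  qed
qed

text \<open>A class of functions that is closed under directional derivatives and still rich enough for bump functions,
partitions of unity and characters. Because of this closure every member is differentiable infinitely
often, by one induction and without a calculus of higher derivatives.\<close>

inductive_set smooth_expr :: "(complex \<Rightarrow> complex) set" where
  const: "(\<lambda>_. c) \<in> smooth_expr"
| ident: "(\<lambda>z. z) \<in> smooth_expr"
| add: "f \<in> smooth_expr \<Longrightarrow> g \<in> smooth_expr \<Longrightarrow> (\<lambda>z. f z + g z) \<in> smooth_expr"
| mult: "f \<in> smooth_expr \<Longrightarrow> g \<in> smooth_expr \<Longrightarrow> (\<lambda>z. f z * g z) \<in> smooth_expr"
| cnj: "f \<in> smooth_expr \<Longrightarrow> (\<lambda>z. cnj (f z)) \<in> smooth_expr"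
| inverse: "f \<in> smooth_expr \<Longrightarrow> (\<And>z. f z \<noteq> 0) \<Longrightarrow> (\<lambda>z. inverse (f z)) \<in> smooth_expr"
| exp: "f \<in> smooth_expr \<Longrightarrow> (\<lambda>z. exp (f z)) \<in> smooth_expr"
| flat: "f \<in> smooth_expr \<Longrightarrow> (\<lambda>z. of_real (flat k (Re (f z)))) \<in> smooth_expr"

lemma smooth_expr_diff:
  assumes "f \<in> smooth_expr" "g \<in> smooth_expr"
  shows "(\<lambda>z. f z - g z) \<in> smooth_expr"
  using smooth_expr.add[OF assms(1) smooth_expr.mult[OF smooth_expr.const[of "-1"] assms(2)]]
  by simp

lemma smooth_expr_Re:
  assumes "f \<in> smooth_expr"
  shows "(\<lambda>z. of_real (Re (f z))) \<in> smooth_expr"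
proof -
  have "(\<lambda>z. (1/2) * (f z + cnj (f z))) \<in> smooth_expr"
    by (intro smooth_expr.mult smooth_expr.const smooth_expr.add smooth_expr.cnj assms)
  then show ?thesis by (simp add: complex_add_cnj)
qed

lemma smooth_expr_has_derivative:
  assumes "f \<in> smooth_expr"
  shows "\<exists>D. (\<forall>z. (f has_derivative D z) (at z)) \<and> (\<forall>v. (\<lambda>z. D z v) \<in> smooth_expr)"
  using assms
proof induction
  case (const c)
  then show ?case
    by (intro exI[of _ "\<lambda>_ _. 0"]) (auto intro: smooth_expr.const)
next
  case ident
  then show ?case
    by (intro exI[of _ "\<lambda>_ v. v"]) (auto intro: smooth_expr.const)
next
  case (add f g)
  then obtain D E where
    D: "\<And>z. (f has_derivative D z) (at z)" "\<And>v. (\<lambda>z. D z v) \<in> smooth_expr" and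
    E: "\<And>z. (g has_derivative E z) (at z)" "\<And>v. (\<lambda>z. E z v) \<in> smooth_expr" by blast
  show ?case
    by (intro exI[of _ "\<lambda>z v. D z v + E z v"] conjI allI smooth_expr.add has_derivative_add D E)
next
  case (mult f g)
  then obtain D E where
    D: "\<And>z. (f has_derivative D z) (at z)" "\<And>v. (\<lambda>z. D z v) \<in> smooth_expr" and
    E: "\<And>z. (g has_derivative E z) (at z)" "\<And>v. (\<lambda>z. E z v) \<in> smooth_expr" by blast
  show ?case
    by (intro exI[of _ "\<lambda>z v. f z * E z v + D z v * g z"] conjI allI smooth_expr.add smooth_expr.mult
          has_derivative_mult D E mult.hyps)
next
  case (cnj f)
  then obtain D where
    D: "\<And>z. (f has_derivative D z) (at z)" "\<And>v. (\<lambda>z. D z v) \<in> smooth_expr" by blast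
  show ?case
    by (intro exI[of _ "\<lambda>z v. cnj (D z v)"] conjI allI smooth_expr.cnj has_derivative_cnj D)
next
  case (inverse f)
  then obtain D where
    D: "\<And>z. (f has_derivative D z) (at z)" "\<And>v. (\<lambda>z. D z v) \<in> smooth_expr" by blast
  have "(\<lambda>z. (-1) * (inverse (f z) * D z v * inverse (f z))) \<in> smooth_expr" for v
    by (intro smooth_expr.mult smooth_expr.const smooth_expr.inverse D inverse.hyps)
  then have "(\<lambda>z. - (inverse (f z) * D z v * inverse (f z))) \<in> smooth_expr" for v
    by simp
  moreover have "((\<lambda>z. inverse (f z)) has_derivative (\<lambda>v. - (inverse (f z) * D z v * inverse (f z)))) (at z)" for z
    by (rule Deriv.has_derivative_inverse[OF inverse.hyps(2) D(1)])
  ultimately show ?case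
    by (intro exI[of _ "\<lambda>z v. - (inverse (f z) * D z v * inverse (f z))"]) blast
next
  case (exp f)
  then obtain D where
    D: "\<And>z. (f has_derivative D z) (at z)" "\<And>v. (\<lambda>z. D z v) \<in> smooth_expr" by blast
  have "((\<lambda>z. exp (f z)) has_derivative (\<lambda>v. exp (f z) * D z v)) (at z)" for z
    by (rule has_derivative_compose[OF D(1) DERIV_exp[unfolded has_field_derivative_def]])
  moreover have "(\<lambda>z. exp (f z) * D z v) \<in> smooth_expr" for v
    by (intro smooth_expr.mult smooth_expr.exp D exp.hyps)
  ultimately show ?case
    by (intro exI[of _ "\<lambda>z v. exp (f z) * D z v"]) blast
next
  case (flat f k)
  then obtain D where
    D: "\<And>z. (f has_derivative D z) (at z)" "\<And>v. (\<lambda>z. D z v) \<in> smooth_expr" by blast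
  let ?E = "\<lambda>z v. complex_of_real ((flat (k + 2) (Re (f z)) - of_nat k * flat (k + 1) (Re (f z)))
                 * Re (D z v))"
  have "(\<lambda>z. (of_real (flat (k + 2) (Re (f z))) - of_nat k * of_real (flat (k + 1) (Re (f z))))
                 * of_real (Re (D z v))) \<in> smooth_expr" for v
    by (intro smooth_expr.mult smooth_expr.const smooth_expr.flat smooth_expr_diff smooth_expr_Re flat.hyps D)
  then have "(\<lambda>z. ?E z v) \<in> smooth_expr" for v
    by simp
  moreover have "((\<lambda>z. complex_of_real (flat k (Re (f z)))) has_derivative ?E z) (at z)" for z
    by (rule has_derivative_of_real, rule has_derivative_compose[OF has_derivative_Re[OF D(1)]
          flat_has_derivative[unfolded has_field_derivative_def]])
  ultimately show ?case by (intro exI[of _ ?E] conjI allI)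
qed

lemma smooth_expr_frechet:
  assumes "f \<in> smooth_expr"
  shows "f differentiable (at z)"
    and "(f has_derivative frechet_derivative f (at z)) (at z)"
    and "(\<lambda>z. frechet_derivative f (at z) v) \<in> smooth_expr"
proof -
  obtain D where D: "\<And>z. (f has_derivative D z) (at z)" "\<And>v. (\<lambda>z. D z v) \<in> smooth_expr"
    using smooth_expr_has_derivative[OF assms] by blast
  have eq: "frechet_derivative f (at z) = D z" for z
    using frechet_derivative_at[OF D(1)] by metis
  show "f differentiable (at z)" using D(1) differentiable_def by blast
  then show "(f has_derivative frechet_derivative f (at z)) (at z)"
    by (simp add: frechet_derivative_works)
  show "(\<lambda>z. frechet_derivative f (at z) v) \<in> smooth_expr"
    using D(2) by (simp add: eq)
qed

lemma smooth_expr_continuous_on: "f \<in> smooth_expr \<Longrightarrow> continuous_on A f"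
  by (meson differentiable_imp_continuous_within continuous_at_imp_continuous_on smooth_expr_frechet(1))

lemma smooth_expr_Ck: "f \<in> smooth_expr \<Longrightarrow> Ck_function n f"
proof (induction n arbitrary: f)
  case 0
  then show ?case by (simp add: smooth_expr_continuous_on)
next
  case (Suc n)
  then show ?case using smooth_expr_frechet[OF Suc.prems] by (simp only: Ck_function.simps) blast
qed

section \<open>Integration by parts for piecewise smooth Lipschitz functions\<close>

text \<open>Both Wirtinger operators at once, so that each fact about them is proved only once: \<open>wirt (- \<i>)\<close> is
\<open>\<partial>/\<partial>z\<close> and \<open>wirt \<i>\<close> is its conjugate, applied to a real derivative \<open>D\<close>.\<close>

definition wirt :: "complex \<Rightarrow> (complex \<Rightarrow> complex) \<Rightarrow> complex" where
  "wirt s D = (D 1 + s * D \<i>) / 2"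

lemma wirtinger_dz_eq: "wirtinger_dz \<phi> z = wirt (- \<i>) (frechet_derivative \<phi> (at z))"
  and wirtinger_dzbar_eq: "wirtinger_dzbar \<phi> z = wirt \<i> (frechet_derivative \<phi> (at z))"
  by (simp_all add: wirtinger_dz_def wirtinger_dzbar_def wirt_def)

lemma lebesgue_integral_translation:
  fixes P :: "complex \<Rightarrow> complex"
  assumes "continuous_on UNIV P"
  shows "(LINT z|lebesgue. P (z + a)) = (LINT z|lebesgue. P z)"
proof -
  have m: "P \<in> borel_measurable borel"
    using assms by (simp add: borel_measurable_continuous_onI)
  have "(LINT z|lebesgue. P (z + a)) = (LINT z|lborel. P (a + z))"
    using m by (subst integral_completion) (auto simp: add.commute)
  also have "\<dots> = (LINT z|distr lborel borel ((+) a). P z)"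
    using m by (subst integral_distr) auto
  also have "\<dots> = (LINT z|lebesgue. P z)"
    using m by (simp add: lborel_distr_plus integral_completion)
  finally show ?thesis .
qed

lemma integrable_lebesgue_continuous_compact_support:
  fixes P :: "complex \<Rightarrow> 'a :: euclidean_space"
  assumes "continuous_on UNIV P" "\<And>z. z \<notin> cball 0 R \<Longrightarrow> P z = 0"
  shows "integrable lebesgue P"
proof -
  have "integrable lborel (\<lambda>z. indicator (cball 0 R) z *\<^sub>R P z)"
    using assms(1) continuous_on_subset by (intro borel_integrable_compact) auto
  also have "(\<lambda>z. indicator (cball 0 R) z *\<^sub>R P z) = P"
    using assms(2) by (auto simp: fun_eq_iff indicator_def)
  finally show ?thesis
    using assms(1) by (simp add: integrable_completion borel_measurable_continuous_onI)
qed

text \<open>By translation invariance every difference quotient of \<open>P\<close> in direction \<open>v\<close> has integral 0; the Lipschitz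
bound dominates the quotients, so the integral passes to the limit. The limit has to exist only almost
everywhere, which admits functions that are glued along a circle.\<close>

lemma integral_derivative_eq_0:
  fixes P :: "complex \<Rightarrow> complex"
  assumes lip: "C-lipschitz_on UNIV P" and supp: "\<And>z. z \<notin> cball 0 R \<Longrightarrow> P z = 0"
    and N: "N \<in> null_sets lebesgue"
    and der: "\<And>z. z \<notin> N \<Longrightarrow> (P has_derivative D z) (at z)"
    and g: "\<And>z. z \<notin> N \<Longrightarrow> g z = D z v"
  shows "integrable lebesgue g" "(LINT z|lebesgue. g z) = 0"
proof -
  define h :: "nat \<Rightarrow> real" where "h n = 1 / (real n + 1)" for n
  have h: "h n > 0" "h n \<le> 1" for n by (auto simp: h_def)
  have h_lim: "h \<longlonglongrightarrow> 0"
    unfolding h_def using LIMSEQ_inverse_real_of_nat by (simp add: inverse_eq_divide add.commute)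
  define q where "q n z = (P (z + of_real (h n) * v) - P z) / of_real (h n)" for n z
  have contP: "continuous_on UNIV P" using lip by (rule lipschitz_on_continuous_on)
  have contPt: "continuous_on UNIV (\<lambda>z. P (z + a))" for a
    by (intro continuous_on_compose2[OF contP] continuous_intros) auto
  have intP: "integrable lebesgue P"
    by (rule integrable_lebesgue_continuous_compact_support[OF contP supp])
  have intPt: "integrable lebesgue (\<lambda>z. P (z + a))" for a
  proof (rule integrable_lebesgue_continuous_compact_support[OF contPt])
    fix z :: complex assume "z \<notin> cball 0 (R + norm a)"
    then have "norm z > R + norm a" by simp
    then have "norm (z + a) > R" using norm_diff_ineq[of z a] by linarith
    then show "P (z + a) = 0" using supp by simp
  qed
  have int_q: "(LINT z|lebesgue. q n z) = 0" for n
    unfolding q_def using intP intPt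
    by (simp add: lebesgue_integral_translation[OF contP])
  have q_lim: "(\<lambda>n. q n z) \<longlonglongrightarrow> g z" if "z \<notin> N" for z
  proof -
    have "((\<lambda>t. P (z + t *\<^sub>R v)) has_vector_derivative D z v) (at 0)"
    proof -
      have "((\<lambda>t. z + t *\<^sub>R v) has_derivative (\<lambda>t. t *\<^sub>R v)) (at 0)"
        by (auto intro!: derivative_eq_intros)
      moreover have "(P has_derivative D z) (at (z + 0 *\<^sub>R v))" using der[OF that] by simp
      ultimately have "((\<lambda>t. P (z + t *\<^sub>R v)) has_derivative (\<lambda>t. D z (t *\<^sub>R v))) (at 0)"
        using has_derivative_compose[of "\<lambda>t. z + t *\<^sub>R v" "\<lambda>t. t *\<^sub>R v" 0 UNIV P "D z"] by simp
      then show ?thesis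
        using linear_scale[OF has_derivative_linear[OF der[OF that]]]
        by (simp add: has_vector_derivative_def)
    qed
    then have lim: "((\<lambda>t. norm (P (z + t *\<^sub>R v) - P z - t *\<^sub>R D z v) / norm t) \<longlongrightarrow> 0) (at 0)"
      by (simp add: has_vector_derivative_def has_derivative_at)
    have "norm (P (z + t *\<^sub>R v) - P z - t *\<^sub>R D z v) / norm t =
        norm ((P (z + t *\<^sub>R v) - P z) /\<^sub>R t - D z v)" if "t \<noteq> 0" for t
    proof -
      have "(P (z + t *\<^sub>R v) - P z) /\<^sub>R t - D z v = (P (z + t *\<^sub>R v) - P z - t *\<^sub>R D z v) /\<^sub>R t"
        using that by (simp add: scaleR_diff_right)
      then show ?thesis by (simp add: divide_inverse mult.commute)
    qed
    then have "((\<lambda>t. norm ((P (z + t *\<^sub>R v) - P z) /\<^sub>R t - D z v)) \<longlongrightarrow> 0) (at 0)"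
      by (intro Lim_transform_eventually[OF lim]) (auto simp: eventually_at_filter)
    then have lim: "((\<lambda>t. (P (z + t *\<^sub>R v) - P z) /\<^sub>R t) \<longlongrightarrow> D z v) (at 0)"
      by - (rule LIM_zero_cancel, rule tendsto_norm_zero_cancel)
    have "filterlim h (at 0) sequentially"
      using h h_lim by (auto simp: filterlim_at intro!: always_eventually) (metis less_irrefl)
    from filterlim_compose[OF lim this] have "(\<lambda>n. (P (z + h n *\<^sub>R v) - P z) /\<^sub>R h n) \<longlonglongrightarrow> D z v" .
    then show ?thesis using g[OF that]
      by (simp add: q_def scaleR_conv_of_real divide_inverse mult.commute)
  qed
  have q_meas: "q n \<in> borel_measurable lebesgue" for n
    unfolding q_def using intP intPt by (intro borel_measurable_divide borel_measurable_diff borel_measurable_integrable) auto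
  have ae: "AE z in lebesgue. (\<lambda>n. q n z) \<longlonglongrightarrow> g z"
    by (rule AE_I'[OF N]) (use q_lim in auto)
  have "(\<lambda>z. lim (\<lambda>n. q n z)) \<in> borel_measurable lebesgue"
    using q_meas by (intro borel_measurable_lim_metric)
  then have g_meas: "g \<in> borel_measurable lebesgue"
    by (rule borel_measurable_AE) (use ae in \<open>auto simp: limI elim!: eventually_mono\<close>)
  define w where "w z = C * norm v * indicator (cball (0::complex) (R + norm v)) z" for z
  have w: "integrable lebesgue w"
    unfolding w_def by (intro integrable_mult_right integrable_real_indicator) (auto simp: emeasure_lborel_cball_finite[unfolded infinity_ennreal_def])
  have bound: "norm (q n z) \<le> w z" for n z
  proof (cases "z \<in> cball 0 (R + norm v)")
    case True
    have "norm (P (z + of_real (h n) * v) - P z) \<le> C * (h n * norm v)"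
      using lipschitz_onD[OF lip, of "z + of_real (h n) * v" z] h[of n] by (simp add: dist_norm norm_mult)
    then show ?thesis using True h[of n]
      by (simp add: q_def w_def norm_divide divide_le_eq mult_ac)
  next
    case False
    have "norm (of_real (h n) * v) \<le> norm v"
      using h[of n] by (simp add: norm_mult mult_left_le_one_le)
    moreover have "norm z > R + norm v" using False by simp
    ultimately have "norm (z + of_real (h n) * v) > R" "norm z > R"
      using norm_diff_ineq[of z "of_real (h n) * v"] norm_ge_zero[of v] by linarith+
    then show ?thesis using supp lipschitz_on_nonneg[OF lip] by (simp add: q_def w_def)
  qed
  show "integrable lebesgue g"
    by (rule integrable_dominated_convergence[OF g_meas q_meas w ae]) (use bound in auto)
  have "(\<lambda>n. LINT z|lebesgue. q n z) \<longlonglongrightarrow> (LINT z|lebesgue. g z)"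
    by (rule integral_dominated_convergence[OF g_meas q_meas w ae]) (use bound in auto)
  then show "(LINT z|lebesgue. g z) = 0"
    using int_q LIMSEQ_unique tendsto_const by (metis (no_types, lifting) ext)
qed

definition loc_lip :: "complex set \<Rightarrow> (complex \<Rightarrow> complex) \<Rightarrow> bool" where
  "loc_lip U f \<longleftrightarrow> (\<forall>z\<in>U. \<exists>r>0. \<exists>C. C-lipschitz_on (ball z r) f)"

lemma loc_lip_mult:
  assumes "loc_lip U f" "loc_lip U g"
  shows "loc_lip U (\<lambda>z. f z * g z)"
  unfolding loc_lip_def
proof
  fix z assume "z \<in> U"
  then obtain r C r' C' where *: "r > 0" "C-lipschitz_on (ball z r) f" "r' > 0" "C'-lipschitz_on (ball z r') g"
    using assms unfolding loc_lip_def by metis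
  define \<rho> where "\<rho> = min 1 (min r r')"
  have \<rho>: "\<rho> > 0" "\<rho> \<le> 1" using * by (auto simp: \<rho>_def)
  have f: "C-lipschitz_on (ball z \<rho>) f" and g: "C'-lipschitz_on (ball z \<rho>) g"
    using * by (auto simp: \<rho>_def intro: lipschitz_on_subset)
  have C: "C \<ge> 0" "C' \<ge> 0" using f g lipschitz_on_nonneg by auto
  have z: "z \<in> ball z \<rho>" using \<rho> by simp
  have bf: "norm (f x) \<le> norm (f z) + C" if "x \<in> ball z \<rho>" for x
  proof -
    have "norm (f x - f z) \<le> C * norm (x - z)"
      using lipschitz_onD[OF f that z] by (simp add: dist_norm)
    also have "\<dots> \<le> C * 1" using that \<rho> C by (intro mult_left_mono) (auto simp: dist_norm norm_minus_commute)
    finally show ?thesis using norm_triangle_ineq2[of "f x" "f z"] by simp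
  qed
  have bg: "norm (g x) \<le> norm (g z) + C'" if "x \<in> ball z \<rho>" for x
  proof -
    have "norm (g x - g z) \<le> C' * norm (x - z)"
      using lipschitz_onD[OF g that z] by (simp add: dist_norm)
    also have "\<dots> \<le> C' * 1" using that \<rho> C by (intro mult_left_mono) (auto simp: dist_norm norm_minus_commute)
    finally show ?thesis using norm_triangle_ineq2[of "g x" "g z"] by simp
  qed
  have "((norm (f z) + C) * C' + C * (norm (g z) + C'))-lipschitz_on (ball z \<rho>) (\<lambda>z. f z * g z)"
  proof (rule lipschitz_onI)
    fix x y assume xy: "x \<in> ball z \<rho>" "y \<in> ball z \<rho>"
    have "f x * g x - f y * g y = f x * (g x - g y) + (f x - f y) * g y" by (simp add: algebra_simps)
    then have "dist (f x * g x) (f y * g y) \<le> norm (f x) * dist (g x) (g y) + dist (f x) (f y) * norm (g y)"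
      unfolding dist_norm by (metis norm_mult norm_triangle_ineq)
    also have "\<dots> \<le> (norm (f z) + C) * (C' * dist x y) + (C * dist x y) * (norm (g z) + C')"
      using xy C by (intro add_mono mult_mono lipschitz_onD[OF f] lipschitz_onD[OF g] bf bg) auto
    finally show "dist (f x * g x) (f y * g y) \<le> ((norm (f z) + C) * C' + C * (norm (g z) + C')) * dist x y"
      by (simp add: algebra_simps)
  qed (use C in auto)
  then show "\<exists>r>0. \<exists>C. C-lipschitz_on (ball z r) (\<lambda>z. f z * g z)" using \<rho> by blast
qed

lemma loc_lip_C1:
  assumes der: "\<And>z. z \<in> U \<Longrightarrow> (f has_derivative D z) (at z)"
    and cont: "continuous_on U (\<lambda>z. D z 1)" "continuous_on U (\<lambda>z. D z \<i>)" and U: "open U"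
  shows "loc_lip U f"
  unfolding loc_lip_def
proof
  fix z assume "z \<in> U"
  then obtain r where r: "r > 0" "cball z r \<subseteq> U" using U open_contains_cball by blast
  have "compact ((\<lambda>w. norm (D w 1) + norm (D w \<i>)) ` cball z r)"
    by (intro compact_continuous_image continuous_intros continuous_on_subset[OF cont(1)]
        continuous_on_subset[OF cont(2)] r) auto
  then obtain B where B: "\<And>w. w \<in> cball z r \<Longrightarrow> norm (D w 1) + norm (D w \<i>) \<le> B"
    by (meson bounded_imp_bdd_above bdd_above.unfold compact_imp_bounded imageI)
  have "B \<ge> 0" using B[of z] r by (smt (verit) centre_in_cball norm_ge_zero)
  have "onorm (D w) \<le> B" if w: "w \<in> cball z r" for w
  proof (rule onorm_bound[OF \<open>B \<ge> 0\<close>])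
    fix v
    have lin: "linear (D w)" using der w r has_derivative_linear by blast
    have "v = Re v *\<^sub>R 1 + Im v *\<^sub>R \<i>" by (simp add: complex_eq_iff)
    then have "D w v = Re v *\<^sub>R D w 1 + Im v *\<^sub>R D w \<i>"
      by (metis lin linear_add linear_scale)
    then have "norm (D w v) \<le> \<bar>Re v\<bar> * norm (D w 1) + \<bar>Im v\<bar> * norm (D w \<i>)"
      by (metis norm_scaleR norm_triangle_ineq)
    also have "\<dots> \<le> norm v * norm (D w 1) + norm v * norm (D w \<i>)"
      by (intro add_mono mult_right_mono abs_Re_le_cmod abs_Im_le_cmod) auto
    also have "\<dots> = (norm (D w 1) + norm (D w \<i>)) * norm v" by (simp add: algebra_simps)
    also have "\<dots> \<le> B * norm v" by (intro mult_right_mono B w) auto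
    finally show "norm (D w v) \<le> B * norm v" .
  qed
  then have "norm (f x - f y) \<le> B * norm (x - y)" if "x \<in> cball z r" "y \<in> cball z r" for x y
    using r that by (intro differentiable_bound[of "cball z r" f D])
      (auto intro!: has_derivative_at_withinI der)
  then have "B-lipschitz_on (ball z r) f"
    using \<open>B \<ge> 0\<close> by (intro lipschitz_onI) (auto simp: dist_norm)
  then show "\<exists>r>0. \<exists>C. C-lipschitz_on (ball z r) f" using r by blast
qed

text \<open>On a slightly larger disc compactness gives a Lipschitz constant. A point outside this disc is at distance at
least 1 from the support, so there the maximum of the function serves as the constant.\<close>

lemma loc_lip_imp_lipschitz:
  assumes "loc_lip UNIV P" and supp: "\<And>z. z \<notin> cball 0 R \<Longrightarrow> P z = 0"
  obtains C where "C-lipschitz_on UNIV P"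
proof -
  let ?K = "cball (0::complex) (R + 1)"
  have "local_lipschitz {0::real} ?K (\<lambda>_. P)"
  proof (rule local_lipschitzI)
    fix t z assume "z \<in> ?K"
    obtain r C where "r > 0" "C-lipschitz_on (ball z r) P"
      using assms(1) unfolding loc_lip_def by blast
    moreover have "cball z (r / 2) \<inter> ?K \<subseteq> ball z r" using \<open>r > 0\<close> by auto
    ultimately have "C-lipschitz_on (cball z (r / 2) \<inter> ?K) P"
      using lipschitz_on_subset by blast
    then show "\<exists>u>0. \<exists>L. \<forall>t\<in>cball t u \<inter> {0}. L-lipschitz_on (cball z u \<inter> ?K) P"
      using \<open>r > 0\<close> by (intro exI[of _ "r / 2"]) auto
  qed
  then obtain L where L: "L-lipschitz_on ?K P"
    using local_lipschitz_compact_implies_lipschitz[where X="?K" and T="{0::real}" and f="\<lambda>_. P"] by auto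
  have "compact (P ` ?K)"
    using compact_continuous_image[OF lipschitz_on_continuous_on[OF L] compact_cball] .
  then have "bounded (P ` ?K)" by (rule compact_imp_bounded)
  then obtain B where "\<forall>x\<in>P ` ?K. norm x \<le> B" by (auto simp: bounded_iff)
  then have B: "norm (P w) \<le> B" if "w \<in> ?K" for w using that by blast
  define C where "C = max L (max B 0)"
  have C: "C \<ge> 0" "L \<le> C" "B \<le> C" by (auto simp: C_def)
  have far: "norm (P x - P y) \<le> C * norm (x - y)" if "y \<notin> ?K" for x y
  proof (cases "x \<in> cball 0 R")
    case True
    have "norm (x - y) \<ge> 1" using that True norm_triangle_ineq2[of y x] by (simp add: norm_minus_commute)
    moreover have "norm (P x - P y) \<le> C" using True that B[of x] supp[of y] C by auto
    ultimately show ?thesis using C by (smt (verit) mult_le_cancel_left1)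
  next
    case False
    then have "P x = 0" "P y = 0" using that supp by auto
    then show ?thesis using C by simp
  qed
  have "C-lipschitz_on UNIV P"
  proof (rule lipschitz_onI)
    fix x y
    show "dist (P x) (P y) \<le> C * dist x y"
    proof (cases "x \<in> ?K \<and> y \<in> ?K")
      case True
      then show ?thesis using lipschitz_onD[OF L, of x y] C
        by (meson dual_order.trans mult_right_mono zero_le_dist)
    next
      case False
      then show ?thesis using far[of x y] far[of y x] by (auto simp: dist_norm norm_minus_commute)
    qed
  qed (use C in auto)
  then show ?thesis by (rule that)
qed

text \<open>Apply the vanishing of the integral of a derivative to the Lipschitz function \<open>f * \<phi>\<close>, extended by 0, and
expand with the product rule.\<close>

lemma weak_derivative_piecewise:
  fixes f :: "complex \<Rightarrow> complex"
  assumes U: "open U" and f: "loc_lip U f" and N: "N \<in> null_sets lebesgue"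
    and der: "\<And>z. z \<in> U - N \<Longrightarrow> (f has_derivative D z) (at z)"
    and g: "\<And>z. z \<in> U - N \<Longrightarrow> g z = wirt s (D z)"
    and \<phi>: "\<And>z. (\<phi> has_derivative E z) (at z)" "continuous_on UNIV (\<lambda>z. E z 1)" "continuous_on UNIV (\<lambda>z. E z \<i>)"
    and K: "compact K" "K \<subseteq> U" "\<And>z. z \<notin> K \<Longrightarrow> \<phi> z = 0"
  shows "(LINT z:U|lebesgue. f z * wirt s (E z)) = - (LINT z:U|lebesgue. g z * \<phi> z)"
    and "set_integrable lebesgue U (\<lambda>z. g z * \<phi> z)"
proof -
  define P where "P z = f z * \<phi> z" for z
  obtain R where R: "K \<subseteq> cball 0 R" 
    using compact_imp_bounded[OF K(1)] by (auto simp: bounded_iff subset_iff)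
  have openK: "open (- K)" using K(1) compact_imp_closed by blast
  have E0: "E z = (\<lambda>v. 0)" if "z \<notin> K" for z
  proof -
    have "(\<phi> has_derivative (\<lambda>v. 0)) (at z)"
      by (rule has_derivative_transform_within_open[OF _ openK, of "\<lambda>_. 0"]) (use that K(3) in auto)
    then show ?thesis using \<phi>(1) has_derivative_unique by blast
  qed
  have "loc_lip U P"
    unfolding P_def
    by (rule loc_lip_mult[OF f]) (use loc_lip_C1[OF _ \<phi>(2,3)] \<phi>(1) in \<open>auto simp: loc_lip_def\<close>)
  moreover have "loc_lip (- K) P"
    unfolding loc_lip_def
  proof
    fix z assume "z \<in> - K"
    then obtain r where "r > 0" "ball z r \<subseteq> - K" using openK open_contains_ball by blast
    then have "0-lipschitz_on (ball z r) P"
      using K(3) by (intro lipschitz_onI) (auto simp: P_def subset_iff)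
    then show "\<exists>r>0. \<exists>C. C-lipschitz_on (ball z r) P" using \<open>r > 0\<close> by blast
  qed
  ultimately have "loc_lip UNIV P" using K(2) unfolding loc_lip_def by blast
  then obtain C where C: "C-lipschitz_on UNIV P"
    using loc_lip_imp_lipschitz[of P R] R K(3) by (auto simp: P_def subset_iff)
  have supp: "P z = 0" if "z \<notin> cball 0 R" for z using that R K(3) by (auto simp: P_def subset_iff)
  define F where "F z v = (if z \<in> U then f z * E z v + D z v * \<phi> z else 0)" for z v
  have derP: "(P has_derivative F z) (at z)" if "z \<notin> N" for z
  proof (cases "z \<in> U")
    case True
    then show ?thesis using der[of z] that \<phi>(1)[of z]
      unfolding P_def F_def by (auto intro!: derivative_eq_intros ext simp: algebra_simps)
  next
    case False
    then have "z \<in> - K" using K by auto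
    have "(P has_derivative (\<lambda>v. 0)) (at z)"
      by (rule has_derivative_transform_within_open[OF _ openK \<open>z \<in> - K\<close>, of "\<lambda>_. 0"]) (use K(3) in \<open>auto simp: P_def\<close>)
    moreover have "F z = (\<lambda>v. 0)" using False by (simp add: F_def fun_eq_iff)
    ultimately show ?thesis by simp
  qed
  have I: "integrable lebesgue (\<lambda>z. F z v)" "(LINT z|lebesgue. F z v) = 0" for v
    using integral_derivative_eq_0[OF C supp N derP, where g = "\<lambda>z. F z v" and v = v] by auto
  then have I2: "integrable lebesgue (\<lambda>z. wirt s (F z))" "(LINT z|lebesgue. wirt s (F z)) = 0"
    by (simp_all add: wirt_def)
  have contf: "continuous_on U f"
    unfolding continuous_on_eq_continuous_at[OF U]
  proof
    fix z assume "z \<in> U"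
    then obtain r C where "r > 0" "C-lipschitz_on (ball z r) f" using f by (auto simp: loc_lip_def)
    then show "isCont f z" 
      using lipschitz_on_continuous_on continuous_on_eq_continuous_at[of "ball z r" f] by auto
  qed
  have J: "set_integrable lebesgue U (\<lambda>z. f z * wirt s (E z))"
  proof -
    have "continuous_on K (\<lambda>z. f z * wirt s (E z))"
      unfolding wirt_def using K(2)
      by (intro continuous_intros continuous_on_subset[OF contf] continuous_on_subset[OF \<phi>(2)] continuous_on_subset[OF \<phi>(3)]) auto
    then have "integrable lborel (\<lambda>z. indicator K z *\<^sub>R (f z * wirt s (E z)))"
      by (intro borel_integrable_compact K(1))
    then have "integrable lebesgue (\<lambda>z. indicator K z *\<^sub>R (f z * wirt s (E z)))"
      using integrable_completion borel_measurable_integrable by blast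
    also have "(\<lambda>z. indicator K z *\<^sub>R (f z * wirt s (E z))) = (\<lambda>z. indicator U z *\<^sub>R (f z * wirt s (E z)))"
      using K(2) E0 by (auto simp: fun_eq_iff indicator_def wirt_def)
    finally show ?thesis unfolding set_integrable_def .
  qed
  define G where "G z = wirt s (F z) - indicator U z *\<^sub>R (f z * wirt s (E z))" for z
  have G: "integrable lebesgue G" "(LINT z|lebesgue. G z) = - (LINT z:U|lebesgue. f z * wirt s (E z))"
    using I2 J unfolding G_def set_integrable_def set_lebesgue_integral_def by simp_all
  have ae: "AE z in lebesgue. G z = indicator U z *\<^sub>R (g z * \<phi> z)"
  proof -
    have "G z = indicator U z *\<^sub>R (g z * \<phi> z)" if "z \<notin> N" for z
      using that g[of z] by (auto simp: G_def F_def indicator_def wirt_def algebra_simps add_divide_distrib)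
    then show ?thesis by (intro AE_I'[OF N]) auto
  qed
  have mG: "G \<in> borel_measurable lebesgue" using G(1) by (rule borel_measurable_integrable)
  have m: "(\<lambda>z. indicator U z *\<^sub>R (g z * \<phi> z)) \<in> borel_measurable lebesgue"
    by (rule borel_measurable_AE[OF mG ae])
  have "(LINT z|lebesgue. G z) = (LINT z:U|lebesgue. g z * \<phi> z)"
    unfolding set_lebesgue_integral_def by (rule integral_cong_AE[OF mG m ae])
  moreover have "integrable lebesgue (\<lambda>z. indicator U z *\<^sub>R (g z * \<phi> z))"
    using integrable_cong_AE[OF mG m ae] G(1) by blast
  ultimately show "set_integrable lebesgue U (\<lambda>z. g z * \<phi> z)"
    "(LINT z:U|lebesgue. f z * wirt s (E z)) = - (LINT z:U|lebesgue. g z * \<phi> z)"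
    using G(2) by (simp add: set_integrable_def, metis minus_minus)
qed

section \<open>Trigonometric polynomials on a square\<close>

text \<open>The transfer of Fubini's theorem for the plane from pairs of reals to complex numbers.\<close>

lemma lborel_complex_eq_distr:
  "(lborel :: complex measure) = distr (lborel \<Otimes>\<^sub>M lborel) borel (\<lambda>(x, y). Complex x y)"
proof (rule lborel_eqI)
  let ?f = "\<lambda>(x, y). Complex x y"
  have "continuous_on UNIV ?f"
    by (auto simp: Complex_eq case_prod_beta intro!: continuous_intros)
  then have [measurable]: "?f \<in> borel_measurable (lborel \<Otimes>\<^sub>M lborel)"
    using borel_measurable_continuous_onI by (simp add: lborel_prod)
  fix l u :: complex
  assume le: "\<And>b. b \<in> Basis \<Longrightarrow> l \<bullet> b \<le> u \<bullet> b"
  have "?f -` box l u \<inter> space (lborel \<Otimes>\<^sub>M lborel) = box (Re l) (Re u) \<times> box (Im l) (Im u)"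
    by (auto simp: space_pair_measure box_def Basis_complex_def)
  then have "emeasure (distr (lborel \<Otimes>\<^sub>M lborel) borel ?f) (box l u) =
      emeasure (lborel \<Otimes>\<^sub>M lborel) (box (Re l) (Re u) \<times> box (Im l) (Im u))"
    by (simp add: emeasure_distr)
  also have "\<dots> = emeasure lborel (box (Re l) (Re u)) * emeasure lborel (box (Im l) (Im u))"
    by (intro lborel.emeasure_pair_measure_Times) auto
  also have "\<dots> = ennreal ((Re u - Re l) * (Im u - Im l))"
    using le[of 1] le[of \<i>] by (simp add: Basis_complex_def box_real ennreal_mult)
  also have "\<dots> = (\<Prod>b\<in>Basis. (u - l) \<bullet> b)"
    by (simp add: Basis_complex_def)
  finally show "emeasure (distr (lborel \<Otimes>\<^sub>M lborel) borel ?f) (box l u) = (\<Prod>b\<in>Basis. (u - l) \<bullet> b)" .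
qed simp

definition square :: "real \<Rightarrow> complex set" where
  "square L = {z. \<bar>Re z\<bar> < L \<and> \<bar>Im z\<bar> < L}"

lemma square_eq_box: "square L = box (Complex (-L) (-L)) (Complex L L)"
  by (auto simp: square_def box_def Basis_complex_def)

lemma square_measurable [measurable]: "square L \<in> sets borel" "square L \<in> sets lebesgue"
  by (auto simp: square_eq_box)

lemma cball_subset_square:
  assumes "r < L" shows "cball 0 r \<subseteq> square L"
proof
  fix z :: complex assume "z \<in> cball 0 r"
  then show "z \<in> square L"
    using assms abs_Re_le_cmod[of z] abs_Im_le_cmod[of z] by (simp add: square_def)
qed

lemma emeasure_square: 
  assumes "L > 0" shows "emeasure lebesgue (square L) = ennreal (4 * L\<^sup>2)"
proof -
  have "emeasure lborel (box (Complex (-L) (-L)) (Complex L L)) = (\<Prod>b\<in>Basis. (Complex L L - Complex (-L) (-L)) \<bullet> b)"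
    by (rule emeasure_lborel_box) (use assms in \<open>auto simp: Basis_complex_def\<close>)
  then show ?thesis using assms by (simp add: square_eq_box Basis_complex_def power2_eq_square)
qed

definition trig :: "real \<Rightarrow> int \<times> int \<Rightarrow> complex \<Rightarrow> complex" where
  "trig L k z = cis (pi / L * (of_int (fst k) * Re z + of_int (snd k) * Im z))"

lemma norm_trig [simp]: "norm (trig L k z) = 1"
  by (simp add: trig_def)

lemma trig_0 [simp]: "trig L (0, 0) z = 1"
  by (simp add: trig_def)

lemma trig_mult: "trig L j z * trig L k z = trig L (j + k) z"
  by (simp add: trig_def cis_mult algebra_simps)

lemma cnj_trig: "cnj (trig L k z) = trig L (- k) z"
  by (simp add: trig_def cis_cnj algebra_simps)

lemma continuous_trig [continuous_intros]: "continuous_on A (trig L k)"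
  unfolding trig_def by (intro continuous_intros)

lemma integral_cis_period:
  assumes "L > 0" "m \<noteq> 0"
  shows "(LINT x|lborel. indicator {-L..L} x *\<^sub>R cis (pi / L * (of_int m * x))) = 0"
proof -
  define c where "c = pi / L * of_int m"
  have c: "c \<noteq> 0" using assms by (simp add: c_def)
  have "((\<lambda>x. cis (c * x) / (\<i> * c)) has_vector_derivative cis (c * x)) (at x within {- L..L})" for x
  proof -
    have "((\<lambda>w. exp (\<i> * of_real c * w) / (\<i> * c)) has_field_derivative exp (\<i> * of_real c * of_real x)) (at (of_real x))"
      using c by (auto intro!: derivative_eq_intros)
    then have "((\<lambda>x. exp (\<i> * of_real c * of_real x) / (\<i> * c)) has_vector_derivative exp (\<i> * of_real c * of_real x)) (at x within {- L..L})"
      by (rule has_vector_derivative_real_field[THEN has_vector_derivative_at_within])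
    then show ?thesis by (simp add: cis_conv_exp mult.assoc)
  qed
  moreover have "continuous_on {-L..L} (\<lambda>x. cis (c * x))" by (intro continuous_intros)
  ultimately have "(LINT x|lborel. indicator {-L..L} x *\<^sub>R cis (c * x))
      = cis (c * L) / (\<i> * c) - cis (c * (-L)) / (\<i> * c)"
    using assms by (intro integral_FTC_atLeastAtMost) linarith+
  also have "cis (c * L) = cis (c * (-L))"
  proof -
    have "cis (c * L) = cis (c * (-L) + 2 * pi * of_int m)"
      using assms by (simp add: c_def field_simps)
    also have "\<dots> = cis (c * (-L)) * cis (2 * pi * of_int m)" by (simp only: cis_mult)
    finally show ?thesis by (simp add: cis_multiple_2pi)
  qed
  finally show ?thesis by (simp add: c_def mult.assoc)
qed

lemma integral_trig_eq_0:
  assumes L: "L > 0" and k: "k \<noteq> (0, 0)"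
  shows "(LINT z:square L|lebesgue. trig L k z) = 0"
proof -
  obtain m n where mn: "k = (m, n)" by (cases k)
  let ?e = "\<lambda>m x. indicator {-L..L} x *\<^sub>R cis (pi / L * (of_int m * x))"
  let ?F = "\<lambda>z. indicator (cbox (Complex (-L) (-L)) (Complex L L)) z *\<^sub>R trig L k z"
  have [measurable]: "trig L k \<in> borel_measurable borel"
    by (intro borel_measurable_continuous_onI continuous_intros)
  have "(\<lambda>(x, y). Complex x y) \<in> borel_measurable (borel :: (real \<times> real) measure)"
    by (intro borel_measurable_continuous_onI) (auto simp: Complex_eq case_prod_beta intro!: continuous_intros)
  then have [measurable]: "(\<lambda>(x, y). Complex x y) \<in> borel_measurable (lborel \<Otimes>\<^sub>M lborel)"
    by (simp add: lborel_prod)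
  have [measurable]: "?F \<in> borel_measurable borel" by measurable
  have eq: "(\<lambda>p. ?F (case p of (x, y) \<Rightarrow> Complex x y)) = (\<lambda>(x, y). ?e m x * ?e n y)"
  proof (rule ext, safe)
    fix x y :: real
    have "Complex x y \<in> cbox (Complex (-L) (-L)) (Complex L L) \<longleftrightarrow> x \<in> {-L..L} \<and> y \<in> {-L..L}"
      by (auto simp: cbox_def Basis_complex_def)
    then show "?F (Complex x y) = ?e m x * ?e n y"
      by (cases "x \<in> {-L..L}"; cases "y \<in> {-L..L}")
         (simp_all add: mn trig_def cis_mult distrib_left del: atLeastAtMost_iff)
  qed
  have intF: "integrable lborel ?F"
    by (intro borel_integrable_compact continuous_intros) auto
  have "(LINT z:square L|lebesgue. trig L k z) = (LINT z|lborel. indicator (square L) z *\<^sub>R trig L k z)"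
    unfolding set_lebesgue_integral_def by (intro integral_completion) measurable
  also have "\<dots> = (LINT z|lborel. ?F z)"
  proof (intro integral_cong_AE)
    have "AE z in lborel. z \<notin> frontier (cbox (Complex (-L) (-L)) (Complex L L))"
    proof (rule AE_not_in)
      have "negligible (frontier (cbox (Complex (-L) (-L)) (Complex L L)))"
        by (intro negligible_convex_frontier) simp
      then have "emeasure lebesgue (frontier (cbox (Complex (-L) (-L)) (Complex L L))) = 0"
        by (simp add: negligible_iff_null_sets null_sets_def)
      then show "frontier (cbox (Complex (-L) (-L)) (Complex L L)) \<in> null_sets lborel"
        by (auto simp: null_sets_def)
    qed
    then show "AE z in lborel. indicator (square L) z *\<^sub>R trig L k z = ?F z"
      by eventually_elim (auto simp: square_eq_box frontier_def interior_cbox indicator_def 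
          dest: subsetD[OF box_subset_cbox])
  qed auto
  also have "\<dots> = (LINT z|distr (lborel \<Otimes>\<^sub>M lborel) borel (\<lambda>(x, y). Complex x y). ?F z)"
    using lborel_complex_eq_distr by (rule arg_cong[where f = "\<lambda>M. integral\<^sup>L M ?F"])
  also have "\<dots> = (LINT p|(lborel \<Otimes>\<^sub>M lborel). ?F (case p of (x, y) \<Rightarrow> Complex x y))"
    by (intro integral_distr) measurable
  also have "\<dots> = integral\<^sup>L (lborel \<Otimes>\<^sub>M lborel) (\<lambda>(x, y). ?e m x * ?e n y)"
    by (simp only: eq)
  also have "\<dots> = (LINT x|lborel. LINT y|lborel. ?e m x * ?e n y)"
  proof -
    have "integrable (distr (lborel \<Otimes>\<^sub>M lborel) borel (\<lambda>(x, y). Complex x y)) ?F"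
      using intF by (simp only: lborel_complex_eq_distr[symmetric])
    then have "integrable (lborel \<Otimes>\<^sub>M lborel) (\<lambda>p. ?F (case p of (x, y) \<Rightarrow> Complex x y))"
      by (rule integrable_distr[rotated]) measurable
    then have "integrable (lborel \<Otimes>\<^sub>M lborel) (\<lambda>(x, y). ?e m x * ?e n y)"
      by (simp only: eq)
    from lborel_pair.integral_fst'[OF this] show ?thesis by simp
  qed
  also have "\<dots> = (LINT x|lborel. ?e m x) * (LINT y|lborel. ?e n y)"
    by (simp only: integral_mult_right_zero integral_mult_left_zero)
  also have "\<dots> = 0"
    using integral_cis_period[OF L, of m] integral_cis_period[OF L, of n] k mn by auto
  finally show ?thesis .
qed

definition trig_polys :: "real \<Rightarrow> (complex \<Rightarrow> complex) set" where
  "trig_polys L = {P. \<exists>I c. finite I \<and> P = (\<lambda>z. \<Sum>k\<in>I. c k * trig L k z)}"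

lemma trig_polysI: "finite I \<Longrightarrow> P = (\<lambda>z. \<Sum>k\<in>I. c k * trig L k z) \<Longrightarrow> P \<in> trig_polys L"
  unfolding trig_polys_def by blast

lemma trig_polys_monom: "(\<lambda>z. a * trig L k z) \<in> trig_polys L"
  by (rule trig_polysI[of "{k}" _ "\<lambda>_. a"]) auto

lemma trig_polys_trig: "trig L k \<in> trig_polys L"
  using trig_polys_monom[of 1 L k] by simp

lemma trig_polys_const: "(\<lambda>z. a) \<in> trig_polys L"
  using trig_polys_monom[of a L "(0, 0)"] by simp

lemma trig_polys_add:
  assumes "P \<in> trig_polys L" "Q \<in> trig_polys L"
  shows "(\<lambda>z. P z + Q z) \<in> trig_polys L"
proof -
  obtain I c J d where *: "finite I" "P = (\<lambda>z. \<Sum>k\<in>I. c k * trig L k z)"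
    "finite J" "Q = (\<lambda>z. \<Sum>k\<in>J. d k * trig L k z)"
    using assms by (auto simp: trig_polys_def)
  let ?a = "\<lambda>k. (if k \<in> I then c k else 0) + (if k \<in> J then d k else 0)"
  have "P z + Q z = (\<Sum>k\<in>I \<union> J. ?a k * trig L k z)" for z
  proof -
    have "P z = (\<Sum>k\<in>I \<union> J. (if k \<in> I then c k else 0) * trig L k z)"
      unfolding * by (intro sum.mono_neutral_cong_left) (use * in auto)
    moreover have "Q z = (\<Sum>k\<in>I \<union> J. (if k \<in> J then d k else 0) * trig L k z)"
      unfolding * by (intro sum.mono_neutral_cong_left) (use * in auto)
    ultimately show ?thesis by (simp add: sum.distrib distrib_right)
  qed
  then show ?thesis using * by (intro trig_polysI[of "I \<union> J" _ ?a]) auto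
qed

lemma trig_polys_sum:
  assumes "\<And>i. i \<in> I \<Longrightarrow> P i \<in> trig_polys L"
  shows "(\<lambda>z. \<Sum>i\<in>I. P i z) \<in> trig_polys L"
  using assms
  by (induction I rule: infinite_finite_induct) (auto simp: trig_polys_const trig_polys_add)

lemma trig_polys_mult:
  assumes "P \<in> trig_polys L" "Q \<in> trig_polys L"
  shows "(\<lambda>z. P z * Q z) \<in> trig_polys L"
proof -
  obtain I c J d where *: "finite I" "P = (\<lambda>z. \<Sum>k\<in>I. c k * trig L k z)"
    "finite J" "Q = (\<lambda>z. \<Sum>k\<in>J. d k * trig L k z)"
    using assms by (auto simp: trig_polys_def)
  have "(c i * trig L i z) * (d j * trig L j z) = (c i * d j) * trig L (i + j) z" for i j z
    by (simp add: trig_mult[symmetric])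
  then have "(\<lambda>z. P z * Q z) = (\<lambda>z. \<Sum>i\<in>I. \<Sum>j\<in>J. (c i * d j) * trig L (i + j) z)"
    by (simp only: * sum_product)
  then show ?thesis by (simp only:) (intro trig_polys_sum trig_polys_monom)
qed

lemma trig_polys_continuous: "P \<in> trig_polys L \<Longrightarrow> continuous_on A P"
  by (auto simp: trig_polys_def intro!: continuous_intros)

lemma real_polynomial_function_trig:
  assumes "real_polynomial_function (r :: complex \<times> complex \<Rightarrow> real)"
  shows "(\<lambda>z. complex_of_real (r (trig L (1, 0) z, trig L (0, 1) z))) \<in> trig_polys L"
  using assms
proof induction
  case (linear f)
  have Re: "complex_of_real (Re (trig L k z)) = (1/2) * trig L k z + (1/2) * trig L (-k) z" for k z
    by (simp add: cnj_trig[symmetric] complex_eq_iff)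
  have Im: "complex_of_real (Im (trig L k z)) = (-\<i>/2) * trig L k z + (\<i>/2) * trig L (-k) z" for k z
    by (simp add: cnj_trig[symmetric] complex_eq_iff)
  define c1 c2 c3 c4 where "c1 = f (1, 0)" and "c2 = f (\<i>, 0)" and "c3 = f (0, 1)" and "c4 = f (0, \<i>)"
  have "f (u, v) = Re u * c1 + Im u * c2 + Re v * c3 + Im v * c4" for u v
  proof -
    have lin: "linear f" using linear by (simp add: bounded_linear.linear)
    have "(u, v) = Re u *\<^sub>R (1, 0) + Im u *\<^sub>R (\<i>, 0) + Re v *\<^sub>R (0, 1) + Im v *\<^sub>R (0, \<i>)"
      by (simp add: complex_eq_iff)
    then have "f (u, v) = f (Re u *\<^sub>R (1, 0) + Im u *\<^sub>R (\<i>, 0) + Re v *\<^sub>R (0, 1) + Im v *\<^sub>R (0, \<i>))"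
      by (rule arg_cong)
    also have "\<dots> = Re u * c1 + Im u * c2 + Re v * c3 + Im v * c4"
      unfolding c1_def c2_def c3_def c4_def by (simp only: linear_add[OF lin] linear_scale[OF lin] real_scaleR_def)
    finally show ?thesis .
  qed
  then have "(\<lambda>z. complex_of_real (f (trig L (1, 0) z, trig L (0, 1) z))) = (\<lambda>z.
      complex_of_real (Re (trig L (1,0) z)) * of_real c1 + of_real (Im (trig L (1,0) z)) * of_real c2 +
      of_real (Re (trig L (0,1) z)) * of_real c3 + of_real (Im (trig L (0,1) z)) * of_real c4)"
    by simp
  then show ?case
    unfolding Re Im by (simp only:) (intro trig_polys_add trig_polys_mult trig_polys_trig trig_polys_const)
next
  case (const c)
  then show ?case by (simp add: trig_polys_const)
next
  case (add f g)
  then show ?case by (simp add: trig_polys_add)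
next
  case (mult f g)
  then show ?case by (simp add: trig_polys_mult)
qed

text \<open>The square with opposite sides identified is the torus \<open>S\<^sup>1 \<times> S\<^sup>1\<close>. Since \<open>g\<close> vanishes near the boundary of the
square, it is a continuous function on the torus, and Stone-Weierstrass yields a polynomial in the four real
coordinates there, that is, a trigonometric polynomial.\<close>

lemma trig_uniform_dense:
  assumes g: "continuous_on UNIV g" "\<And>z. z \<notin> cball 0 r \<Longrightarrow> g z = 0" 
    and r: "0 < r" "r < L" and e: "e > 0"
  shows "\<exists>P\<in>trig_polys L. \<forall>z\<in>square L. norm (g z - P z) < e"
proof -
  \<comment> \<open>The inverse of the parametrisation of the torus by the square; it jumps where a coordinate is -1.\<close>
  define h where "h w = Complex (L / pi * Arg (fst w)) (L / pi * Arg (snd w))" for w :: "complex \<times> complex"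
  define T where "T = sphere (0::complex) 1 \<times> sphere (0::complex) 1"
  have T: "compact T" by (simp add: T_def compact_Times)
  define \<rho> where "\<rho> = cos (pi * r / L)"
  \<comment> \<open>On A the map h is continuous; on B the value of h lies outside the support of g.
      These two open sets cover the torus.\<close>
  define A where "A = {w :: complex \<times> complex. fst w \<notin> \<real>\<^sub>\<le>\<^sub>0 \<and> snd w \<notin> \<real>\<^sub>\<le>\<^sub>0}"
  define B where "B = {w :: complex \<times> complex. Re (fst w) < \<rho> \<or> Re (snd w) < \<rho>}"
  have \<rho>: "-1 < \<rho>"
  proof -
    have "cos pi < cos (pi * r / L)" using r by (intro cos_monotone_0_pi) (auto simp: field_simps)
    then show ?thesis by (simp add: \<rho>_def)
  qed
  have Arg: "\<bar>L / pi * Arg u\<bar> > r" if "norm u = 1" "Re u < \<rho>" for u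
  proof (rule ccontr)
    assume "\<not> ?thesis"
    then have "\<bar>Arg u\<bar> \<le> pi * r / L" using r by (simp add: abs_mult field_simps)
    moreover have "pi * r / L \<le> pi" using r by (simp add: field_simps)
    ultimately have "cos (pi * r / L) \<le> cos \<bar>Arg u\<bar>"
      by (intro cos_monotone_0_pi_le) auto
    moreover have "cis (Arg u) = u"
      using that cis_Arg[of u] by (force simp: sgn_div_norm)
    then have "cos (Arg u) = Re u" by (metis cis.sel(1))
    ultimately show False using that by (simp add: \<rho>_def)
  qed
  have zeroB: "g (h w) = 0" if "w \<in> B \<inter> T" for w
  proof (rule g(2))
    have "norm (h w) > r"
      using that Arg[of "fst w"] Arg[of "snd w"] abs_Re_le_cmod[of "h w"] abs_Im_le_cmod[of "h w"]
      by (auto simp: B_def T_def h_def)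
    then show "h w \<notin> cball 0 r" by simp
  qed
  have cont: "continuous_on T (\<lambda>w. g (h w))"
  proof -
    have "open A"
    proof -
      have "A = (- \<real>\<^sub>\<le>\<^sub>0) \<times> (- \<real>\<^sub>\<le>\<^sub>0)" by (auto simp: A_def)
      then show ?thesis by (auto intro!: open_Times)
    qed
    have "open B"
      unfolding B_def by (intro open_Collect_disj open_Collect_less continuous_intros)
    have "continuous_on (T \<inter> A) (\<lambda>w. g (h w))"
      unfolding h_def
      by (intro continuous_on_compose2[OF g(1)]) (auto simp: A_def Complex_eq intro!: continuous_intros)
    moreover have "continuous_on (T \<inter> B) (\<lambda>w. g (h w))"
      by (rule continuous_on_eq[OF continuous_on_const[of _ 0]]) (use zeroB in auto)
    moreover have "T \<subseteq> A \<union> B"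
    proof
      fix w assume w: "w \<in> T"
      have *: "Re u < \<rho>" if "norm u = 1" "u \<in> \<real>\<^sub>\<le>\<^sub>0" for u
      proof -
        have "u = -1" using that by (auto elim!: nonpos_Reals_cases)
        then show ?thesis using \<rho> by simp
      qed
      show "w \<in> A \<union> B" using w *[of "fst w"] *[of "snd w"] by (auto simp: T_def A_def B_def)
    qed
    moreover from this have T: "(T \<inter> A) \<union> (T \<inter> B) = T" by blast
    moreover have "openin (top_of_set T) (T \<inter> A)" "openin (top_of_set T) (T \<inter> B)"
      using \<open>open A\<close> \<open>open B\<close> by (auto intro: openin_open_Int)
    ultimately show ?thesis
      using continuous_on_cases_local_open[of "T \<inter> A" "T \<inter> B" "\<lambda>w. g (h w)" "\<lambda>w. g (h w)" "\<lambda>_. True"]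
      by simp
  qed
  then obtain p where p: "polynomial_function p" "\<And>w. w \<in> T \<Longrightarrow> norm (g (h w) - p w) < e"
    using Stone_Weierstrass_polynomial_function[OF T cont e] by metis
  define P where "P z = p (trig L (1, 0) z, trig L (0, 1) z)" for z
  have re: "real_polynomial_function (\<lambda>w. Re (p w))" and im: "real_polynomial_function (\<lambda>w. Im (p w))"
    using p(1) bounded_linear_Re bounded_linear_Im by (auto simp: polynomial_function_def o_def)
  have A: "(\<lambda>z. of_real (Re (P z))) \<in> trig_polys L" and B: "(\<lambda>z. of_real (Im (P z))) \<in> trig_polys L"
    unfolding P_def by (rule real_polynomial_function_trig[OF re], rule real_polynomial_function_trig[OF im])
  have "(\<lambda>z. of_real (Re (P z)) + \<i> * of_real (Im (P z))) \<in> trig_polys L"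
    by (rule trig_polys_add[OF A trig_polys_mult[OF trig_polys_const B]])
  then have "P \<in> trig_polys L" by (simp only: complex_eq[symmetric])
  moreover have "norm (g z - P z) < e" if "z \<in> square L" for z
  proof -
    have Arg_cis: "L / pi * Arg (cis (pi / L * x)) = x" if "\<bar>x\<bar> < L" for x
    proof -
      have "Arg (cis (pi / L * x)) = pi / L * x"
      proof (rule Arg_cis)
        have "pi * x < pi * L" "pi * (-L) < pi * x"
          using that by (intro mult_strict_left_mono; simp add: abs_less_iff)+
        then show "pi / L * x \<in> {- pi<..pi}" using r by (simp add: field_simps)
      qed
      then show ?thesis using r by simp
    qed
    have "h (trig L (1, 0) z, trig L (0, 1) z) = z"
      using that Arg_cis[of "Re z"] Arg_cis[of "Im z"] by (simp add: h_def trig_def square_def complex_eq_iff)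
    then show ?thesis using p(2)[of "(trig L (1, 0) z, trig L (0, 1) z)"] by (simp add: P_def T_def)
  qed
  ultimately show ?thesis by blast
qed

lemma norm_add_sq_le3:
  fixes a b c :: complex
  shows "(norm (a + b + c))\<^sup>2 \<le> 3 * ((norm a)\<^sup>2 + (norm b)\<^sup>2 + (norm c)\<^sup>2)"
proof -
  have "norm (a + b + c) \<le> norm a + norm b + norm c"
    by (meson add_mono_thms_linordered_semiring(3) norm_triangle_ineq norm_triangle_le order_trans)
  then have "(norm (a + b + c))\<^sup>2 \<le> (norm a + norm b + norm c)\<^sup>2"
    by (simp add: power_mono)
  also have "\<dots> \<le> 3 * ((norm a)\<^sup>2 + (norm b)\<^sup>2 + (norm c)\<^sup>2)"
    using sum_squares_ge_zero[of "norm a - norm b" "norm b - norm c"] zero_le_square[of "norm a - norm c"]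
    by (simp add: power2_eq_square algebra_simps)
  finally show ?thesis .
qed

text \<open>Truncation, then continuous approximation, then uniform trigonometric approximation. Each of the three errors
is kept below \<open>e / 9\<close> in square mean, which the inequality \<open>|a + b + c|\<^sup>2 \<le> 3 (|a|\<^sup>2 + |b|\<^sup>2 + |c|\<^sup>2)\<close> absorbs.\<close>

lemma trig_L2_dense:
  assumes V: "V \<in> borel_measurable lebesgue" "integrable lebesgue (\<lambda>z. (norm (V z))\<^sup>2)"
    and supp: "\<And>z. z \<notin> cball 0 r \<Longrightarrow> V z = 0" and r: "0 < r" "r < L" and e: "e > 0"
  shows "\<exists>P\<in>trig_polys L. (LINT z:square L|lebesgue. (norm (V z - P z))\<^sup>2) < e"
proof -
  note [measurable] = V(1)
  define W where "W n z = (if norm (V z) \<le> real (Suc n) then V z else 0)" for n z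
  have [measurable]: "W n \<in> borel_measurable lebesgue" for n
    unfolding W_def by measurable
  have "(\<lambda>n. LINT z|lebesgue. (norm (V z - W n z))\<^sup>2) \<longlonglongrightarrow> (LINT (z::complex)|lebesgue. (0::real))"
  proof (rule integral_dominated_convergence[where w = "\<lambda>z. (norm (V z))\<^sup>2" and M = lebesgue and f = "\<lambda>_. 0::real"
        and s = "\<lambda>n z. (norm (V z - W n z))\<^sup>2"])
    show "integrable lebesgue (\<lambda>z. (norm (V z))\<^sup>2)" by (rule V(2))
  next
    show "AE z in lebesgue. (\<lambda>n. (norm (V z - W n z))\<^sup>2) \<longlonglongrightarrow> 0"
    proof (rule AE_I2)
      fix z
      obtain N where N: "norm (V z) \<le> real N" using real_arch_simple by blast
      have "eventually (\<lambda>n. (norm (V z - W n z))\<^sup>2 = 0) sequentially"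
        using eventually_ge_at_top[of N] by eventually_elim (use N in \<open>auto simp: W_def\<close>)
      then show "(\<lambda>n. (norm (V z - W n z))\<^sup>2) \<longlonglongrightarrow> 0" by (rule tendsto_eventually)
    qed
  qed (auto simp: W_def)
  then have "eventually (\<lambda>n. (LINT z|lebesgue. (norm (V z - W n z))\<^sup>2) < e / 9) sequentially"
    using e by (intro order_tendstoD(2)) auto
  then obtain n where n: "(LINT z|lebesgue. (norm (V z - W n z))\<^sup>2) < e / 9"
    by (auto simp: eventually_sequentially)
  define M where "M = real (Suc n)"
  have M: "M > 0" by (simp add: M_def)
  have Wb: "norm (W n z) \<le> M" for z by (simp add: W_def M_def)
  have Wsupp: "W n z = 0" if "z \<notin> cball 0 r" for z using supp[OF that] by (simp add: W_def)
  have "W n measurable_on UNIV"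
    by (intro lebesgue_measurable_imp_measurable_on) auto
  then obtain N g where Ng: "negligible N" "\<forall>j. continuous_on UNIV (g j)"
      "\<forall>z. z \<notin> N \<longrightarrow> (\<lambda>j. g j z) \<longlonglongrightarrow> (if z \<in> UNIV then W n z else 0)"
    unfolding measurable_on_def by blast
  then have N: "negligible N" and g: "\<And>j. continuous_on UNIV (g j)"
    "\<And>z. z \<notin> N \<Longrightarrow> (\<lambda>j. g j z) \<longlonglongrightarrow> W n z"
    by simp_all
  \<comment> \<open>The continuous functions g j converge almost everywhere to W n without any bound or support condition.
      Clipping at height M and multiplying by the radial cutoff \<tau> restores both and keeps the limit.\<close>
  define clip where "clip w = w * of_real (M / max M (norm w))" for w :: complex
  have clip_cont: "continuous_on UNIV clip"
    unfolding clip_def using M by (intro continuous_intros) auto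
  have clip_b: "norm (clip w) \<le> M" for w
    using M by (auto simp: clip_def norm_mult norm_divide max_def field_simps)
  have clip_id: "clip w = w" if "norm w \<le> M" for w
    using that M by (simp add: clip_def max_def)
  define R where "R = (r + L) / 2"
  have R: "r < R" "R < L" "0 < R" using r by (auto simp: R_def)
  define \<tau> where "\<tau> z = max 0 (min 1 ((R - norm z) / (R - r)))" for z :: complex
  have \<tau>: "0 \<le> \<tau> z" "\<tau> z \<le> 1" for z by (auto simp: \<tau>_def)
  have \<tau>1: "\<tau> z = 1" if "norm z \<le> r" for z using that R by (auto simp: \<tau>_def min_def max_def field_simps)
  have \<tau>0: "\<tau> z = 0" if "norm z > R" for z using that R by (auto simp: \<tau>_def min_def max_def field_simps)
  define G where "G j z = of_real (\<tau> z) * clip (g j z)" for j z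
  have G_cont: "continuous_on UNIV (G j)" for j
    unfolding G_def \<tau>_def using R by (intro continuous_intros continuous_on_compose2[OF clip_cont] g(1)) auto
  then have [measurable]: "G j \<in> borel_measurable lebesgue" for j
    by (intro measurable_completion) (simp add: borel_measurable_continuous_onI)
  have G_supp: "G j z = 0" if "z \<notin> cball 0 R" for j z using that \<tau>0[of z] by (simp add: G_def)
  have G_b: "norm (G j z) \<le> M" for j z
    using \<tau>[of z] clip_b[of "g j z"] by (simp add: G_def norm_mult) (meson clip_b dual_order.trans mult_left_le_one_le norm_ge_zero)
  define w where "w z = (2 * M)\<^sup>2 * indicator (cball (0::complex) R) z" for z
  have w: "integrable lebesgue w"
    unfolding w_def by (intro integrable_mult_right integrable_real_indicator) (auto simp: emeasure_lborel_cball_finite[unfolded infinity_ennreal_def])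
  have WG_b: "(norm (W n z - G j z))\<^sup>2 \<le> w z" for j z
  proof (cases "z \<in> cball 0 R")
    case True
    have "norm (W n z - G j z) \<le> 2 * M" using norm_triangle_ineq4[of "W n z" "G j z"] Wb[of z] G_b[of j z] by linarith
    then have "(norm (W n z - G j z))\<^sup>2 \<le> (2 * M)\<^sup>2" by (intro power_mono) auto
    then show ?thesis using True by (simp add: w_def)
  next
    case False
    moreover have "z \<notin> cball 0 r" using False R by auto
    ultimately show ?thesis using Wsupp[of z] G_supp[of z j] by (simp add: w_def)
  qed
  have lim: "(\<lambda>j. LINT z|lebesgue. (norm (W n z - G j z))\<^sup>2) \<longlonglongrightarrow> (LINT (z::complex)|lebesgue. (0::real))"
  proof (rule integral_dominated_convergence[where w = w])
    show "integrable lebesgue w" by (rule w)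
  next
    have "(\<lambda>j. (norm (W n z - G j z))\<^sup>2) \<longlonglongrightarrow> 0" if "z \<notin> N" for z
    proof -
      have "isCont clip (W n z)" using clip_cont by (simp add: continuous_on_eq_continuous_at)
      then have "(\<lambda>j. G j z) \<longlonglongrightarrow> of_real (\<tau> z) * clip (W n z)"
        unfolding G_def by (intro tendsto_intros isCont_tendsto_compose[OF _ g(2)[OF that]])
      also have "of_real (\<tau> z) * clip (W n z) = W n z"
        unfolding clip_id[OF Wb] using \<tau>1[of z] Wsupp[of z] by (cases "z \<in> cball 0 r") auto
      finally have "(\<lambda>j. norm (W n z - G j z) ^ 2) \<longlonglongrightarrow> norm (W n z - W n z) ^ 2"
        by (intro tendsto_intros)
      then show ?thesis by simp
    qed
    then show "AE z in lebesgue. (\<lambda>j. (norm (W n z - G j z))\<^sup>2) \<longlonglongrightarrow> 0"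
      using N by (intro AE_I'[of N]) (auto simp: negligible_iff_null_sets)
  qed (use WG_b in auto)
  then have "eventually (\<lambda>j. (LINT z|lebesgue. (norm (W n z - G j z))\<^sup>2) < e / 9) sequentially"
    using e by (intro order_tendstoD(2)) auto
  then obtain j where j: "(LINT z|lebesgue. (norm (W n z - G j z))\<^sup>2) < e / 9"
    by (auto simp: eventually_sequentially)
  \<comment> \<open>The uniform error d contributes d^2 times the area 4 L^2 of the square, which is e / 9.\<close>
  define d where "d = sqrt (e / (36 * L\<^sup>2))"
  have d: "d > 0" "d\<^sup>2 = e / (36 * L\<^sup>2)" using e r by (auto simp: d_def)
  obtain P where P: "P \<in> trig_polys L" "\<And>z. z \<in> square L \<Longrightarrow> norm (G j z - P z) < d"
    using trig_uniform_dense[OF G_cont G_supp R(3,2) d(1)] by blast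
  have [measurable]: "P \<in> borel_measurable lebesgue"
    using trig_polys_continuous[OF P(1)] by (intro measurable_completion) (simp add: borel_measurable_continuous_onI)
  have fin: "integrable lebesgue (indicator (square L) :: complex \<Rightarrow> real)"
    using r emeasure_square[of L] by (intro integrable_real_indicator) auto
  define B where "B z = 3 * ((norm (V z - W n z))\<^sup>2 + (norm (W n z - G j z))\<^sup>2 + d\<^sup>2 * indicator (square L) z)" for z
  have i1: "integrable lebesgue (\<lambda>z. (norm (V z - W n z))\<^sup>2)"
    by (rule Bochner_Integration.integrable_bound[OF V(2)]) (auto simp: W_def)
  have i2: "integrable lebesgue (\<lambda>z. (norm (W n z - G j z))\<^sup>2)"
    by (rule Bochner_Integration.integrable_bound[OF w]) (use WG_b[of _ j] in \<open>auto simp: w_def\<close>)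
  have iB: "integrable lebesgue B"
    unfolding B_def by (intro integrable_mult_right Bochner_Integration.integrable_add i1 i2 fin)
  have le: "indicator (square L) z *\<^sub>R (norm (V z - P z))\<^sup>2 \<le> B z" for z
  proof (cases "z \<in> square L")
    case True
    have "(norm (V z - P z))\<^sup>2 = (norm ((V z - W n z) + (W n z - G j z) + (G j z - P z)))\<^sup>2" by simp
    also have "\<dots> \<le> 3 * ((norm (V z - W n z))\<^sup>2 + (norm (W n z - G j z))\<^sup>2 + (norm (G j z - P z))\<^sup>2)"
      by (rule norm_add_sq_le3)
    also have "(norm (G j z - P z))\<^sup>2 \<le> d\<^sup>2"
      using P(2)[OF True] by (intro power_mono) auto
    finally show ?thesis using True by (simp add: B_def)
  qed (simp add: B_def)
  have "(LINT z:square L|lebesgue. (norm (V z - P z))\<^sup>2) \<le> (LINT z|lebesgue. B z)"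
    unfolding set_lebesgue_integral_def
    by (rule integral_mono'[OF iB le]) (simp add: B_def)
  also have "\<dots> = 3 * ((LINT z|lebesgue. (norm (V z - W n z))\<^sup>2) + (LINT z|lebesgue. (norm (W n z - G j z))\<^sup>2)
      + d\<^sup>2 * measure lebesgue (square L))"
    unfolding B_def using i1 i2 fin by simp
  also have "measure lebesgue (square L) = 4 * L\<^sup>2"
    using r emeasure_square[of L] by (simp add: measure_def)
  also have "d\<^sup>2 * (4 * L\<^sup>2) = e / 9" using d r by simp
  also have "3 * ((LINT z|lebesgue. (norm (V z - W n z))\<^sup>2) + (LINT z|lebesgue. (norm (W n z - G j z))\<^sup>2) + e / 9) < e"
    using n j by simp
  finally show ?thesis using P(1) by blast
qed

lemma integrable_of_square_integrable:
  fixes V :: "complex \<Rightarrow> complex"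
  assumes V: "V \<in> borel_measurable lebesgue" "integrable lebesgue (\<lambda>z. (norm (V z))\<^sup>2)"
    and supp: "\<And>z. z \<notin> cball 0 r \<Longrightarrow> V z = 0"
    and P: "P \<in> borel_measurable lebesgue" "\<And>z. norm (P z) \<le> B"
  shows "integrable lebesgue (\<lambda>z. V z * P z)"
proof -
  have "integrable lebesgue (\<lambda>z. B * ((norm (V z))\<^sup>2 + indicator (cball 0 r) z))"
    by (intro integrable_mult_right Bochner_Integration.integrable_add V integrable_real_indicator)
       (auto simp: emeasure_lborel_cball_finite[unfolded infinity_ennreal_def])
  then show ?thesis
  proof (rule Bochner_Integration.integrable_bound)
    have "norm (V z * P z) \<le> norm (B * ((norm (V z))\<^sup>2 + indicator (cball 0 r) z))" for z
    proof (cases "z \<in> cball 0 r")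
      case True
      have "2 * norm (V z) \<le> (norm (V z))\<^sup>2 + 1"
        using zero_le_power2[of "norm (V z) - 1"] by (simp add: power2_eq_square algebra_simps)
      then have "norm (V z) \<le> (norm (V z))\<^sup>2 + 1" using norm_ge_zero[of "V z"] by linarith
      then have "norm (V z) * norm (P z) \<le> ((norm (V z))\<^sup>2 + 1) * B"
        by (intro mult_mono P) auto
      then show ?thesis using True by (simp add: norm_mult mult.commute)
    qed (simp add: supp)
    then show "AE z in lebesgue. norm (V z * P z) \<le> norm (B * ((norm (V z))\<^sup>2 + indicator (cball 0 r) z))"
      by simp
  qed (use V P in measurable)
qed

lemma norm_diff_sq_cnj:
  "(norm (cnj a - b))\<^sup>2 = (norm a)\<^sup>2 + (norm b)\<^sup>2 - 2 * Re (a * b)"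
  by (simp only: cmod_power2) (simp add: power2_eq_square algebra_simps)

text \<open>The expansion of the square, with the orthogonality of the characters. It is stated for \<open>cnj V\<close> because then
the coefficients of \<open>V\<close> appear as integrals against the characters themselves.\<close>

lemma trig_poly_square_distance:
  assumes V: "V \<in> borel_measurable lebesgue" "integrable lebesgue (\<lambda>z. (norm (V z))\<^sup>2)"
    and supp: "\<And>z. z \<notin> cball 0 r \<Longrightarrow> V z = 0" and r: "0 < r" "r < L"
    and I: "finite I"
  shows "(LINT z:square L|lebesgue. (norm (cnj (V z) - (\<Sum>k\<in>I. c k * trig L k z)))\<^sup>2) =
    (LINT z|lebesgue. (norm (V z))\<^sup>2) + 4 * L\<^sup>2 * (\<Sum>k\<in>I. (norm (c k))\<^sup>2)
    - 2 * Re (\<Sum>k\<in>I. c k * (LINT z|lebesgue. V z * trig L k z))"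
proof -
  let ?P = "\<lambda>z. \<Sum>k\<in>I. c k * trig L k z"
  have meas_trig: "trig L k \<in> borel_measurable lebesgue" for k
    using continuous_trig[of UNIV L k] by (intro measurable_completion) (simp add: borel_measurable_continuous_onI)
  have iVt: "integrable lebesgue (\<lambda>z. V z * trig L k z)" for k
    by (rule integrable_of_square_integrable[OF V supp meas_trig, where B = 1]) auto
  have VP: "V z * ?P z = (\<Sum>k\<in>I. c k * (V z * trig L k z))" for z
    by (simp add: sum_distrib_left mult_ac)
  have iVP: "integrable lebesgue (\<lambda>z. V z * ?P z)"
    unfolding VP by (intro Bochner_Integration.integrable_sum integrable_mult_right iVt)
  have VP_int: "(LINT z|lebesgue. V z * ?P z) = (\<Sum>k\<in>I. c k * (LINT z|lebesgue. V z * trig L k z))"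
    unfolding VP by (subst Bochner_Integration.integral_sum) (auto intro!: iVt)
  have it: "set_integrable lebesgue (square L) (\<lambda>z. trig L k z)" for k
    unfolding set_integrable_def
  proof (rule Bochner_Integration.integrable_bound)
    show "integrable lebesgue (indicator (square L) :: complex \<Rightarrow> real)"
      using r emeasure_square[of L] by (intro integrable_real_indicator) auto
  qed (use meas_trig[of k] in \<open>auto simp: indicator_def\<close>)
  have PP: "of_real ((norm (?P z))\<^sup>2) = (\<Sum>j\<in>I. \<Sum>k\<in>I. c j * cnj (c k) * trig L (j - k) z)" for z
  proof -
    have eq: "trig L (j - k) z = trig L j z * cnj (trig L k z)" for j k by (simp add: cnj_trig trig_mult)
    have "of_real ((norm (?P z))\<^sup>2) = ?P z * cnj (?P z)" by (rule complex_norm_square)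
    also have "\<dots> = (\<Sum>j\<in>I. \<Sum>k\<in>I. (c j * trig L j z) * cnj (c k * trig L k z))"
      by (simp only: cnj_sum sum_product)
    also have "\<dots> = (\<Sum>j\<in>I. \<Sum>k\<in>I. c j * cnj (c k) * trig L (j - k) z)"
      by (intro sum.cong refl) (simp add: eq mult_ac)
    finally show ?thesis .
  qed
  have it2: "integrable lebesgue (\<lambda>z. indicator (square L) z *\<^sub>R (a * trig L k z))" for a k
    using set_integrable_mult_right[OF it, of a k] unfolding set_integrable_def .
  have int2: "(LINT z|lebesgue. indicator (square L) z *\<^sub>R (a * trig L k z)) = a * (LINT z:square L|lebesgue. trig L k z)" for a k
    using set_integral_mult_right[of lebesgue "square L" a "trig L k"] unfolding set_lebesgue_integral_def .
  have iPP: "set_integrable lebesgue (square L) (\<lambda>z. complex_of_real ((norm (?P z))\<^sup>2))"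
    unfolding PP set_integrable_def scaleR_sum_right
    by (intro Bochner_Integration.integrable_sum it2)
  have tr: "(LINT z:square L|lebesgue. trig L (j - k) z) = (if j = k then of_real (4 * L\<^sup>2) else 0)" for j k
  proof (cases "j = k")
    case True
    then have "trig L (j - k) z = 1" for z by (simp add: trig_def)
    then show ?thesis using r emeasure_square[of L] True
      by (simp add: set_lebesgue_integral_def measure_def scaleR_conv_of_real)
  next
    case False
    then have "j - k \<noteq> (0, 0)" by (auto simp: prod_eq_iff)
    then show ?thesis using integral_trig_eq_0[of L "j - k"] r False by auto
  qed
  have "(LINT z:square L|lebesgue. complex_of_real ((norm (?P z))\<^sup>2)) =
      (\<Sum>j\<in>I. \<Sum>k\<in>I. c j * cnj (c k) * (LINT z:square L|lebesgue. trig L (j - k) z))"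
  proof -
    have "(LINT z:square L|lebesgue. complex_of_real ((norm (?P z))\<^sup>2)) =
        (LINT z|lebesgue. (\<Sum>j\<in>I. \<Sum>k\<in>I. indicator (square L) z *\<^sub>R (c j * cnj (c k) * trig L (j - k) z)))"
      by (simp only: PP set_lebesgue_integral_def scaleR_sum_right)
    also have "\<dots> = (\<Sum>j\<in>I. (LINT z|lebesgue. (\<Sum>k\<in>I. indicator (square L) z *\<^sub>R (c j * cnj (c k) * trig L (j - k) z))))"
      by (intro Bochner_Integration.integral_sum Bochner_Integration.integrable_sum it2)
    also have "\<dots> = (\<Sum>j\<in>I. \<Sum>k\<in>I. (LINT z|lebesgue. indicator (square L) z *\<^sub>R (c j * cnj (c k) * trig L (j - k) z)))"
      by (intro sum.cong refl Bochner_Integration.integral_sum it2)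
    finally show ?thesis by (simp only: int2)
  qed
  also have "\<dots> = of_real (4 * L\<^sup>2 * (\<Sum>k\<in>I. (norm (c k))\<^sup>2))"
  proof -
    have "(\<Sum>k\<in>I. c j * cnj (c k) * (if j = k then of_real (4 * L\<^sup>2) else 0)) = of_real (4 * L\<^sup>2 * (norm (c j))\<^sup>2)"
      if "j \<in> I" for j
    proof -
      have "(\<Sum>k\<in>I. c j * cnj (c k) * (if j = k then of_real (4 * L\<^sup>2) else 0)) =
          (\<Sum>k\<in>I. if j = k then c j * cnj (c k) * of_real (4 * L\<^sup>2) else 0)"
        by (intro sum.cong) auto
      also have "\<dots> = c j * cnj (c j) * of_real (4 * L\<^sup>2)" using that I by (simp add: sum.delta)
      finally show ?thesis by (simp add: complex_norm_square mult_ac del: of_real_power)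
    qed
    then show ?thesis unfolding tr by (simp add: sum_distrib_left)
  qed
  finally have PP_int: "(LINT z:square L|lebesgue. (norm (?P z))\<^sup>2) = 4 * L\<^sup>2 * (\<Sum>k\<in>I. (norm (c k))\<^sup>2)"
    unfolding set_integral_complex_of_real of_real_eq_iff .
  have iPPr: "set_integrable lebesgue (square L) (\<lambda>z. (norm (?P z))\<^sup>2)"
    using iPP complex_of_real_integrable_eq[of lebesgue "\<lambda>z. indicator (square L) z *\<^sub>R (norm (?P z))\<^sup>2"]
    by (simp add: set_integrable_def scaleR_conv_of_real)
  have eq: "indicator (square L) z *\<^sub>R (norm (cnj (V z) - ?P z))\<^sup>2 =
     (norm (V z))\<^sup>2 + indicator (square L) z *\<^sub>R (norm (?P z))\<^sup>2 - 2 * Re (V z * ?P z)" for z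
  proof (cases "z \<in> square L")
    case False
    then have "V z = 0" using supp cball_subset_square[OF r(2)] by blast
    then show ?thesis using False by simp
  qed (simp add: norm_diff_sq_cnj)
  define Q where "Q z = ?P z" for z
  have iVQ: "integrable lebesgue (\<lambda>z. V z * Q z)" using iVP by (simp only: Q_def)
  have iQQ: "integrable lebesgue (\<lambda>z. indicator (square L) z *\<^sub>R (norm (Q z))\<^sup>2)"
    using iPPr by (simp only: Q_def set_integrable_def)
  have "(LINT z|lebesgue. (norm (V z))\<^sup>2 + indicator (square L) z *\<^sub>R (norm (Q z))\<^sup>2 - 2 * Re (V z * Q z)) =
      (LINT z|lebesgue. (norm (V z))\<^sup>2) + (LINT z|lebesgue. indicator (square L) z *\<^sub>R (norm (Q z))\<^sup>2)
      - 2 * (LINT z|lebesgue. Re (V z * Q z))"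
    using V(2) iQQ integrable_Re[OF iVQ]
    by (simp only: Bochner_Integration.integral_diff Bochner_Integration.integral_add Bochner_Integration.integrable_add
        integrable_mult_right integral_mult_right_zero)
  also have "(LINT z|lebesgue. Re (V z * Q z)) = Re (LINT z|lebesgue. V z * Q z)" by (rule integral_Re[OF iVQ])
  finally show ?thesis
    unfolding Q_def VP_int set_lebesgue_integral_def eq PP_int[unfolded set_lebesgue_integral_def] .
qed

text \<open>A substitute for Parseval's identity. Approximate \<open>cnj V\<close> by \<open>\<Sum> c\<^sub>k e\<^sub>k\<close> and compare \<open>cnj W\<close> with
\<open>\<Sum> c\<^sub>k s\<^sub>k e\<^sub>k\<close>: by \<open>|s\<^sub>k| = 1\<close> and the relation of the coefficients, the two square distances differ by exactly
the difference of the two norms. The first distance is small and the second is not negative.\<close>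

lemma L2_le_of_fourier_coefficients:
  assumes V: "V \<in> borel_measurable lebesgue" "integrable lebesgue (\<lambda>z. (norm (V z))\<^sup>2)" "\<And>z. z \<notin> cball 0 r \<Longrightarrow> V z = 0"
    and W: "W \<in> borel_measurable lebesgue" "integrable lebesgue (\<lambda>z. (norm (W z))\<^sup>2)" "\<And>z. z \<notin> cball 0 r \<Longrightarrow> W z = 0"
    and r: "0 < r" "r < L"
    and s: "\<And>k. norm (s k) = 1"
    and eq: "\<And>k. (LINT z|lebesgue. V z * trig L k z) = s k * (LINT z|lebesgue. W z * trig L k z)"
  shows "(LINT z|lebesgue. (norm (V z))\<^sup>2) \<le> (LINT z|lebesgue. (norm (W z))\<^sup>2)"
proof (rule field_le_epsilon)
  fix e :: real assume e: "e > 0"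
  have "\<exists>P\<in>trig_polys L. (LINT z:square L|lebesgue. (norm (cnj (V z) - P z))\<^sup>2) < e"
  proof (rule trig_L2_dense[OF _ _ _ r e])
    have "cnj \<in> borel_measurable borel"
      by (intro borel_measurable_continuous_onI continuous_intros)
    then show "(\<lambda>z. cnj (V z)) \<in> borel_measurable lebesgue"
      using V(1) measurable_compose by blast
  qed (use V in auto)
  then obtain I c where I: "finite I" 
    and lt: "(LINT z:square L|lebesgue. (norm (cnj (V z) - (\<Sum>k\<in>I. c k * trig L k z)))\<^sup>2) < e"
    by (auto simp: trig_polys_def)
  have nonneg: "(LINT z:square L|lebesgue. (norm (cnj (W z) - (\<Sum>k\<in>I. (c k * s k) * trig L k z)))\<^sup>2) \<ge> 0"
    unfolding set_lebesgue_integral_def by simp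
  have N: "(\<Sum>k\<in>I. (norm (c k * s k))\<^sup>2) = (\<Sum>k\<in>I. (norm (c k))\<^sup>2)" by (simp add: norm_mult s)
  have S: "(\<Sum>k\<in>I. c k * s k * (LINT z|lebesgue. W z * trig L k z)) =
      (\<Sum>k\<in>I. c k * (LINT z|lebesgue. V z * trig L k z))"
    by (simp only: eq mult.assoc)
  show "(LINT z|lebesgue. (norm (V z))\<^sup>2) \<le> (LINT z|lebesgue. (norm (W z))\<^sup>2) + e"
    using lt nonneg trig_poly_square_distance[OF V r I, of c] 
      trig_poly_square_distance[OF W r I, of "\<lambda>k. c k * s k", unfolded S N]
    by linarith
qed

section \<open>The energies of the two Wirtinger derivatives\<close>

text \<open>Weak derivatives tested only against explicit smooth functions. This is weaker than testing against all test
functions, so it is implied by the distributional definitions, but it still determines the derivative.\<close>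

definition weak_wirt :: "complex \<Rightarrow> complex set \<Rightarrow> (complex \<Rightarrow> complex) \<Rightarrow> (complex \<Rightarrow> complex) \<Rightarrow> bool" where
  "weak_wirt s U u g \<longleftrightarrow> (\<forall>\<phi>\<in>smooth_expr. \<forall>K. compact K \<and> K \<subseteq> U \<and> (\<forall>z. z \<notin> K \<longrightarrow> \<phi> z = 0) \<longrightarrow>
     (LINT z|lebesgue. u z * wirt s (frechet_derivative \<phi> (at z))) = - (LINT z|lebesgue. g z * \<phi> z))"

definition loc_L2 :: "complex set \<Rightarrow> (complex \<Rightarrow> complex) \<Rightarrow> bool" where
  "loc_L2 U g \<longleftrightarrow> g \<in> borel_measurable lebesgue \<and>
     (\<forall>K. compact K \<and> K \<subseteq> U \<longrightarrow> integrable lebesgue (\<lambda>z. indicator K z * (norm (g z))\<^sup>2))"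

lemma smooth_expr_measurable: "f \<in> smooth_expr \<Longrightarrow> f \<in> borel_measurable lebesgue"
  by (intro measurable_completion) (simp add: borel_measurable_continuous_onI smooth_expr_continuous_on)

lemma frechet_derivative_vanish_outside:
  fixes \<phi> :: "complex \<Rightarrow> complex"
  assumes "compact K" "\<And>z. z \<notin> K \<Longrightarrow> \<phi> z = 0" "z \<notin> K"
  shows "frechet_derivative \<phi> (at z) = (\<lambda>v. 0)"
proof -
  have "open (- K)" using assms(1) compact_imp_closed by blast
  then have "(\<phi> has_derivative (\<lambda>v. 0)) (at z)"
    by (rule has_derivative_transform_within_open[of "\<lambda>_. 0" "\<lambda>_. 0", rotated]) (use assms in auto)
  then show ?thesis using frechet_derivative_at by metis
qed

lemma wirt_smooth_expr:
  assumes "f \<in> smooth_expr"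
  shows "(\<lambda>z. wirt s (frechet_derivative f (at z))) \<in> smooth_expr"
proof -
  have "(\<lambda>z. (1/2) * (frechet_derivative f (at z) 1 + s * frechet_derivative f (at z) \<i>)) \<in> smooth_expr"
    by (intro smooth_expr.mult smooth_expr.add smooth_expr.const smooth_expr_frechet(3) assms)
  then show ?thesis by (simp add: wirt_def)
qed

lemma wirt_frechet_mult:
  assumes "f \<in> smooth_expr" "g \<in> smooth_expr"
  shows "wirt s (frechet_derivative (\<lambda>z. f z * g z) (at z)) =
     f z * wirt s (frechet_derivative g (at z)) + wirt s (frechet_derivative f (at z)) * g z"
proof -
  have "((\<lambda>z. f z * g z) has_derivative
      (\<lambda>v. f z * frechet_derivative g (at z) v + frechet_derivative f (at z) v * g z)) (at z)"
    by (rule has_derivative_mult[OF smooth_expr_frechet(2)[OF assms(1)] smooth_expr_frechet(2)[OF assms(2)]])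
  from frechet_derivative_at[OF this, symmetric] show ?thesis
    by (simp add: wirt_def field_simps)
qed

lemma trig_smooth_expr: "trig L k \<in> smooth_expr"
proof -
  have "(\<lambda>z. exp (\<i> * of_real (pi / L) * (of_int (fst k) * of_real (Re z) + of_int (snd k) * of_real (Im z)))) \<in> smooth_expr"
  proof -
    have "(\<lambda>z. of_real (Im z)) = (\<lambda>z. (- \<i>) * (z - of_real (Re z)))"
      by (auto simp: complex_eq_iff)
    then have "(\<lambda>z. complex_of_real (Im z)) \<in> smooth_expr"
      by (simp only:) (intro smooth_expr.mult smooth_expr_diff smooth_expr_Re smooth_expr.const smooth_expr.ident)
    then show ?thesis
      by (intro smooth_expr.exp smooth_expr.mult smooth_expr.add smooth_expr_Re smooth_expr.const smooth_expr.ident)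
  qed
  moreover have "trig L k = (\<lambda>z. exp (\<i> * of_real (pi / L) * (of_int (fst k) * of_real (Re z) + of_int (snd k) * of_real (Im z))))"
    by (simp add: trig_def cis_conv_exp fun_eq_iff mult.assoc)
  ultimately show ?thesis by simp
qed

lemma wirt_trig:
  "wirt s (frechet_derivative (trig L k) (at z)) =
     \<i> * of_real (pi / L) * (of_int (fst k) + s * of_int (snd k)) / 2 * trig L k z"
proof -
  define c where "c = \<i> * of_real (pi / L)"
  have "((\<lambda>z. c * (of_int (fst k) * of_real (Re z) + of_int (snd k) * of_real (Im z))) has_derivative
      (\<lambda>v. c * (of_int (fst k) * of_real (Re v) + of_int (snd k) * of_real (Im v)))) (at z)"
    by (intro has_derivative_mult_right has_derivative_add has_derivative_of_real has_derivative_Re has_derivative_Im has_derivative_ident)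
  then have "((\<lambda>z. exp (c * (of_int (fst k) * of_real (Re z) + of_int (snd k) * of_real (Im z)))) has_derivative
      (\<lambda>v. exp (c * (of_int (fst k) * of_real (Re z) + of_int (snd k) * of_real (Im z))) *
         (c * (of_int (fst k) * of_real (Re v) + of_int (snd k) * of_real (Im v))))) (at z)"
    by (rule has_derivative_compose[OF _ DERIV_exp[unfolded has_field_derivative_def]])
  moreover have "trig L k = (\<lambda>z. exp (c * (of_int (fst k) * of_real (Re z) + of_int (snd k) * of_real (Im z))))"
    by (simp add: trig_def cis_conv_exp fun_eq_iff mult.assoc c_def)
  ultimately have "(trig L k has_derivative (\<lambda>v. trig L k z * (c * (of_int (fst k) * of_real (Re v) + of_int (snd k) * of_real (Im v))))) (at z)"
    by simp
  from frechet_derivative_at[OF this, symmetric] show ?thesis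
    unfolding c_def[symmetric] by (simp add: wirt_def algebra_simps)
qed

lemma loc_L2_mult_smooth:
  assumes g: "loc_L2 U g" and \<eta>: "\<eta> \<in> smooth_expr" "compact K" "K \<subseteq> U" "\<And>z. z \<notin> K \<Longrightarrow> \<eta> z = 0"
  shows "(\<lambda>z. g z * \<eta> z) \<in> borel_measurable lebesgue" "integrable lebesgue (\<lambda>z. (norm (g z * \<eta> z))\<^sup>2)"
proof -
  have [measurable]: "g \<in> borel_measurable lebesgue" "\<eta> \<in> borel_measurable lebesgue"
    using g smooth_expr_measurable[OF \<eta>(1)] by (auto simp: loc_L2_def)
  show "(\<lambda>z. g z * \<eta> z) \<in> borel_measurable lebesgue" by measurable
  have "bounded (\<eta> ` K)"
    by (intro compact_imp_bounded compact_continuous_image smooth_expr_continuous_on \<eta>)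
  then obtain B where "\<forall>x\<in>\<eta> ` K. norm x \<le> B" by (auto simp: bounded_iff)
  then have B: "norm (\<eta> z) \<le> B" if "z \<in> K" for z using that by blast
  have "integrable lebesgue (\<lambda>z. B\<^sup>2 * (indicator K z * (norm (g z))\<^sup>2))"
    using g \<eta> by (intro integrable_mult_right) (auto simp: loc_L2_def)
  then show "integrable lebesgue (\<lambda>z. (norm (g z * \<eta> z))\<^sup>2)"
  proof (rule Bochner_Integration.integrable_bound)
    have "norm ((norm (g z * \<eta> z))\<^sup>2) \<le> norm (B\<^sup>2 * (indicator K z * (norm (g z))\<^sup>2))" for z
    proof (cases "z \<in> K")
      case True
      have "(norm (\<eta> z))\<^sup>2 \<le> B\<^sup>2" using B[OF True] by (intro power_mono) auto
      then have "(norm (\<eta> z))\<^sup>2 * (norm (g z))\<^sup>2 \<le> B\<^sup>2 * (norm (g z))\<^sup>2" by (intro mult_right_mono) auto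
      then show ?thesis using True by (simp add: norm_mult power_mult_distrib mult.commute)
    qed (simp add: \<eta>(4))
    then show "AE z in lebesgue. norm ((norm (g z * \<eta> z))\<^sup>2) \<le> norm (B\<^sup>2 * (indicator K z * (norm (g z))\<^sup>2))"
      by simp
  qed measurable
qed

text \<open>The two sides are the energies of \<open>\<partial>(u \<eta>)\<close> and of its conjugate derivative. Testing with \<open>\<eta>\<close> times a character
shows that the Fourier coefficients of both are those of \<open>u \<eta>\<close> times the symbols of the operators. The
symbols \<open>m \<mp> \<i> n\<close> are conjugate to each other up to a common factor, so their quotient has modulus 1.\<close>

lemma cutoff_energy_le:
  assumes u: "continuous_on UNIV u" and v: "loc_L2 UNIV v" "weak_wirt (- \<i>) UNIV u v"
    and w: "loc_L2 UNIV w" "weak_wirt \<i> UNIV u w"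
    and \<eta>: "\<eta> \<in> smooth_expr" and R: "R > 0" and supp: "\<And>z. z \<notin> cball 0 R \<Longrightarrow> \<eta> z = 0"
  shows "(LINT z|lebesgue. (norm (u z * wirt (- \<i>) (frechet_derivative \<eta> (at z)) + v z * \<eta> z))\<^sup>2)
       \<le> (LINT z|lebesgue. (norm (u z * wirt \<i> (frechet_derivative \<eta> (at z)) + w z * \<eta> z))\<^sup>2)"
proof -
  \<comment> \<open>Any period square that contains the support of the cutoff.\<close>
  define L where "L = R + 1"
  define V where "V s g z = u z * wirt s (frechet_derivative \<eta> (at z)) + g z * \<eta> z" for s g z
  define \<sigma> where "\<sigma> s k = \<i> * of_real (pi / L) * (of_int (fst k) + s * of_int (snd k)) / 2" for s and k :: "int \<times> int"
  have um: "u \<in> borel_measurable lebesgue"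
    using u by (intro measurable_completion) (simp add: borel_measurable_continuous_onI)
  have D\<eta>: "wirt s (frechet_derivative \<eta> (at z)) = 0" if "z \<notin> cball 0 R" for s z
    using frechet_derivative_vanish_outside[OF compact_cball supp that] by (simp add: wirt_def)
  have cont: "continuous_on UNIV (\<lambda>z. wirt s (frechet_derivative \<eta> (at z)))" "continuous_on UNIV \<eta>" for s
    by (intro smooth_expr_continuous_on wirt_smooth_expr \<eta>)+
  have A: "integrable lebesgue (\<lambda>z. u z * wirt s (frechet_derivative \<eta> (at z)) * f z)" 
    if "f \<in> smooth_expr" for s f
    by (rule integrable_lebesgue_continuous_compact_support[where R = R])
       (use D\<eta> in \<open>auto intro!: continuous_on_mult u cont smooth_expr_continuous_on[OF that]\<close>)
  have A2: "integrable lebesgue (\<lambda>z. (norm (u z * wirt s (frechet_derivative \<eta> (at z))))\<^sup>2)" for s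
    by (rule integrable_lebesgue_continuous_compact_support[where R = R])
       (use D\<eta> in \<open>auto intro!: continuous_on_mult continuous_on_power continuous_on_norm u cont\<close>)
  have A3: "integrable lebesgue (\<lambda>z. u z * (\<eta> z * f z))" if "f \<in> smooth_expr" for f
    by (rule integrable_lebesgue_continuous_compact_support[where R = R])
       (use supp in \<open>auto intro!: continuous_on_mult u cont smooth_expr_continuous_on[OF that]\<close>)
  have main: "V s g \<in> borel_measurable lebesgue \<and> integrable lebesgue (\<lambda>z. (norm (V s g z))\<^sup>2) \<and>
      (\<forall>z. z \<notin> cball 0 R \<longrightarrow> V s g z = 0) \<and>
      (\<forall>k. (LINT z|lebesgue. V s g z * trig L k z) = - \<sigma> s k * (LINT z|lebesgue. u z * (\<eta> z * trig L k z)))"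
    if g: "loc_L2 UNIV g" "weak_wirt s UNIV u g" for s g
  proof (intro conjI allI impI)
    note gm = loc_L2_mult_smooth[OF g(1) \<eta> compact_cball[of 0 R] subset_UNIV supp]
    show Vm: "V s g \<in> borel_measurable lebesgue"
      unfolding V_def using um gm(1) smooth_expr_measurable[OF wirt_smooth_expr[OF \<eta>], of s] by measurable
    have "integrable lebesgue (\<lambda>z. 3 * ((norm (u z * wirt s (frechet_derivative \<eta> (at z))))\<^sup>2 + (norm (g z * \<eta> z))\<^sup>2 + (norm (0::complex))\<^sup>2))"
      using A2[of s] gm(2) by simp
    then show "integrable lebesgue (\<lambda>z. (norm (V s g z))\<^sup>2)"
    proof (rule Bochner_Integration.integrable_bound)
      have "norm ((norm (V s g z))\<^sup>2) \<le> norm (3 * ((norm (u z * wirt s (frechet_derivative \<eta> (at z))))\<^sup>2 + (norm (g z * \<eta> z))\<^sup>2 + (norm (0::complex))\<^sup>2))" for z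
        using norm_add_sq_le3[of "u z * wirt s (frechet_derivative \<eta> (at z))" "g z * \<eta> z" 0] by (simp add: V_def)
      then show "AE z in lebesgue. norm ((norm (V s g z))\<^sup>2) \<le> norm (3 * ((norm (u z * wirt s (frechet_derivative \<eta> (at z))))\<^sup>2 + (norm (g z * \<eta> z))\<^sup>2 + (norm (0::complex))\<^sup>2))"
        by simp
    qed (use Vm in measurable)
    show "V s g z = 0" if "z \<notin> cball 0 R" for z using D\<eta>[OF that] supp[OF that] by (simp add: V_def)
    show "(LINT z|lebesgue. V s g z * trig L k z) = - \<sigma> s k * (LINT z|lebesgue. u z * (\<eta> z * trig L k z))" for k
    proof -
      have \<phi>: "(\<lambda>z. \<eta> z * trig L k z) \<in> smooth_expr" by (intro smooth_expr.mult \<eta> trig_smooth_expr)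
      have G: "integrable lebesgue (\<lambda>z. g z * \<eta> z * trig L k z)"
        by (rule integrable_of_square_integrable[OF gm, where r = R and B = 1])
           (auto simp: supp smooth_expr_measurable trig_smooth_expr)
      have W: "u z * wirt s (frechet_derivative (\<lambda>z. \<eta> z * trig L k z) (at z)) =
          u z * wirt s (frechet_derivative \<eta> (at z)) * trig L k z + \<sigma> s k * (u z * (\<eta> z * trig L k z))" for z
        unfolding wirt_frechet_mult[OF \<eta> trig_smooth_expr] wirt_trig \<sigma>_def by (simp add: algebra_simps)
      have "(LINT z|lebesgue. u z * wirt s (frechet_derivative (\<lambda>z. \<eta> z * trig L k z) (at z))) =
          - (LINT z|lebesgue. g z * (\<eta> z * trig L k z))"
        using g(2) \<phi> supp unfolding weak_wirt_def by (auto intro!: exI[of _ "cball 0 R"])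
      then have h1: "(LINT z|lebesgue. u z * wirt s (frechet_derivative \<eta> (at z)) * trig L k z) + \<sigma> s k * (LINT z|lebesgue. u z * (\<eta> z * trig L k z))
         = - (LINT z|lebesgue. g z * \<eta> z * trig L k z)"
        unfolding W using A[OF trig_smooth_expr] A3[OF trig_smooth_expr] by (simp add: mult.assoc)
      have h2: "(LINT z|lebesgue. V s g z * trig L k z) =
          (LINT z|lebesgue. u z * wirt s (frechet_derivative \<eta> (at z)) * trig L k z) + (LINT z|lebesgue. g z * \<eta> z * trig L k z)"
        unfolding V_def distrib_right using A[OF trig_smooth_expr] G by (rule Bochner_Integration.integral_add)
      have alg: "d = - b" if "a + b = - c" "d = a + c" for a b c d :: complex
        using that by (simp add: eq_neg_iff_add_eq_0 algebra_simps)
      show ?thesis using alg[OF h1 h2] by simp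
    qed
  qed
  \<comment> \<open>If the symbol of one operator is 0, so is that of the other, and any unimodular factor will do.\<close>
  define S where "S k = (if \<sigma> \<i> k = 0 then 1 else \<sigma> (- \<i>) k / \<sigma> \<i> k)" for k
  have norm_\<sigma>: "norm (\<sigma> (- \<i>) k) = norm (\<sigma> \<i> k)" for k
  proof -
    have "cnj (of_int (fst k) + \<i> * of_int (snd k)) = of_int (fst k) + (- \<i>) * of_int (snd k)" by simp
    then have "norm (of_int (fst k) + (- \<i>) * of_int (snd k)) = norm (of_int (fst k) + \<i> * of_int (snd k))"
      by (metis complex_mod_cnj)
    then show ?thesis by (simp add: \<sigma>_def norm_mult norm_divide)
  qed
  have "norm (S k) = 1" for k using norm_\<sigma>[of k] by (simp add: S_def norm_divide)
  moreover have "(LINT z|lebesgue. V (- \<i>) v z * trig L k z) = S k * (LINT z|lebesgue. V \<i> w z * trig L k z)" for k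
  proof -
    have "\<sigma> (- \<i>) k = S k * \<sigma> \<i> k" using norm_\<sigma>[of k] by (auto simp: S_def)
    moreover have "(LINT z|lebesgue. V (- \<i>) v z * trig L k z) = - \<sigma> (- \<i>) k * (LINT z|lebesgue. u z * (\<eta> z * trig L k z))"
      and "(LINT z|lebesgue. V \<i> w z * trig L k z) = - \<sigma> \<i> k * (LINT z|lebesgue. u z * (\<eta> z * trig L k z))"
      using main[OF v] main[OF w] by blast+
    ultimately show ?thesis by simp
  qed
  ultimately have "(LINT z|lebesgue. (norm (V (- \<i>) v z))\<^sup>2) \<le> (LINT z|lebesgue. (norm (V \<i> w z))\<^sup>2)"
    using main[OF v] main[OF w] R by (intro L2_le_of_fourier_coefficients[where s = S and r = R and L = L]) (auto simp: L_def)
  then show ?thesis by (simp add: V_def)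
qed

text \<open>The fundamental lemma of the calculus of variations. On a small disc multiply \<open>g\<close> by a bump function: all
Fourier coefficients of the product vanish, hence so does the product. Countably many discs cover the set.\<close>

lemma AE_eq_0_of_orthogonal_to_smooth:
  assumes U: "open U" and g: "loc_L2 U g"
    and zero: "\<And>\<phi> K. \<phi> \<in> smooth_expr \<Longrightarrow> compact K \<Longrightarrow> K \<subseteq> U \<Longrightarrow> (\<And>z. z \<notin> K \<Longrightarrow> \<phi> z = 0) \<Longrightarrow>
       (LINT z|lebesgue. g z * \<phi> z) = 0"
  shows "AE z in lebesgue. z \<in> U \<longrightarrow> g z = 0"
proof -
  have loc: "AE z in lebesgue. z \<in> ball a r \<longrightarrow> g z = 0" if r: "r > 0" "cball a r \<subseteq> U" for a r
  proof -
    define \<eta> where "\<eta> z = complex_of_real (flat 0 (Re (of_real (r\<^sup>2) - (z - a) * cnj (z - a))))" for z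
    have eta: "\<eta> z = of_real (flat 0 (r\<^sup>2 - (norm (z - a))\<^sup>2))" for z
      unfolding \<eta>_def complex_norm_square[symmetric] by simp
    have \<eta>: "\<eta> \<in> smooth_expr"
      unfolding \<eta>_def by (intro smooth_expr.flat smooth_expr.mult smooth_expr.cnj smooth_expr_diff smooth_expr.const smooth_expr.ident)
    have supp: "\<eta> z = 0" if "z \<notin> cball a r" for z
    proof -
      have "r\<^sup>2 \<le> (norm (z - a))\<^sup>2" using that r by (intro power_mono) (auto simp: dist_norm norm_minus_commute)
      then show ?thesis by (simp add: eta flat_zero)
    qed
    note gm = loc_L2_mult_smooth[OF g \<eta> compact_cball[of a r] r(2) supp]
    have far: "z \<notin> cball a r" if "z \<notin> cball 0 (norm a + r)" for z
    proof
      assume "z \<in> cball a r"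
      then have "norm z \<le> norm a + r" using norm_triangle_sub[of z a] by (simp add: dist_norm norm_minus_commute)
      then show False using that by simp
    qed
    have "(LINT z|lebesgue. (norm (g z * \<eta> z))\<^sup>2) \<le> (LINT z|lebesgue. (norm ((\<lambda>_. 0::complex) (z::complex)))\<^sup>2)"
    proof (rule L2_le_of_fourier_coefficients[where s = "\<lambda>_. 1" and r = "norm a + r" and L = "norm a + r + 1"])
      show "g z * \<eta> z = 0" if "z \<notin> cball 0 (norm a + r)" for z using supp[OF far[OF that]] by simp
      show "0 < norm a + r" using r by (simp add: add_nonneg_pos)
      fix k
      have "(LINT z|lebesgue. g z * (\<eta> z * trig (norm a + r + 1) k z)) = 0"
        by (rule zero[OF _ compact_cball r(2)]) (auto intro!: smooth_expr.mult \<eta> trig_smooth_expr simp: supp)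
      then show "(LINT z|lebesgue. g z * \<eta> z * trig (norm a + r + 1) k z) = 1 * (LINT z|lebesgue. 0 * trig (norm a + r + 1) k z)"
        by (simp add: mult.assoc)
    qed (use gm in auto)
    then have "(LINT z|lebesgue. (norm (g z * \<eta> z))\<^sup>2) = 0"
      by (intro antisym) auto
    then have "AE z in lebesgue. (norm (g z * \<eta> z))\<^sup>2 = 0"
      using integral_nonneg_eq_0_iff_AE[OF gm(2)] by auto
    then show ?thesis
    proof eventually_elim
      case (elim z)
      have "\<eta> z \<noteq> 0" if "z \<in> ball a r"
      proof -
        have "(norm (z - a))\<^sup>2 < r\<^sup>2" using that r by (intro power_strict_mono) (auto simp: dist_norm norm_minus_commute)
        then show ?thesis using flat_pos[of "r\<^sup>2 - (norm (z - a))\<^sup>2" 0] by (simp add: eta)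
      qed
      then show ?case using elim by auto
    qed
  qed
  define F where "F = {ball a r | a r. r > 0 \<and> cball a r \<subseteq> U}"
  obtain F' where F': "F' \<subseteq> F" "countable F'" "\<Union>F' = \<Union>F"
    using Lindelof[of F] by (auto simp: F_def)
  have "\<Union>F = U"
  proof
    show "\<Union>F \<subseteq> U" using ball_subset_cball unfolding F_def by blast
    show "U \<subseteq> \<Union>F"
    proof
      fix z assume "z \<in> U"
      then obtain r where "r > 0" "cball z r \<subseteq> U" using U open_contains_cball by blast
      then show "z \<in> \<Union>F" unfolding F_def by (auto intro!: exI[of _ "ball z r"] exI[of _ z] exI[of _ r])
    qed
  qed
  have "AE z in lebesgue. \<forall>B\<in>F'. z \<in> B \<longrightarrow> g z = 0"
    using F' loc by (subst AE_ball_countable) (auto simp: F_def)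
  then show ?thesis
    by eventually_elim (use F'(3) \<open>\<Union>F = U\<close> in blast)
qed

text \<open>With small \<open>t\<close> a perturbation \<open>y\<close> of small energy changes the energy of \<open>x\<close> by a factor close to 1.\<close>

lemma young_sq:
  fixes x y :: complex
  assumes "t > 0"
  shows "(norm (x + y))\<^sup>2 \<le> (1 + t) * (norm x)\<^sup>2 + (1 + 1 / t) * (norm y)\<^sup>2"
proof -
  have "0 \<le> (sqrt t * norm x - norm y / sqrt t)\<^sup>2" by simp
  also have "\<dots> = t * (norm x)\<^sup>2 + (norm y)\<^sup>2 / t - 2 * norm x * norm y"
    using assms by (simp add: power2_diff power_mult_distrib power_divide)
  finally have "2 * norm x * norm y \<le> t * (norm x)\<^sup>2 + (norm y)\<^sup>2 / t" by simp
  moreover have "(norm (x + y))\<^sup>2 \<le> (norm x + norm y)\<^sup>2"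
    by (intro power_mono norm_triangle_ineq) auto
  ultimately show ?thesis by (simp add: power2_sum algebra_simps)
qed

lemma measure_cball_complex: "r \<ge> 0 \<Longrightarrow> measure lebesgue (cball (a::complex) r) = pi * r\<^sup>2"
  by (simp add: content_cball unit_ball_vol_2)

lemma integrable_indicator_cball: "integrable lebesgue (indicator (cball (a::complex) r) :: complex \<Rightarrow> real)"
  by (intro integrable_real_indicator) (auto simp: emeasure_lborel_cball_finite[unfolded infinity_ennreal_def])

text \<open>Centred at 0 with support the disc of radius \<open>n + 1\<close>, normalised to have the value 1 at the centre.\<close>

definition cutoff :: "nat \<Rightarrow> complex \<Rightarrow> real" where
  "cutoff n z = exp 1 * flat 0 (1 - (norm z / real (Suc n))\<^sup>2)"

lemma cutoff_smooth: "(\<lambda>z. complex_of_real (cutoff n z)) \<in> smooth_expr"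
proof -
  have "(\<lambda>z. of_real (exp 1) * of_real (flat 0 (Re (1 - of_real (1 / (real (Suc n))\<^sup>2) * (z * cnj z))))) \<in> smooth_expr"
    by (intro smooth_expr.flat smooth_expr.mult smooth_expr.cnj smooth_expr_diff smooth_expr.const smooth_expr.ident)
  also have "(\<lambda>z. of_real (exp 1) * of_real (flat 0 (Re (1 - of_real (1 / (real (Suc n))\<^sup>2) * (z * cnj z))))) = (\<lambda>z. complex_of_real (cutoff n z))"
    unfolding complex_norm_square[symmetric] cutoff_def by (auto simp: power_divide fun_eq_iff simp del: of_nat_Suc)
  finally show ?thesis .
qed

lemma cutoff_bounds: "0 \<le> cutoff n z" "cutoff n z \<le> 1"
proof -
  show "0 \<le> cutoff n z" using flat_nonneg by (simp add: cutoff_def)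
  define t where "t = 1 - (norm z / real (Suc n))\<^sup>2"
  have "flat 0 t \<le> exp (-1)" 
  proof (cases "t > 0")
    case True
    moreover have "t \<le> 1" by (simp add: t_def)
    ultimately have "1 / t \<ge> 1" by simp
    then show ?thesis using True by (simp add: flat_def)
  qed (simp add: flat_def)
  then have "exp 1 * flat 0 t \<le> exp 1 * exp (-1)" by (intro mult_left_mono) auto
  then show "cutoff n z \<le> 1" by (simp add: cutoff_def t_def flip: exp_add)
qed

lemma flat_0_mono: "s \<le> t \<Longrightarrow> flat 0 s \<le> flat 0 t"
  by (auto simp: flat_def frac_le)

lemma cutoff_mono: "m \<le> n \<Longrightarrow> cutoff m z \<le> cutoff n z"
  unfolding cutoff_def
  by (intro mult_left_mono flat_0_mono diff_left_mono power_mono divide_left_mono) auto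

lemma cutoff_supp: "z \<notin> cball 0 (real (Suc n)) \<Longrightarrow> cutoff n z = 0"
proof -
  assume "z \<notin> cball 0 (real (Suc n))"
  then have "1 \<le> norm z / real (Suc n)" by (simp add: field_simps)
  then have "1 \<le> (norm z / real (Suc n))\<^sup>2" by (metis one_le_power)
  then show ?thesis by (simp add: cutoff_def flat_zero)
qed

lemma cutoff_tendsto: "(\<lambda>n. cutoff n z) \<longlonglongrightarrow> 1"
proof -
  have "(\<lambda>n. norm z / real (Suc n)) \<longlonglongrightarrow> 0"
    using LIMSEQ_inverse_real_of_nat[THEN tendsto_mult_right_zero[of _ _ "norm z"]] by (simp add: divide_inverse)
  then have "(\<lambda>n. 1 - (norm z / real (Suc n))\<^sup>2) \<longlonglongrightarrow> 1 - 0\<^sup>2"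
    by (intro tendsto_intros)
  moreover have "isCont (flat 0) 1" using flat_has_derivative DERIV_isCont by blast
  ultimately have "(\<lambda>n. flat 0 (1 - (norm z / real (Suc n))\<^sup>2)) \<longlonglongrightarrow> flat 0 1"
    by (intro isCont_tendsto_compose[of _ "flat 0"]) auto
  then have "(\<lambda>n. cutoff n z) \<longlonglongrightarrow> exp 1 * flat 0 1"
    unfolding cutoff_def by (intro tendsto_intros)
  then show ?thesis by (simp add: flat_def flip: exp_add)
qed

lemma wirt_cutoff_bound:
  assumes "norm s = 1"
  shows "norm (wirt s (frechet_derivative (\<lambda>z. complex_of_real (cutoff n z)) (at z))) \<le> 4 * exp 1 / real (Suc n) * indicator (cball 0 (real (Suc n))) z"
proof (cases "z \<in> cball 0 (real (Suc n))")
  case False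
  show ?thesis
    using frechet_derivative_vanish_outside[OF compact_cball[of 0 "real (Suc n)"] _ False, of "\<lambda>z. complex_of_real (cutoff n z)"] cutoff_supp
    by (simp add: wirt_def)
next
  case True
  define R where "R = real (Suc n)"
  have R: "R > 0" "norm z \<le> R" using True by (auto simp: R_def)
  define t where "t = 1 - (norm z / R)\<^sup>2"
  have sq: "1 - (norm w / R)\<^sup>2 = 1 - ((Re w)\<^sup>2 + (Im w)\<^sup>2) / R\<^sup>2" for w
    by (simp add: power_divide cmod_power2)
  have "((\<lambda>w. 1 - ((Re w)\<^sup>2 + (Im w)\<^sup>2) / R\<^sup>2) has_derivative (\<lambda>v. - ((2 * Re z * Re v + 2 * Im z * Im v) / R\<^sup>2))) (at z)"
    using R by (auto intro!: derivative_eq_intros simp: fun_eq_iff field_simps eval_nat_numeral)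
  then have "((\<lambda>w. 1 - (norm w / R)\<^sup>2) has_derivative (\<lambda>v. - ((2 * Re z * Re v + 2 * Im z * Im v) / R\<^sup>2))) (at z)"
    unfolding sq .
  from has_derivative_compose[OF this flat_has_derivative[of 0, unfolded has_field_derivative_def]]
  have "((\<lambda>w. flat 0 (1 - (norm w / R)\<^sup>2)) has_derivative (\<lambda>v. flat 2 t * - ((2 * Re z * Re v + 2 * Im z * Im v) / R\<^sup>2))) (at z)"
    by (simp add: t_def numeral_2_eq_2)
  then have "((\<lambda>w. complex_of_real (exp 1 * flat 0 (1 - (norm w / R)\<^sup>2))) has_derivative (\<lambda>v. of_real (exp 1 * (flat 2 t * - ((2 * Re z * Re v + 2 * Im z * Im v) / R\<^sup>2))))) (at z)"
    by (intro has_derivative_of_real has_derivative_mult_right)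
  then have der: "((\<lambda>w. complex_of_real (cutoff n w)) has_derivative (\<lambda>v. of_real (exp 1 * (flat 2 t * - ((2 * Re z * Re v + 2 * Im z * Im v) / R\<^sup>2))))) (at z)"
    unfolding cutoff_def R_def .
  define \<kappa> where "\<kappa> = - (exp 1 * flat 2 t / R\<^sup>2)"
  have eq: "exp 1 * (flat 2 t * - ((2 * Re z * Re v + 2 * Im z * Im v) / R\<^sup>2)) = \<kappa> * (2 * Re z * Re v + 2 * Im z * Im v)" for v
    by (simp add: \<kappa>_def)
  have "((\<lambda>w. complex_of_real (cutoff n w)) has_derivative (\<lambda>v. of_real (\<kappa> * (2 * Re z * Re v + 2 * Im z * Im v)))) (at z)"
    using der by (simp only: eq)
  from frechet_derivative_at[OF this, symmetric]
  have "wirt s (frechet_derivative (\<lambda>z. complex_of_real (cutoff n z)) (at z)) =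
      of_real \<kappa> * (of_real (Re z) + s * of_real (Im z))"
    by (simp add: wirt_def algebra_simps)
  then have "wirt s (frechet_derivative (\<lambda>z. complex_of_real (cutoff n z)) (at z)) =
      of_real (- (exp 1 * flat 2 t / R\<^sup>2)) * (of_real (Re z) + s * of_real (Im z))"
    by (simp only: \<kappa>_def)
  also have "norm \<dots> = exp 1 * flat 2 t / R\<^sup>2 * norm (of_real (Re z) + s * of_real (Im z))"
    using flat_nonneg[of 2 t] by (simp only: norm_mult norm_of_real) simp
  also have "\<dots> \<le> exp 1 * 2 / R\<^sup>2 * (2 * R)"
  proof (intro mult_mono divide_right_mono)
    have "norm (of_real (Re z) + s * of_real (Im z)) \<le> \<bar>Re z\<bar> + \<bar>Im z\<bar>"
      using norm_triangle_ineq[of "of_real (Re z)" "s * of_real (Im z)"] assms by (simp add: norm_mult)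
    then show "norm (of_real (Re z) + s * of_real (Im z)) \<le> 2 * R"
      using R abs_Re_le_cmod[of z] abs_Im_le_cmod[of z] by linarith
    show "flat 2 t \<le> 2" using flat_le_fact[of 2 t] by (simp add: fact_2)
  qed (use flat_nonneg R in auto)
  also have "\<dots> = 4 * exp 1 / R" using R by (simp add: power2_eq_square)
  finally show ?thesis using True by (simp add: R_def)
qed

text \<open>Apply \<open>cutoff_energy_le\<close> to cutoffs at radius \<open>n\<close>. Their gradients are of size \<open>1 / n\<close> on a disc of area
proportional to \<open>n\<^sup>2\<close>, so the errors are the means of \<open>|u|\<^sup>2\<close> over growing discs and tend to 0, because \<open>u\<close>
vanishes at infinity. Finiteness of the energy is part of the conclusion: the hypothesis with \<open>\<theta> < 1\<close>
lets the truncated \<open>v\<close>-energy be absorbed into the left side, uniformly in \<open>n\<close>.\<close>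

lemma dz_energy_le_dzbar_energy:
  assumes u: "continuous_on UNIV u" "(u \<longlongrightarrow> 0) at_infinity"
    and v: "loc_L2 UNIV v" "weak_wirt (- \<i>) UNIV u v"
    and w: "loc_L2 UNIV w" "weak_wirt \<i> UNIV u w"
    and \<theta>: "0 \<le> \<theta>" "\<theta> < 1" and h: "integrable lebesgue h"
    and le: "AE z in lebesgue. (norm (w z))\<^sup>2 \<le> \<theta> * (norm (v z))\<^sup>2 + h z"
  shows "integrable lebesgue (\<lambda>z. (norm (v z))\<^sup>2)" "integrable lebesgue (\<lambda>z. (norm (w z))\<^sup>2)"
    "(LINT z|lebesgue. (norm (v z))\<^sup>2) \<le> (LINT z|lebesgue. (norm (w z))\<^sup>2)"
proof -
  have [measurable]: "v \<in> borel_measurable lebesgue" "w \<in> borel_measurable lebesgue" "h \<in> borel_measurable lebesgue"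
    using v w h by (auto simp: loc_L2_def)
  have [measurable]: "u \<in> borel_measurable lebesgue"
    using u(1) by (intro measurable_completion) (simp add: borel_measurable_continuous_onI)
  obtain M where M: "\<And>z. norm (u z) \<le> M" "M \<ge> 0"
  proof -
    obtain b where b: "\<And>z. norm z \<ge> b \<Longrightarrow> norm (u z) < 1"
      using tendstoD[OF u(2), of 1] by (auto simp: eventually_at_infinity)
    have "bounded (u ` cball 0 b)"
      by (intro compact_imp_bounded compact_continuous_image continuous_on_subset[OF u(1)]) auto
    then obtain B where B: "\<forall>x\<in>u ` cball 0 b. norm x \<le> B" by (auto simp: bounded_iff)
    have "norm (u z) \<le> max 1 B" for z
    proof (cases "norm z \<le> b")
      case True
      then have "norm (u z) \<le> B" using B by simp
      then show ?thesis by simp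
    next
      case False
      then show ?thesis using b[of z] by simp
    qed
    then show ?thesis by (rule that) simp
  qed
  define C where "C = 4 * exp (1::real)"
  \<comment> \<open>The cutoff error: an upper bound for the energy of u times the gradient of the cutoff.\<close>
  define E where "E n = (LINT z|lebesgue. (norm (u z))\<^sup>2 * ((C / real (Suc n))\<^sup>2 * indicator (cball 0 (real (Suc n))) z))" for n
  have [measurable]: "cball (0::complex) r \<in> sets lebesgue" for r by simp
  have iE: "integrable lebesgue (\<lambda>z. (norm (u z))\<^sup>2 * (c * indicator (cball 0 r) z))" for c r
  proof (rule Bochner_Integration.integrable_bound)
    show "integrable lebesgue (\<lambda>z. M\<^sup>2 * \<bar>c\<bar> * indicator (cball (0::complex) r) z)"
      by (intro integrable_mult_right integrable_indicator_cball)
    have "norm ((norm (u z))\<^sup>2 * (c * indicator (cball 0 r) z)) \<le> norm (M\<^sup>2 * \<bar>c\<bar> * indicator (cball 0 r) z)" for z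
    proof -
      have "(norm (u z))\<^sup>2 \<le> M\<^sup>2" using M by (intro power_mono) auto
      then show ?thesis by (auto simp: abs_mult indicator_def intro!: mult_right_mono)
    qed
    then show "AE z in lebesgue. norm ((norm (u z))\<^sup>2 * (c * indicator (cball 0 r) z)) \<le> norm (M\<^sup>2 * \<bar>c\<bar> * indicator (cball 0 r) z)" by simp
  qed measurable
  have E_nonneg: "E n \<ge> 0" for n by (auto simp: E_def)
  have E_lim: "E \<longlonglongrightarrow> 0"
  proof (rule order_tendstoI)
    fix a :: real assume "a < 0"
    then have "a < E n" for n using E_nonneg[of n] by linarith
    then show "eventually (\<lambda>n. a < E n) sequentially" by simp
  next
    fix \<epsilon> :: real assume \<epsilon>: "0 < \<epsilon>"
    have C: "C > 0" by (simp add: C_def)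
    define d where "d = sqrt (\<epsilon> / (2 * C\<^sup>2 * pi))"
    have d: "d > 0" "d\<^sup>2 = \<epsilon> / (2 * C\<^sup>2 * pi)" using \<epsilon> C by (auto simp: d_def)
    obtain b where b: "\<And>z. norm z \<ge> b \<Longrightarrow> norm (u z) < d"
      using tendstoD[OF u(2) d(1)] by (auto simp: eventually_at_infinity)
    define S where "S = max b 0"
    have S: "S \<ge> 0" "\<And>z. norm z \<ge> S \<Longrightarrow> norm (u z) < d" using b by (auto simp: S_def)
    \<comment> \<open>Inside the disc of radius S the function u is only bounded, outside it is smaller than d.\<close>
    have bound: "E n \<le> C\<^sup>2 * M\<^sup>2 * pi * S\<^sup>2 * (inverse (real (Suc n)))\<^sup>2 + \<epsilon> / 2" for n
    proof -
      let ?R = "real (Suc n)"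
      let ?c = "(C / ?R)\<^sup>2"
      have "E n \<le> (LINT z|lebesgue. ?c * (M\<^sup>2 * indicator (cball (0::complex) S) z + d\<^sup>2 * indicator (cball 0 ?R) z))"
        unfolding E_def
      proof (rule integral_mono)
        show "integrable lebesgue (\<lambda>z. ?c * (M\<^sup>2 * indicator (cball (0::complex) S) z + d\<^sup>2 * indicator (cball 0 ?R) z))"
          by (intro integrable_mult_right Bochner_Integration.integrable_add integrable_indicator_cball)
        fix z
        have "(norm (u z))\<^sup>2 * indicator (cball 0 ?R) z \<le> M\<^sup>2 * indicator (cball 0 S) z + d\<^sup>2 * indicator (cball 0 ?R) z"
        proof (cases "z \<in> cball 0 S")
          case True
          have "(norm (u z))\<^sup>2 \<le> M\<^sup>2" using M by (intro power_mono) auto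
          then show ?thesis using True by (auto simp: indicator_def intro: add_increasing2)
        next
          case False
          then have "norm (u z) \<le> d" using S(2)[of z] by auto
          then have "(norm (u z))\<^sup>2 \<le> d\<^sup>2" by (intro power_mono) auto
          then show ?thesis using False by (auto simp: indicator_def)
        qed
        then have "?c * ((norm (u z))\<^sup>2 * indicator (cball 0 ?R) z) \<le> ?c * (M\<^sup>2 * indicator (cball 0 S) z + d\<^sup>2 * indicator (cball 0 ?R) z)"
          by (intro mult_left_mono) auto
        then show "(norm (u z))\<^sup>2 * (?c * indicator (cball 0 ?R) z) \<le> ?c * (M\<^sup>2 * indicator (cball 0 S) z + d\<^sup>2 * indicator (cball 0 ?R) z)"
          by (simp only: mult_ac)
      qed (rule iE)
      also have "\<dots> = ?c * (M\<^sup>2 * (pi * S\<^sup>2) + d\<^sup>2 * (pi * ?R\<^sup>2))"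
        using S(1) measure_cball_complex[of S 0] measure_cball_complex[of ?R 0] integrable_indicator_cball[of 0]
        by (simp del: of_nat_Suc)
      also have "\<dots> = C\<^sup>2 * M\<^sup>2 * pi * S\<^sup>2 * (inverse ?R)\<^sup>2 + C\<^sup>2 * pi * d\<^sup>2"
        by (simp add: field_simps power_divide del: of_nat_Suc)
      also have "C\<^sup>2 * pi * d\<^sup>2 = \<epsilon> / 2" using d C by (simp add: field_simps)
      finally show ?thesis .
    qed
    have "(\<lambda>n. C\<^sup>2 * M\<^sup>2 * pi * S\<^sup>2 * (inverse (real (Suc n)))\<^sup>2 + \<epsilon> / 2) \<longlonglongrightarrow> C\<^sup>2 * M\<^sup>2 * pi * S\<^sup>2 * 0\<^sup>2 + \<epsilon> / 2"
      by (intro tendsto_intros LIMSEQ_inverse_real_of_nat)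
    then have "eventually (\<lambda>n. C\<^sup>2 * M\<^sup>2 * pi * S\<^sup>2 * (inverse (real (Suc n)))\<^sup>2 + \<epsilon> / 2 < \<epsilon>) sequentially"
      by (rule order_tendstoD(2)) (use \<epsilon> in simp)
    then show "eventually (\<lambda>n. E n < \<epsilon>) sequentially"
      by eventually_elim (use bound le_less_trans in blast)
  qed
  define a where "a n = (LINT z|lebesgue. (norm (v z * of_real (cutoff n z)))\<^sup>2)" for n
  define b where "b n = (LINT z|lebesgue. (norm (w z * of_real (cutoff n z)))\<^sup>2)" for n
  have supp: "complex_of_real (cutoff n z) = 0" if "z \<notin> cball 0 (real (Suc n))" for n z
    using cutoff_supp[OF that] by simp
  have ia: "integrable lebesgue (\<lambda>z. (norm (v z * of_real (cutoff n z)))\<^sup>2)"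
   and ib: "integrable lebesgue (\<lambda>z. (norm (w z * of_real (cutoff n z)))\<^sup>2)" for n
    using loc_L2_mult_smooth(2)[OF v(1) cutoff_smooth compact_cball[of 0 "real (Suc n)"] subset_UNIV supp]
      loc_L2_mult_smooth(2)[OF w(1) cutoff_smooth compact_cball[of 0 "real (Suc n)"] subset_UNIV supp] by auto
  have key: "a n \<le> (1 + t)\<^sup>2 * b n + (1 + 1 / t) * (2 + t) * E n" if t: "t > 0" for t n
  proof -
    define D where "D s z = u z * wirt s (frechet_derivative (\<lambda>z. complex_of_real (cutoff n z)) (at z))" for s z
    have [measurable]: "D s \<in> borel_measurable lebesgue" for s
      unfolding D_def using smooth_expr_measurable[OF wirt_smooth_expr[OF cutoff_smooth], of s n] by measurable
    have D: "(norm (D s z))\<^sup>2 \<le> (norm (u z))\<^sup>2 * ((C / real (Suc n))\<^sup>2 * indicator (cball 0 (real (Suc n))) z)" if "norm s = 1" for s z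
    proof -
      have "(norm (wirt s (frechet_derivative (\<lambda>z. complex_of_real (cutoff n z)) (at z))))\<^sup>2 \<le>
          (C / real (Suc n) * indicator (cball 0 (real (Suc n))) z)\<^sup>2"
        using wirt_cutoff_bound[OF that, of n z] by (intro power_mono) (auto simp: C_def simp del: of_nat_Suc)
      also have "\<dots> = (C / real (Suc n))\<^sup>2 * indicator (cball 0 (real (Suc n))) z"
        by (simp add: power_mult_distrib indicator_def)
      finally show ?thesis unfolding D_def norm_mult power_mult_distrib by (intro mult_left_mono) auto
    qed
    have iD: "integrable lebesgue (\<lambda>z. (norm (D s z))\<^sup>2)" if "norm s = 1" for s
      by (rule Bochner_Integration.integrable_bound[OF iE[of "(C / real (Suc n))\<^sup>2" "real (Suc n)"]])
         (auto intro!: AE_I2 order_trans[OF _ abs_ge_self] D[OF that] simp del: of_nat_Suc)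
    have DE: "(LINT z|lebesgue. (norm (D s z))\<^sup>2) \<le> E n" if "norm s = 1" for s
      unfolding E_def by (rule integral_mono[OF iD[OF that] iE D[OF that]])
    define V where "V z = D (- \<i>) z + v z * of_real (cutoff n z)" for z
    define W where "W z = D \<i> z + w z * of_real (cutoff n z)" for z
    have [measurable]: "V \<in> borel_measurable lebesgue" "W \<in> borel_measurable lebesgue"
      unfolding V_def W_def using smooth_expr_measurable[OF cutoff_smooth] by measurable
    have iWb: "integrable lebesgue (\<lambda>z. (1 + t) * (norm (w z * of_real (cutoff n z)))\<^sup>2 + (1 + 1 / t) * (norm (D \<i> z))\<^sup>2)"
      by (intro Bochner_Integration.integrable_add integrable_mult_right ib iD) auto
    have Wle: "(norm (W z))\<^sup>2 \<le> (1 + t) * (norm (w z * of_real (cutoff n z)))\<^sup>2 + (1 + 1 / t) * (norm (D \<i> z))\<^sup>2" for z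
      unfolding W_def add.commute[of "D \<i> z"] by (rule young_sq[OF t])
    have iW: "integrable lebesgue (\<lambda>z. (norm (W z))\<^sup>2)"
      by (rule Bochner_Integration.integrable_bound[OF iWb]) (use Wle t in \<open>auto intro!: order_trans[OF _ abs_ge_self]\<close>)
    have W_int: "(LINT z|lebesgue. (norm (W z))\<^sup>2) \<le> (1 + t) * b n + (1 + 1 / t) * E n"
    proof -
      have "(LINT z|lebesgue. (norm (W z))\<^sup>2) \<le>
          (LINT z|lebesgue. (1 + t) * (norm (w z * of_real (cutoff n z)))\<^sup>2 + (1 + 1 / t) * (norm (D \<i> z))\<^sup>2)"
        by (rule integral_mono[OF iW iWb Wle])
      also have "\<dots> = (1 + t) * b n + (1 + 1 / t) * (LINT z|lebesgue. (norm (D \<i> z))\<^sup>2)"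
        unfolding b_def by (subst Bochner_Integration.integral_add) (auto intro!: ib iD)
      also have "\<dots> \<le> (1 + t) * b n + (1 + 1 / t) * E n"
        using t by (intro add_left_mono mult_left_mono DE) auto
      finally show ?thesis .
    qed
    have iVb: "integrable lebesgue (\<lambda>z. (1 + t) * (norm (v z * of_real (cutoff n z)))\<^sup>2 + (1 + 1 / t) * (norm (D (- \<i>) z))\<^sup>2)"
      by (intro Bochner_Integration.integrable_add integrable_mult_right ia iD) auto
    have Vle: "(norm (V z))\<^sup>2 \<le> (1 + t) * (norm (v z * of_real (cutoff n z)))\<^sup>2 + (1 + 1 / t) * (norm (D (- \<i>) z))\<^sup>2" for z
      unfolding V_def add.commute[of "D (- \<i>) z"] by (rule young_sq[OF t])
    have iV: "integrable lebesgue (\<lambda>z. (norm (V z))\<^sup>2)"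
      by (rule Bochner_Integration.integrable_bound[OF iVb]) (use Vle t in \<open>auto intro!: order_trans[OF _ abs_ge_self]\<close>)
    have "(LINT z|lebesgue. (norm (V z))\<^sup>2) \<le> (LINT z|lebesgue. (norm (W z))\<^sup>2)"
      unfolding V_def W_def D_def
      by (rule cutoff_energy_le[OF u(1) v w cutoff_smooth _ supp]) auto
    moreover have "a n \<le> (1 + t) * (LINT z|lebesgue. (norm (V z))\<^sup>2) + (1 + 1 / t) * E n"
    proof -
      have "(norm (v z * of_real (cutoff n z)))\<^sup>2 \<le> (1 + t) * (norm (V z))\<^sup>2 + (1 + 1 / t) * (norm (D (- \<i>) z))\<^sup>2" for z
        using young_sq[OF t, of "V z" "- D (- \<i>) z"] by (simp add: V_def)
      then have "a n \<le> (LINT z|lebesgue. (1 + t) * (norm (V z))\<^sup>2 + (1 + 1 / t) * (norm (D (- \<i>) z))\<^sup>2)"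
        unfolding a_def using iV iD[of "- \<i>"] by (intro integral_mono ia) auto
      also have "\<dots> = (1 + t) * (LINT z|lebesgue. (norm (V z))\<^sup>2) + (1 + 1 / t) * (LINT z|lebesgue. (norm (D (- \<i>) z))\<^sup>2)"
        using iV iD[of "- \<i>"] by (subst Bochner_Integration.integral_add) auto
      also have "\<dots> \<le> (1 + t) * (LINT z|lebesgue. (norm (V z))\<^sup>2) + (1 + 1 / t) * E n"
        using t by (intro add_left_mono mult_left_mono DE) auto
      finally show ?thesis .
    qed
    ultimately have "a n \<le> (1 + t) * ((1 + t) * b n + (1 + 1 / t) * E n) + (1 + 1 / t) * E n"
      using W_int t by (smt (verit) mult_left_mono)
    moreover have "(1 + t) * ((1 + t) * b n + (1 + r) * E n) + (1 + r) * E n = (1 + t)\<^sup>2 * b n + (1 + r) * (2 + t) * E n" for r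
      by (simp add: power2_eq_square algebra_simps)
    ultimately show ?thesis by simp
  qed
  have mono: "a m \<le> a n" if "m \<le> n" for m n
    unfolding a_def using that cutoff_bounds cutoff_mono[OF that]
    by (intro integral_mono ia) (auto simp: norm_mult intro!: power_mono mult_left_mono)
  \<comment> \<open>A bound on the truncated energies up to a multiple of the error gives, by monotone convergence,
      a bound on the energy itself.\<close>
  have energy: "integrable lebesgue (\<lambda>z. (norm (v z))\<^sup>2) \<and> (LINT z|lebesgue. (norm (v z))\<^sup>2) \<le> x"
    if bd: "\<And>n. a n \<le> x + c * E n" for x c
  proof -
    obtain B where B: "\<And>n. x + c * E n \<le> B"
    proof -
      have "Bseq (\<lambda>n. x + c * E n)"
        using E_lim by (intro convergent_imp_Bseq) (auto intro!: convergentI tendsto_intros)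
      then obtain K where "\<And>n. norm (x + c * E n) \<le> K" by (auto simp: Bseq_def)
      then show ?thesis by (intro that[of K]) (auto intro: order_trans[OF abs_ge_self])
    qed
    have "a n \<le> B" for n using order_trans[OF bd B] .
    moreover have "incseq a" using mono by (simp add: incseq_def)
    ultimately obtain l where l: "a \<longlonglongrightarrow> l"
      using incseq_convergent[of a B] by metis
    have *: "AE z in lebesgue. (\<lambda>n. (norm (v z * of_real (cutoff n z)))\<^sup>2) \<longlonglongrightarrow> (norm (v z))\<^sup>2"
    proof (rule AE_I2)
      fix z
      have "(\<lambda>n. (norm (v z * of_real (cutoff n z)))\<^sup>2) \<longlonglongrightarrow> (norm (v z * of_real 1))\<^sup>2"
        by (intro tendsto_intros cutoff_tendsto)
      then show "(\<lambda>n. (norm (v z * of_real (cutoff n z)))\<^sup>2) \<longlonglongrightarrow> (norm (v z))\<^sup>2" by simp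
    qed
    have m: "AE z in lebesgue. mono (\<lambda>n. (norm (v z * of_real (cutoff n z)))\<^sup>2)"
      using cutoff_bounds cutoff_mono by (auto simp: mono_def norm_mult intro!: AE_I2 power_mono mult_left_mono)
    have "integrable lebesgue (\<lambda>z. (norm (v z))\<^sup>2)" "(LINT z|lebesgue. (norm (v z))\<^sup>2) = l"
    proof -
      have meas: "(\<lambda>z. (norm (v z))\<^sup>2) \<in> borel_measurable lebesgue" by measurable
      show "integrable lebesgue (\<lambda>z. (norm (v z))\<^sup>2)"
        by (rule integrable_monotone_convergence[OF ia m * l[unfolded a_def] meas])
      show "(LINT z|lebesgue. (norm (v z))\<^sup>2) = l"
        by (rule integral_monotone_convergence[OF ia m * l[unfolded a_def] meas])
    qed
    moreover have "l \<le> x + c * 0"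
    proof (rule LIMSEQ_le[OF l])
      show "(\<lambda>n. x + c * E n) \<longlonglongrightarrow> x + c * 0" by (intro tendsto_intros E_lim)
    qed (use bd in blast)
    ultimately show ?thesis by simp
  qed
  have iv: "integrable lebesgue (\<lambda>z. (norm (v z))\<^sup>2)"
  proof -
    define H where "H = (LINT z|lebesgue. \<bar>h z\<bar>)"
    have bn: "b n \<le> \<theta> * a n + H" for n
    proof -
      have "b n \<le> (LINT z|lebesgue. \<theta> * (norm (v z * of_real (cutoff n z)))\<^sup>2 + \<bar>h z\<bar>)"
        unfolding b_def
      proof (rule integral_mono_AE)
        show "integrable lebesgue (\<lambda>z. \<theta> * (norm (v z * of_real (cutoff n z)))\<^sup>2 + \<bar>h z\<bar>)"
          using ia h by auto
        show "AE z in lebesgue. (norm (w z * of_real (cutoff n z)))\<^sup>2 \<le> \<theta> * (norm (v z * of_real (cutoff n z)))\<^sup>2 + \<bar>h z\<bar>"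
          using le
        proof eventually_elim
          case (elim z)
          have c: "0 \<le> (cutoff n z)\<^sup>2" "(cutoff n z)\<^sup>2 \<le> 1" 
            using cutoff_bounds by (auto simp: power_le_one)
          have "(norm (w z))\<^sup>2 * (cutoff n z)\<^sup>2 \<le> (\<theta> * (norm (v z))\<^sup>2 + h z) * (cutoff n z)\<^sup>2"
            using elim c by (intro mult_right_mono) auto
          also have "h z * (cutoff n z)\<^sup>2 \<le> \<bar>h z\<bar> * 1"
            using c by (intro mult_mono) auto
          then have "(\<theta> * (norm (v z))\<^sup>2 + h z) * (cutoff n z)\<^sup>2 \<le> \<theta> * ((norm (v z))\<^sup>2 * (cutoff n z)\<^sup>2) + \<bar>h z\<bar>"
            by (simp add: algebra_simps)
          finally show ?case by (simp add: norm_mult power_mult_distrib)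
        qed
      qed (rule ib)
      also have "\<dots> = \<theta> * a n + H"
        unfolding a_def H_def using ia h by simp
      finally show ?thesis .
    qed
    have lim: "((\<lambda>t. (1 + t)\<^sup>2 * \<theta>) \<longlongrightarrow> (1 + 0)\<^sup>2 * \<theta>) (at_right 0)"
      by (intro tendsto_intros)
    have "eventually (\<lambda>t. (1 + t)\<^sup>2 * \<theta> < 1 \<and> t > 0) (at_right 0)"
      using order_tendstoD(2)[OF lim, of 1] \<theta> eventually_at_right_less[of 0] by (auto elim: eventually_elim2)
    \<comment> \<open>The factor from the cutoff must not destroy the contraction, which is possible since \<theta> < 1.\<close>
    then obtain t where t: "(1 + t)\<^sup>2 * \<theta> < 1" "t > 0"
      using eventually_happens' trivial_limit_at_right_real by blast
    define q where "q = 1 - (1 + t)\<^sup>2 * \<theta>"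
    have q: "q > 0" using t by (simp add: q_def)
    have "a n \<le> (1 + t)\<^sup>2 * H / q + (1 + 1 / t) * (2 + t) / q * E n" for n
    proof -
      have "(1 + t)\<^sup>2 * b n \<le> (1 + t)\<^sup>2 * (\<theta> * a n + H)" by (intro mult_left_mono bn) auto
      then have "a n \<le> (1 + t)\<^sup>2 * (\<theta> * a n + H) + (1 + 1 / t) * (2 + t) * E n"
        using key[OF t(2), of n] by linarith
      then have "q * a n \<le> (1 + t)\<^sup>2 * H + (1 + 1 / t) * (2 + t) * E n"
        by (simp add: q_def algebra_simps)
      then have "a n \<le> ((1 + t)\<^sup>2 * H + (1 + 1 / t) * (2 + t) * E n) / q"
        using q by (simp add: pos_le_divide_eq mult.commute)
      then show ?thesis by (simp add: add_divide_distrib)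
    qed
    then show ?thesis using energy by blast
  qed
  show "integrable lebesgue (\<lambda>z. (norm (v z))\<^sup>2)" by (rule iv)
  show iw: "integrable lebesgue (\<lambda>z. (norm (w z))\<^sup>2)"
  proof (rule Bochner_Integration.integrable_bound)
    show "integrable lebesgue (\<lambda>z. \<theta> * (norm (v z))\<^sup>2 + h z)" using iv h by auto
    show "AE z in lebesgue. norm ((norm (w z))\<^sup>2) \<le> norm (\<theta> * (norm (v z))\<^sup>2 + h z)"
      using le by eventually_elim (auto intro: order_trans[OF _ abs_ge_self])
  qed measurable
  have bw: "b n \<le> (LINT z|lebesgue. (norm (w z))\<^sup>2)" for n
    unfolding b_def using cutoff_bounds
    by (intro integral_mono ib iw) (auto simp: norm_mult intro!: power_mono mult_right_le_one_le)
  \<comment> \<open>First n tends to infinity, then t tends to 0.\<close>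
  show "(LINT z|lebesgue. (norm (v z))\<^sup>2) \<le> (LINT z|lebesgue. (norm (w z))\<^sup>2)"
  proof (rule tendsto_lowerbound)
    show "((\<lambda>t. (1 + t)\<^sup>2 * (LINT z|lebesgue. (norm (w z))\<^sup>2)) \<longlongrightarrow> (LINT z|lebesgue. (norm (w z))\<^sup>2)) (at_right 0)"
      by (rule tendsto_eq_intros refl)+ simp
    show "eventually (\<lambda>t. (LINT z|lebesgue. (norm (v z))\<^sup>2) \<le> (1 + t)\<^sup>2 * (LINT z|lebesgue. (norm (w z))\<^sup>2)) (at_right 0)"
      using eventually_at_right_less[of 0]
    proof eventually_elim
      case (elim t)
      have "a n \<le> (1 + t)\<^sup>2 * (LINT z|lebesgue. (norm (w z))\<^sup>2) + (1 + 1 / t) * (2 + t) * E n" for n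
        using key[OF elim, of n] mult_left_mono[OF bw[of n], of "(1 + t)\<^sup>2"] by simp
      then show ?case using energy by blast
    qed
  qed simp
qed

section \<open>Area integrals of power series over a disc\<close>

definition disc_moment :: "real \<Rightarrow> nat \<Rightarrow> nat \<Rightarrow> complex" where
  "disc_moment r n m = (LINT z:ball 0 r|lebesgue. z ^ n * cnj z ^ m)"

lemma set_integrable_ball_continuous:
  fixes f :: "complex \<Rightarrow> complex"
  assumes "continuous_on (cball 0 r) f"
  shows "set_integrable lebesgue (ball 0 r) f"
proof -
  have "integrable lborel (\<lambda>z. indicator (cball 0 r) z *\<^sub>R f z)"
    by (intro borel_integrable_compact compact_cball assms)
  then have "set_integrable lebesgue (cball 0 r) f"
    unfolding set_integrable_def using integrable_completion borel_measurable_integrable by blast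
  then show ?thesis by (rule set_integrable_subset) auto
qed

lemma set_integrable_moment: "set_integrable lebesgue (ball 0 r) (\<lambda>z. z ^ n * cnj z ^ m)"
  by (intro set_integrable_ball_continuous continuous_intros)

lemma cnj_disc_moment: "cnj (disc_moment r n m) = disc_moment r m n"
proof -
  have "cnj (disc_moment r n m) = (LINT z|lebesgue. cnj (indicator (ball 0 r) z *\<^sub>R (z ^ n * cnj z ^ m)))"
    unfolding disc_moment_def set_lebesgue_integral_def
    by (rule Bochner_Integration.integral_cnj[symmetric])
  also have "\<dots> = disc_moment r m n"
    unfolding disc_moment_def set_lebesgue_integral_def by (simp add: mult.commute)
  finally show ?thesis .
qed

lemma wirt_linear_form: "wirt (- \<i>) (\<lambda>v. A * v + B * cnj v) = A" "wirt \<i> (\<lambda>v. A * v + B * cnj v) = B"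
  by (simp_all add: wirt_def algebra_simps)

text \<open>The integral of \<open>\<partial>(z\<^sup>n\<^sup>+\<^sup>1 (cnj z)\<^sup>m (r\<^sup>2 - |z|\<^sup>2)\<^sub>+) / \<partial>z\<close> vanishes, since the function is Lipschitz with compact
support. This replaces polar coordinates: the recursion and the area of the disc determine all moments.\<close>

lemma disc_moment_rec:
  assumes r: "r > 0"
  shows "of_real (r\<^sup>2) * of_nat (n + 1) * disc_moment r n m = of_nat (n + 2) * disc_moment r (n + 1) (m + 1)"
proof -
  define q where "q z = z ^ (n + 1) * cnj z ^ m" for z :: complex
  define w where "w z = complex_of_real (max 0 (r\<^sup>2 - (norm z)\<^sup>2))" for z :: complex
  define P where "P z = q z * w z" for z
  define Dq where "Dq z v = of_nat (n + 1) * z ^ n * cnj z ^ m * v + z ^ (n + 1) * (of_nat m * cnj z ^ (m - 1)) * cnj v" for z v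
  have Dq: "(q has_derivative Dq z) (at z)" for z
  proof -
    have 1: "((\<lambda>z::complex. z ^ k) has_derivative (\<lambda>v. of_nat k * z ^ (k - 1) * v)) (at z)" for k
      using DERIV_power[OF DERIV_ident, of k z UNIV] by (simp add: has_field_derivative_def)
    show ?thesis
      unfolding q_def Dq_def complex_cnj_power[symmetric]
      using has_derivative_mult[OF 1[of "n + 1"] has_derivative_cnj[OF 1[of m]]]
      by (simp add: algebra_simps)
  qed
  have Dn: "((\<lambda>z. complex_of_real (r\<^sup>2 - (norm z)\<^sup>2)) has_derivative (\<lambda>v. - (cnj z * v + z * cnj v))) (at z)" for z :: complex
  proof -
    have "((\<lambda>z. of_real (r\<^sup>2) - z * cnj z) has_derivative (\<lambda>v. - (cnj z * v + z * cnj v))) (at z)"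
      by (auto intro!: derivative_eq_intros ext simp: algebra_simps)
    moreover have "(\<lambda>z. complex_of_real (r\<^sup>2 - (norm z)\<^sup>2)) = (\<lambda>z. of_real (r\<^sup>2) - z * cnj z)"
      by (simp add: complex_norm_square[symmetric])
    ultimately show ?thesis by simp
  qed
  have "loc_lip UNIV q"
    by (rule loc_lip_C1[OF Dq]) (auto simp: Dq_def intro!: continuous_intros)
  moreover have "loc_lip UNIV w"
  proof -
    have "loc_lip UNIV (\<lambda>z. complex_of_real (r\<^sup>2 - (norm z)\<^sup>2))"
      by (rule loc_lip_C1[OF Dn]) (auto intro!: continuous_intros)
    moreover have "dist (w x) (w y) \<le> dist (complex_of_real (r\<^sup>2 - (norm x)\<^sup>2)) (complex_of_real (r\<^sup>2 - (norm y)\<^sup>2))" for x y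
      unfolding w_def dist_of_real dist_real_def by (auto simp: max_def)
    then have "C-lipschitz_on A w" if "C-lipschitz_on A (\<lambda>z. complex_of_real (r\<^sup>2 - (norm z)\<^sup>2))" for C A
      using that unfolding lipschitz_on_def by (meson order_trans)
    ultimately show ?thesis unfolding loc_lip_def by meson
  qed
  ultimately have "loc_lip UNIV P" unfolding P_def by (rule loc_lip_mult)
  moreover have supp: "P z = 0" if "z \<notin> cball 0 r" for z
  proof -
    have "r\<^sup>2 \<le> (norm z)\<^sup>2" using that r by (intro power_mono) auto
    then show ?thesis by (simp add: P_def w_def)
  qed
  ultimately obtain C where C: "C-lipschitz_on UNIV P" by (rule loc_lip_imp_lipschitz)
  have N: "sphere (0::complex) r \<in> null_sets lebesgue"
    using negligible_sphere negligible_iff_null_sets by blast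
  define D where "D z v = (if z \<in> ball 0 r then q z * - (cnj z * v + z * cnj v) + Dq z v * of_real (r\<^sup>2 - (norm z)\<^sup>2) else 0)" for z v
  have D: "(P has_derivative D z) (at z)" if "z \<notin> sphere 0 r" for z
  proof (cases "z \<in> ball 0 r")
    case True
    have "((\<lambda>z. q z * complex_of_real (r\<^sup>2 - (norm z)\<^sup>2)) has_derivative D z) (at z)"
      using has_derivative_mult[OF Dq Dn] True by (simp add: D_def[abs_def])
    then show ?thesis
    proof (rule has_derivative_transform_within_open[OF _ open_ball True])
      fix x :: complex assume "x \<in> ball 0 r"
      then have "(norm x)\<^sup>2 \<le> r\<^sup>2" by (intro power_mono) auto
      then show "q x * complex_of_real (r\<^sup>2 - (norm x)\<^sup>2) = P x" by (simp add: P_def w_def)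
    qed
  next
    case False
    then have z: "z \<in> - cball 0 r" using that by auto
    have "D z = (\<lambda>v. 0)" using False by (auto simp: D_def)
    moreover have "(P has_derivative (\<lambda>v. 0)) (at z)"
      by (rule has_derivative_transform_within_open[OF has_derivative_const[of 0] _ z]) (use supp in auto)
    ultimately show ?thesis by simp
  qed
  have I: "integrable lebesgue (\<lambda>z. D z v)" "(LINT z|lebesgue. D z v) = 0" for v
    using integral_derivative_eq_0[OF C supp N D, where g = "\<lambda>z. D z v" and v = v] by auto
  have "(LINT z|lebesgue. wirt (- \<i>) (D z)) = 0"
    using I unfolding wirt_def by simp
  moreover have "wirt (- \<i>) (D z) = indicator (ball 0 r) z *\<^sub>R
      (of_nat (n + 1) * of_real (r\<^sup>2) * (z ^ n * cnj z ^ m) - of_nat (n + 2) * (z ^ (n + 1) * cnj z ^ (m + 1)))" for z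
  proof (cases "z \<in> ball 0 r")
    case True
    define A where "A = of_nat (n + 1) * z ^ n * cnj z ^ m * of_real (r\<^sup>2 - (norm z)\<^sup>2) - q z * cnj z"
    define B where "B = z ^ (n + 1) * (of_nat m * cnj z ^ (m - 1)) * of_real (r\<^sup>2 - (norm z)\<^sup>2) - q z * z"
    have "D z = (\<lambda>v. A * v + B * cnj v)"
      using True by (simp add: D_def Dq_def A_def B_def fun_eq_iff algebra_simps)
    then have "wirt (- \<i>) (D z) = A" by (simp add: wirt_linear_form)
    also have "A = of_nat (n + 1) * of_real (r\<^sup>2) * (z ^ n * cnj z ^ m) - of_nat (n + 2) * (z ^ (n + 1) * cnj z ^ (m + 1))"
    proof -
      have e: "complex_of_real (r\<^sup>2 - (norm z)\<^sup>2) = of_real (r\<^sup>2) - z * cnj z"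
        by (simp add: complex_norm_square[symmetric])
      show ?thesis unfolding A_def q_def e by (simp add: algebra_simps)
    qed
    finally show ?thesis using True by simp
  qed (simp add: D_def wirt_def)
  ultimately have "(LINT z:ball 0 r|lebesgue. of_nat (n + 1) * of_real (r\<^sup>2) * (z ^ n * cnj z ^ m) - of_nat (n + 2) * (z ^ (n + 1) * cnj z ^ (m + 1))) = 0"
    unfolding set_lebesgue_integral_def by simp
  then have "of_nat (n + 1) * of_real (r\<^sup>2) * disc_moment r n m - of_nat (n + 2) * disc_moment r (n + 1) (m + 1) = 0"
    unfolding disc_moment_def
    by (subst (asm) set_integral_diff) (auto intro!: set_integrable_mult_right set_integrable_moment simp del: of_nat_add power_Suc)
  then show ?thesis by (simp add: mult_ac)
qed

text \<open>The recursion and its complex conjugate express the same moment with different factors.\<close>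

lemma disc_moment_orthogonal:
  assumes r: "r > 0" and "n \<noteq> m"
  shows "disc_moment r n m = 0"
proof -
  have 1: "of_real (r\<^sup>2) * of_nat (n + 1) * disc_moment r n m = of_nat (n + 2) * disc_moment r (n + 1) (m + 1)"
    by (rule disc_moment_rec[OF r])
  have "cnj (of_real (r\<^sup>2) * of_nat (m + 1) * disc_moment r m n) = cnj (of_nat (m + 2) * disc_moment r (m + 1) (n + 1))"
    by (simp only: disc_moment_rec[OF r])
  then have 2: "of_real (r\<^sup>2) * of_nat (m + 1) * disc_moment r n m = of_nat (m + 2) * disc_moment r (n + 1) (m + 1)"
    by (simp only: complex_cnj_mult complex_cnj_complex_of_real complex_cnj_of_nat cnj_disc_moment)
  have "of_nat (m + 2) * (of_real (r\<^sup>2) * of_nat (n + 1) * disc_moment r n m) = of_nat (n + 2) * (of_real (r\<^sup>2) * of_nat (m + 1) * disc_moment r n m)"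
    unfolding 1 2 by (simp only: mult_ac)
  then have "of_real (r\<^sup>2) * (of_nat n - of_nat m) * disc_moment r n m = 0"
    by (simp add: algebra_simps)
  then show ?thesis using assms by simp
qed

lemma disc_moment_diagonal:
  assumes r: "r > 0"
  shows "disc_moment r n n = of_real (pi * r ^ (2 * n + 2) / (n + 1))"
proof (induction n)
  case 0
  have "measure lebesgue (ball (0::complex) r) = pi * r\<^sup>2"
    using r by (simp add: content_ball unit_ball_vol_2)
  then show ?case by (simp add: disc_moment_def set_lebesgue_integral_def scaleR_conv_of_real power2_eq_square)
next
  case (Suc n)
  have "of_nat (n + 2) * disc_moment r (Suc n) (Suc n) = of_real (r\<^sup>2) * of_nat (n + 1) * disc_moment r n n"
    using disc_moment_rec[OF r, of n n] by simp
  also have "\<dots> = of_real (r\<^sup>2 * real (n + 1) * (pi * r ^ (2 * n + 2) / (n + 1)))"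
    by (simp only: Suc of_real_mult of_real_of_nat_eq)
  also have "r\<^sup>2 * real (n + 1) * (pi * r ^ (2 * n + 2) / (n + 1)) = pi * r ^ (2 * Suc n + 2)"
    by (simp add: field_simps power_add power2_eq_square)
  finally have "disc_moment r (Suc n) (Suc n) = of_real (pi * r ^ (2 * Suc n + 2)) / of_nat (n + 2)"
    by (metis nonzero_mult_div_cancel_left of_nat_eq_0_iff add_is_0 zero_neq_numeral)
  then show ?case by (simp add: add.commute)
qed

text \<open>For partial sums this is the orthogonality of the monomials. The hypothesis makes the series bounded on the
disc, so dominated convergence applies.\<close>

lemma disc_integral_power_series:
  fixes b :: "nat \<Rightarrow> complex"
  assumes r: "r > 0" and b: "summable (\<lambda>n. norm (b n) * r ^ n)"
  shows "(\<lambda>n. pi * r ^ (2 * n + 2) / (n + 1) * (norm (b n))\<^sup>2) sums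
      (LINT z:ball 0 r|lebesgue. (norm (\<Sum>n. b n * z ^ n))\<^sup>2)"
    and "set_integrable lebesgue (ball 0 r) (\<lambda>z. (norm (\<Sum>n. b n * z ^ n))\<^sup>2)"
proof -
  define S where "S N z = (\<Sum>n<N. b n * z ^ n)" for N z
  define B where "B = (\<Sum>n. norm (b n) * r ^ n)"
  have le: "norm (b n * z ^ n) \<le> norm (b n) * r ^ n" if "z \<in> ball 0 r" for n z
    using that r by (auto simp: norm_mult norm_power intro!: mult_left_mono power_mono)
  have lim: "(\<lambda>N. S N z) \<longlonglongrightarrow> (\<Sum>n. b n * z ^ n)" if "z \<in> ball 0 r" for z
    unfolding S_def using summable_comparison_test'[OF b le[OF that]] by (rule summable_LIMSEQ)
  have Sb: "norm (S N z) \<le> B" if "z \<in> ball 0 r" for N z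
  proof -
    have "norm (S N z) \<le> (\<Sum>n<N. norm (b n * z ^ n))" unfolding S_def by (rule norm_sum)
    also have "\<dots> \<le> (\<Sum>n<N. norm (b n) * r ^ n)" by (intro sum_mono le that)
    also have "\<dots> \<le> B" unfolding B_def using r by (intro sum_le_suminf b) auto
    finally show ?thesis .
  qed
  define f where "f N z = indicator (ball 0 r) z *\<^sub>R (norm (S N z))\<^sup>2" for N z
  have f_meas: "f N \<in> borel_measurable lebesgue" for N
  proof -
    have "continuous_on UNIV (S N)" unfolding S_def by (intro continuous_intros)
    then have [measurable]: "S N \<in> borel_measurable lebesgue"
      by (intro measurable_completion) (simp add: borel_measurable_continuous_onI)
    have [measurable]: "ball (0::complex) r \<in> sets lebesgue" by simp
    show ?thesis unfolding f_def by measurable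
  qed
  have f_lim: "(\<lambda>N. f N z) \<longlonglongrightarrow> indicator (ball 0 r) z *\<^sub>R (norm (\<Sum>n. b n * z ^ n))\<^sup>2" for z
  proof (cases "z \<in> ball 0 r")
    case True
    have "(\<lambda>N. (norm (S N z))\<^sup>2) \<longlonglongrightarrow> (norm (\<Sum>n. b n * z ^ n))\<^sup>2"
      by (intro tendsto_intros lim[OF True])
    then show ?thesis using True by (simp add: f_def)
  qed (simp add: f_def)
  have lim_meas: "(\<lambda>z. indicator (ball 0 r) z *\<^sub>R (norm (\<Sum>n. b n * z ^ n))\<^sup>2) \<in> borel_measurable lebesgue"
    by (rule borel_measurable_LIMSEQ_real[OF f_lim f_meas])
  have w: "integrable lebesgue (\<lambda>z. B\<^sup>2 * indicator (cball (0::complex) r) z)"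
    by (intro integrable_mult_right integrable_indicator_cball)
  have f_b: "norm (f N z) \<le> B\<^sup>2 * indicator (cball 0 r) z" for N z
  proof (cases "z \<in> ball 0 r")
    case True
    have "(norm (S N z))\<^sup>2 \<le> B\<^sup>2" using Sb[OF True] by (intro power_mono) auto
    then show ?thesis using True by (simp add: f_def)
  qed (simp add: f_def)
  show "set_integrable lebesgue (ball 0 r) (\<lambda>z. (norm (\<Sum>n. b n * z ^ n))\<^sup>2)"
    unfolding set_integrable_def
    by (rule integrable_dominated_convergence[where s = f, OF lim_meas f_meas w]) (use f_lim f_b in auto)
  have conv: "(\<lambda>N. LINT z|lebesgue. f N z) \<longlonglongrightarrow> (LINT z:ball 0 r|lebesgue. (norm (\<Sum>n. b n * z ^ n))\<^sup>2)"
    unfolding set_lebesgue_integral_def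
    by (rule integral_dominated_convergence[where s = f, OF lim_meas f_meas w]) (use f_lim f_b in auto)
  have "(LINT z|lebesgue. f N z) = (\<Sum>n<N. pi * r ^ (2 * n + 2) / (n + 1) * (norm (b n))\<^sup>2)" for N
  proof -
    have it: "integrable lebesgue (\<lambda>z. indicator (ball 0 r) z *\<^sub>R (a * (z ^ j * cnj z ^ k)))" for a j k
      by (rule set_integrable_mult_right[OF set_integrable_moment, unfolded set_integrable_def])
    have mom: "(LINT z|lebesgue. indicator (ball 0 r) z *\<^sub>R (a * (z ^ j * cnj z ^ k))) = a * disc_moment r j k" for a j k
      using set_integral_mult_right[of lebesgue "ball 0 r" a "\<lambda>z. z ^ j * cnj z ^ k"] unfolding set_lebesgue_integral_def disc_moment_def .
    have "complex_of_real (f N z) = (\<Sum>j<N. \<Sum>k<N. indicator (ball 0 r) z *\<^sub>R (b j * cnj (b k) * (z ^ j * cnj z ^ k)))" for z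
    proof -
      have "complex_of_real ((norm (S N z))\<^sup>2) = S N z * cnj (S N z)" by (rule complex_norm_square)
      also have "\<dots> = (\<Sum>j<N. \<Sum>k<N. (b j * z ^ j) * cnj (b k * z ^ k))"
        unfolding S_def by (simp only: cnj_sum sum_product)
      also have "\<dots> = (\<Sum>j<N. \<Sum>k<N. b j * cnj (b k) * (z ^ j * cnj z ^ k))"
        by (intro sum.cong refl) (simp add: mult_ac)
      finally have "complex_of_real ((norm (S N z))\<^sup>2) = (\<Sum>j<N. \<Sum>k<N. b j * cnj (b k) * (z ^ j * cnj z ^ k))" .
      then show ?thesis unfolding f_def scaleR_sum_right[symmetric] by (simp add: scaleR_conv_of_real)
    qed
    then have "complex_of_real (LINT z|lebesgue. f N z) =
        (LINT z|lebesgue. (\<Sum>j<N. \<Sum>k<N. indicator (ball 0 r) z *\<^sub>R (b j * cnj (b k) * (z ^ j * cnj z ^ k))))"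
      by (simp flip: integral_complex_of_real)
    also have "\<dots> = (\<Sum>j<N. (LINT z|lebesgue. (\<Sum>k<N. indicator (ball 0 r) z *\<^sub>R (b j * cnj (b k) * (z ^ j * cnj z ^ k)))))"
      by (intro Bochner_Integration.integral_sum Bochner_Integration.integrable_sum it)
    also have "\<dots> = (\<Sum>j<N. \<Sum>k<N. b j * cnj (b k) * disc_moment r j k)"
      by (intro sum.cong refl) (simp only: Bochner_Integration.integral_sum it mom)
    also have "\<dots> = (\<Sum>j<N. of_real (pi * r ^ (2 * j + 2) / (j + 1) * (norm (b j))\<^sup>2))"
    proof (intro sum.cong refl)
      fix j assume j: "j \<in> {..<N}"
      have "(\<Sum>k<N. b j * cnj (b k) * disc_moment r j k) = (\<Sum>k<N. if k = j then b j * cnj (b j) * disc_moment r j j else 0)"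
        using disc_moment_orthogonal[OF r, of j] by (intro sum.cong refl) auto
      also have "\<dots> = b j * cnj (b j) * disc_moment r j j" using j by (simp add: sum.delta)
      finally show "(\<Sum>k<N. b j * cnj (b k) * disc_moment r j k) = of_real (pi * r ^ (2 * j + 2) / (j + 1) * (norm (b j))\<^sup>2)"
        unfolding disc_moment_diagonal[OF r] complex_norm_square[symmetric] by (simp only: of_real_mult mult.commute)
    qed
    finally have "complex_of_real (LINT z|lebesgue. f N z) = complex_of_real (\<Sum>n<N. pi * r ^ (2 * n + 2) / (n + 1) * (norm (b n))\<^sup>2)"
      by (simp only: of_real_sum)
    then show ?thesis by (simp only: of_real_eq_iff)
  qed
  then show "(\<lambda>n. pi * r ^ (2 * n + 2) / (n + 1) * (norm (b n))\<^sup>2) sums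
      (LINT z:ball 0 r|lebesgue. (norm (\<Sum>n. b n * z ^ n))\<^sup>2)"
    unfolding sums_def using conv by simp
qed

section \<open>Calculus of weak Wirtinger derivatives\<close>

lemma loc_L2_measurable: "loc_L2 U g \<Longrightarrow> g \<in> borel_measurable lebesgue"
  by (simp add: loc_L2_def)

lemma loc_L2_mono: "loc_L2 U g \<Longrightarrow> V \<subseteq> U \<Longrightarrow> loc_L2 V g"
  by (auto simp: loc_L2_def)

lemma loc_L2_bounded:
  assumes g: "g \<in> borel_measurable lebesgue"
    and b: "\<And>K. compact K \<Longrightarrow> K \<subseteq> U \<Longrightarrow> \<exists>B. \<forall>z\<in>K. norm (g z) \<le> B"
  shows "loc_L2 U g"
  unfolding loc_L2_def
proof (intro conjI allI impI g)
  fix K assume K: "compact K \<and> K \<subseteq> U"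
  obtain B where "\<forall>z\<in>K. norm (g z) \<le> B" using b[of K] K by auto
  then have B: "norm (g z) \<le> B" if "z \<in> K" for z using that by simp
  have [measurable]: "K \<in> sets lebesgue" "g \<in> borel_measurable lebesgue"
    using K g by (auto intro: lmeasurable_compact fmeasurableD)
  have "integrable lebesgue (\<lambda>z. B\<^sup>2 * indicator K z)"
    using K lmeasurable_compact[of K] by (intro integrable_mult_right) (simp add: lmeasurable_iff_integrable)
  then show "integrable lebesgue (\<lambda>z. indicator K z * (norm (g z))\<^sup>2)"
  proof (rule Bochner_Integration.integrable_bound)
    have "norm (indicator K z * (norm (g z))\<^sup>2) \<le> norm (B\<^sup>2 * indicator K z)" for z
      using B[of z] by (cases "z \<in> K") (auto intro!: power_mono)
    then show "AE z in lebesgue. norm (indicator K z * (norm (g z))\<^sup>2) \<le> norm (B\<^sup>2 * indicator K z)" by simp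
  qed measurable
qed

lemma loc_L2_linear:
  assumes "loc_L2 U g" "loc_L2 U h"
  shows "loc_L2 U (\<lambda>z. g z + c * h z)"
  unfolding loc_L2_def
proof (intro conjI allI impI)
  have [measurable]: "g \<in> borel_measurable lebesgue" "h \<in> borel_measurable lebesgue"
    using assms by (auto simp: loc_L2_def)
  show "(\<lambda>z. g z + c * h z) \<in> borel_measurable lebesgue" by measurable
  fix K assume K: "compact K \<and> K \<subseteq> U"
  have [measurable]: "K \<in> sets lebesgue" using K by (auto intro: lmeasurable_compact fmeasurableD)
  have "integrable lebesgue (\<lambda>z. 3 * (indicator K z * (norm (g z))\<^sup>2 + (norm c)\<^sup>2 * (indicator K z * (norm (h z))\<^sup>2)))"
    using assms K by (intro integrable_mult_right Bochner_Integration.integrable_add) (auto simp: loc_L2_def)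
  then show "integrable lebesgue (\<lambda>z. indicator K z * (norm (g z + c * h z))\<^sup>2)"
  proof (rule Bochner_Integration.integrable_bound)
    have "norm (indicator K z * (norm (g z + c * h z))\<^sup>2) \<le>
        norm (3 * (indicator K z * (norm (g z))\<^sup>2 + (norm c)\<^sup>2 * (indicator K z * (norm (h z))\<^sup>2)))" for z
      using norm_add_sq_le3[of "g z" "c * h z" 0] by (cases "z \<in> K") (simp_all add: norm_mult power_mult_distrib)
    then show "AE z in lebesgue. norm (indicator K z * (norm (g z + c * h z))\<^sup>2) \<le>
        norm (3 * (indicator K z * (norm (g z))\<^sup>2 + (norm c)\<^sup>2 * (indicator K z * (norm (h z))\<^sup>2)))" by simp
  qed measurable
qed

lemma integrable_continuous_test:
  assumes "continuous_on K u" "\<psi> \<in> smooth_expr" "compact K" "\<And>z. z \<notin> K \<Longrightarrow> \<psi> z = 0"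
  shows "integrable lebesgue (\<lambda>z. u z * \<psi> z)"
proof -
  have "integrable lborel (\<lambda>z. indicator K z *\<^sub>R (u z * \<psi> z))"
    by (intro borel_integrable_compact continuous_on_mult assms smooth_expr_continuous_on)
  then have "integrable lebesgue (\<lambda>z. indicator K z *\<^sub>R (u z * \<psi> z))"
    using integrable_completion borel_measurable_integrable by blast
  moreover have "indicator K z *\<^sub>R (u z * \<psi> z) = u z * \<psi> z" for z
    using assms(4)[of z] by (cases "z \<in> K") auto
  ultimately show ?thesis by simp
qed

lemma integrable_loc_L2_test:
  assumes "loc_L2 U g" "\<phi> \<in> smooth_expr" "compact K" "K \<subseteq> U" "\<And>z. z \<notin> K \<Longrightarrow> \<phi> z = 0"
  shows "integrable lebesgue (\<lambda>z. g z * \<phi> z)"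
proof -
  obtain R where R: "K \<subseteq> cball 0 R"
    using compact_imp_bounded[OF assms(3)] by (auto simp: bounded_iff subset_iff)
  have supp: "g z * \<phi> z = 0" if "z \<notin> cball 0 R" for z
  proof -
    have "z \<notin> K" using that R by blast
    then show ?thesis using assms(5) by simp
  qed
  have "integrable lebesgue (\<lambda>z. g z * \<phi> z * 1)"
    by (rule integrable_of_square_integrable[OF loc_L2_mult_smooth[OF assms] supp, where B = 1]) auto
  then show ?thesis by simp
qed

lemma set_integral_eq_integral:
  fixes f :: "complex \<Rightarrow> complex"
  assumes "\<And>z. z \<notin> U \<Longrightarrow> f z = 0"
  shows "(LINT z:U|lebesgue. f z) = (LINT z|lebesgue. f z)"
proof -
  have "indicator U z *\<^sub>R f z = f z" for z using assms[of z] by (cases "z \<in> U") auto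
  then show ?thesis unfolding set_lebesgue_integral_def by simp
qed

lemma wirt_frechet_vanish:
  assumes "compact K" "\<And>z. z \<notin> K \<Longrightarrow> \<phi> z = 0" "z \<notin> K"
  shows "wirt s (frechet_derivative \<phi> (at z)) = 0"
  using frechet_derivative_vanish_outside[OF assms] by (simp add: wirt_def)

lemma weak_wirt_linear:
  assumes u: "continuous_on U u" "loc_L2 U g" "weak_wirt s U u g"
    and u': "continuous_on U u'" "loc_L2 U g'" "weak_wirt s U u' g'"
  shows "weak_wirt s U (\<lambda>z. u z + c * u' z) (\<lambda>z. g z + c * g' z)"
  unfolding weak_wirt_def
proof (intro ballI allI impI)
  fix \<phi> K assume \<phi>: "\<phi> \<in> smooth_expr" and K: "compact K \<and> K \<subseteq> U \<and> (\<forall>z. z \<notin> K \<longrightarrow> \<phi> z = 0)"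
  define D where "D z = wirt s (frechet_derivative \<phi> (at z))" for z
  have i: "integrable lebesgue (\<lambda>z. u z * D z)" "integrable lebesgue (\<lambda>z. u' z * D z)"
    unfolding D_def using K wirt_frechet_vanish[of K \<phi> _ s]
    by (auto intro!: integrable_continuous_test[where K = K] wirt_smooth_expr \<phi>
        continuous_on_subset[OF u(1)] continuous_on_subset[OF u'(1)])
  have j: "integrable lebesgue (\<lambda>z. g z * \<phi> z)" "integrable lebesgue (\<lambda>z. g' z * \<phi> z)"
    using K by (auto intro!: integrable_loc_L2_test[OF u(2) \<phi>] integrable_loc_L2_test[OF u'(2) \<phi>])
  have e: "(LINT z|lebesgue. u z * D z) = - (LINT z|lebesgue. g z * \<phi> z)"
    "(LINT z|lebesgue. u' z * D z) = - (LINT z|lebesgue. g' z * \<phi> z)"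
    using u(3) u'(3) \<phi> K unfolding weak_wirt_def D_def by blast+
  have "(u z + c * u' z) * D z = u z * D z + c * (u' z * D z)"
    "(g z + c * g' z) * \<phi> z = g z * \<phi> z + c * (g' z * \<phi> z)" for z by (simp_all add: algebra_simps)
  then show "(LINT z|lebesgue. (u z + c * u' z) * wirt s (frechet_derivative \<phi> (at z))) =
      - (LINT z|lebesgue. (g z + c * g' z) * \<phi> z)"
    unfolding D_def[symmetric] using i j e by simp
qed

lemma weak_wirt_cong:
  assumes w: "weak_wirt s U u g" and u: "\<And>z. z \<in> U \<Longrightarrow> u' z = u z"
    and g: "g \<in> borel_measurable lebesgue" "g' \<in> borel_measurable lebesgue"
    and ae: "AE z in lebesgue. z \<in> U \<longrightarrow> g' z = g z"
  shows "weak_wirt s U u' g'"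
  unfolding weak_wirt_def
proof (intro ballI allI impI)
  fix \<phi> K assume \<phi>: "\<phi> \<in> smooth_expr" and K: "compact K \<and> K \<subseteq> U \<and> (\<forall>z. z \<notin> K \<longrightarrow> \<phi> z = 0)"
  have "u' z * wirt s (frechet_derivative \<phi> (at z)) = u z * wirt s (frechet_derivative \<phi> (at z))" for z
    using wirt_frechet_vanish[of K \<phi> z s] K u[of z] by (cases "z \<in> K") auto
  then have "(LINT z|lebesgue. u' z * wirt s (frechet_derivative \<phi> (at z))) = (LINT z|lebesgue. u z * wirt s (frechet_derivative \<phi> (at z)))"
    by (intro Bochner_Integration.integral_cong refl)
  also have "(LINT z|lebesgue. u z * wirt s (frechet_derivative \<phi> (at z))) = - (LINT z|lebesgue. g z * \<phi> z)"
    using w \<phi> K unfolding weak_wirt_def by blast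
  also have "(LINT z|lebesgue. g z * \<phi> z) = (LINT z|lebesgue. g' z * \<phi> z)"
  proof (rule integral_cong_AE)
    show "AE z in lebesgue. g z * \<phi> z = g' z * \<phi> z"
      using ae by eventually_elim (use K in auto)
  qed (intro borel_measurable_times g smooth_expr_measurable \<phi>)+
  finally show "(LINT z|lebesgue. u' z * wirt s (frechet_derivative \<phi> (at z))) = - (LINT z|lebesgue. g' z * \<phi> z)" .
qed

lemma weak_wirt_mono: "weak_wirt s U u g \<Longrightarrow> V \<subseteq> U \<Longrightarrow> weak_wirt s V u g"
  unfolding weak_wirt_def by blast

lemma weak_wirt_piecewise:
  assumes "open U" "loc_lip U f" "N \<in> null_sets lebesgue"
    "\<And>z. z \<in> U - N \<Longrightarrow> (f has_derivative D z) (at z)" "\<And>z. z \<in> U - N \<Longrightarrow> g z = wirt s (D z)"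
  shows "weak_wirt s U f g"
  unfolding weak_wirt_def
proof (intro ballI allI impI)
  fix \<phi> K assume \<phi>: "\<phi> \<in> smooth_expr" and K: "compact K \<and> K \<subseteq> U \<and> (\<forall>z. z \<notin> K \<longrightarrow> \<phi> z = 0)"
  have "(LINT z:U|lebesgue. f z * wirt s (frechet_derivative \<phi> (at z))) = - (LINT z:U|lebesgue. g z * \<phi> z)"
    by (rule weak_derivative_piecewise[OF assms smooth_expr_frechet(2)[OF \<phi>]
          smooth_expr_continuous_on[OF smooth_expr_frechet(3)[OF \<phi>]]
          smooth_expr_continuous_on[OF smooth_expr_frechet(3)[OF \<phi>]], of K]) (use K in auto)
  moreover have "f z * wirt s (frechet_derivative \<phi> (at z)) = 0" "g z * \<phi> z = 0" if "z \<notin> U" for z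
    using that K wirt_frechet_vanish[of K \<phi> z s] by auto
  ultimately show "(LINT z|lebesgue. f z * wirt s (frechet_derivative \<phi> (at z))) = - (LINT z|lebesgue. g z * \<phi> z)"
    by (simp add: set_integral_eq_integral)
qed

text \<open>A partition of unity splits the test function into one part supported in \<open>A\<close> and one supported away from \<open>a\<close>.\<close>

lemma weak_wirt_glue_point:
  assumes u: "continuous_on UNIV u" and g: "loc_L2 UNIV g" and a: "a \<in> A" "open A"
    and w: "weak_wirt s (- {a}) u g" "weak_wirt s A u g"
  shows "weak_wirt s UNIV u g"
  unfolding weak_wirt_def
proof (intro ballI allI impI)
  fix \<phi> K assume \<phi>: "\<phi> \<in> smooth_expr" and K: "compact K \<and> K \<subseteq> UNIV \<and> (\<forall>z. z \<notin> K \<longrightarrow> \<phi> z = 0)"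
  obtain r where r: "r > 0" "cball a r \<subseteq> A" using a open_contains_cball by blast
  define q where "q z = (z - a) * cnj (z - a)" for z
  have q: "Re (q z) = (norm (z - a))\<^sup>2" for z
    unfolding q_def complex_norm_square[symmetric] by simp
  define f1 where "f1 z = complex_of_real (flat 0 (Re (q z - of_real (r\<^sup>2 / 4))))" for z
  define f2 where "f2 z = complex_of_real (flat 0 (Re (of_real (r\<^sup>2) - q z)))" for z
  have "q \<in> smooth_expr"
    unfolding q_def by (intro smooth_expr.mult smooth_expr.cnj smooth_expr_diff smooth_expr.const smooth_expr.ident)
  then have f12: "f1 \<in> smooth_expr" "f2 \<in> smooth_expr"
    unfolding f1_def f2_def by (intro smooth_expr.flat smooth_expr_diff smooth_expr.const; assumption)+
  have nz: "f1 z + f2 z \<noteq> 0" for z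
  proof -
    have "flat 0 ((norm (z - a))\<^sup>2 - r\<^sup>2 / 4) + flat 0 (r\<^sup>2 - (norm (z - a))\<^sup>2) > 0"
    proof (cases "(norm (z - a))\<^sup>2 > r\<^sup>2 / 4")
      case True
      then show ?thesis by (intro add_pos_nonneg flat_pos flat_nonneg) simp
    next
      case False
      then have "(norm (z - a))\<^sup>2 < r\<^sup>2" using r zero_less_power[of r 2] by linarith
      then show ?thesis by (intro add_nonneg_pos flat_pos flat_nonneg) simp
    qed
    then show ?thesis
      unfolding f1_def f2_def using q[of z] by (simp flip: of_real_add)
  qed
  \<comment> \<open>Equal to 1 near a and supported in A; at every point at least one of f1 and f2 is positive.\<close>
  define \<theta> where "\<theta> z = f2 z * inverse (f1 z + f2 z)" for z
  have \<theta>: "\<theta> \<in> smooth_expr"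
    unfolding \<theta>_def by (intro smooth_expr.mult smooth_expr.inverse smooth_expr.add f12 nz)
  have \<theta>1: "\<theta> z = 1" if "z \<in> ball a (r / 2)" for z
  proof -
    have "(norm (z - a))\<^sup>2 \<le> (r / 2)\<^sup>2" using that by (intro power_mono) (auto simp: dist_norm norm_minus_commute)
    then have "f1 z = 0" by (simp add: f1_def q flat_zero power_divide)
    then show ?thesis using nz[of z] by (simp add: \<theta>_def)
  qed
  have \<theta>0: "\<theta> z = 0" if "z \<notin> cball a r" for z
  proof -
    have "r\<^sup>2 \<le> (norm (z - a))\<^sup>2" using that r by (intro power_mono) (auto simp: dist_norm norm_minus_commute)
    then show ?thesis by (simp add: \<theta>_def f2_def q flat_zero)
  qed
  define \<phi>1 where "\<phi>1 z = \<phi> z * \<theta> z" for z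
  define \<phi>2 where "\<phi>2 z = \<phi> z - \<phi>1 z" for z
  have \<phi>1: "\<phi>1 \<in> smooth_expr" unfolding \<phi>1_def by (intro smooth_expr.mult \<phi> \<theta>)
  have \<phi>2: "\<phi>2 \<in> smooth_expr" unfolding \<phi>2_def by (intro smooth_expr_diff \<phi> \<phi>1)
  define K1 where "K1 = K \<inter> cball a r"
  define K2 where "K2 = K - ball a (r / 2)"
  have K1: "compact K1" "K1 \<subseteq> A" "\<And>z. z \<notin> K1 \<Longrightarrow> \<phi>1 z = 0"
    using K r \<theta>0 by (auto simp: K1_def \<phi>1_def intro: compact_Int)
  have K2: "compact K2" "K2 \<subseteq> - {a}" "\<And>z. z \<notin> K2 \<Longrightarrow> \<phi>2 z = 0"
    using K r \<theta>1 by (auto simp: K2_def \<phi>2_def \<phi>1_def intro: compact_diff)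
  have e1: "(LINT z|lebesgue. u z * wirt s (frechet_derivative \<phi>1 (at z))) = - (LINT z|lebesgue. g z * \<phi>1 z)"
    using w(2) \<phi>1 K1 unfolding weak_wirt_def by blast
  have e2: "(LINT z|lebesgue. u z * wirt s (frechet_derivative \<phi>2 (at z))) = - (LINT z|lebesgue. g z * \<phi>2 z)"
    using w(1) \<phi>2 K2 unfolding weak_wirt_def by blast
  have D: "wirt s (frechet_derivative \<phi> (at z)) = wirt s (frechet_derivative \<phi>1 (at z)) + wirt s (frechet_derivative \<phi>2 (at z))" for z
  proof -
    have "((\<lambda>z. \<phi>1 z + \<phi>2 z) has_derivative (\<lambda>v. frechet_derivative \<phi>1 (at z) v + frechet_derivative \<phi>2 (at z) v)) (at z)"
      by (rule has_derivative_add[OF smooth_expr_frechet(2)[OF \<phi>1] smooth_expr_frechet(2)[OF \<phi>2]])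
    then have "(\<phi> has_derivative (\<lambda>v. frechet_derivative \<phi>1 (at z) v + frechet_derivative \<phi>2 (at z) v)) (at z)"
      by (simp add: \<phi>2_def)
    from frechet_derivative_at[OF this, symmetric] show ?thesis by (simp add: wirt_def field_simps)
  qed
  have i: "integrable lebesgue (\<lambda>z. u z * wirt s (frechet_derivative \<phi>1 (at z)))"
    "integrable lebesgue (\<lambda>z. u z * wirt s (frechet_derivative \<phi>2 (at z)))"
  proof -
    have v: "wirt s (frechet_derivative \<phi>1 (at z)) = 0" if "z \<notin> K1" for z
      by (rule wirt_frechet_vanish[OF K1(1) K1(3) that])
    show "integrable lebesgue (\<lambda>z. u z * wirt s (frechet_derivative \<phi>1 (at z)))"
      by (rule integrable_continuous_test[OF continuous_on_subset[OF u subset_UNIV] wirt_smooth_expr[OF \<phi>1] K1(1) v])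
    have v: "wirt s (frechet_derivative \<phi>2 (at z)) = 0" if "z \<notin> K2" for z
      by (rule wirt_frechet_vanish[OF K2(1) K2(3) that])
    show "integrable lebesgue (\<lambda>z. u z * wirt s (frechet_derivative \<phi>2 (at z)))"
      by (rule integrable_continuous_test[OF continuous_on_subset[OF u subset_UNIV] wirt_smooth_expr[OF \<phi>2] K2(1) v])
  qed
  have j: "integrable lebesgue (\<lambda>z. g z * \<phi>1 z)" "integrable lebesgue (\<lambda>z. g z * \<phi>2 z)"
  proof -
    show "integrable lebesgue (\<lambda>z. g z * \<phi>1 z)"
      by (rule integrable_loc_L2_test[OF g \<phi>1 K1(1) subset_UNIV]) (rule K1(3))
    show "integrable lebesgue (\<lambda>z. g z * \<phi>2 z)"
      by (rule integrable_loc_L2_test[OF g \<phi>2 K2(1) subset_UNIV]) (rule K2(3))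
  qed
  have "g z * \<phi> z = g z * \<phi>1 z + g z * \<phi>2 z" for z by (simp add: \<phi>2_def algebra_simps)
  then show "(LINT z|lebesgue. u z * wirt s (frechet_derivative \<phi> (at z))) = - (LINT z|lebesgue. g z * \<phi> z)"
    unfolding D distrib_left using i j e1 e2 by simp
qed

lemma test_function_of_smooth_expr:
  assumes "\<phi> \<in> smooth_expr" "compact K" "K \<subseteq> U" "\<And>z. z \<notin> K \<Longrightarrow> \<phi> z = 0"
  shows "\<phi> \<in> test_functions U"
proof -
  have sub: "support_on UNIV \<phi> \<subseteq> K" using assms(4) by (auto simp: support_on_def)
  then have "closure (support_on UNIV \<phi>) \<subseteq> K"
    using assms(2) by (intro closure_minimal compact_imp_closed)
  moreover have "compact (closure (support_on UNIV \<phi>))"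
    unfolding compact_closure using bounded_subset[OF compact_imp_bounded[OF assms(2)] sub] .
  ultimately show ?thesis
    using assms(3) smooth_expr_Ck[OF assms(1)] unfolding test_functions_def by blast
qed

text \<open>The integrals in the distributional definitions run over \<open>U\<close>; extension of the derivative by 0 turns them into
integrals over the plane.\<close>

lemma weak_wirt_of_distributional:
  shows "distributional_dz U f g \<Longrightarrow> weak_wirt (- \<i>) U f (\<lambda>z. if z \<in> U then g z else 0)"
    and "distributional_dzbar U f g \<Longrightarrow> weak_wirt \<i> U f (\<lambda>z. if z \<in> U then g z else 0)"
proof -
  have gen: "weak_wirt s U f (\<lambda>z. if z \<in> U then g z else 0)"
    if d: "\<And>\<phi>. \<phi> \<in> test_functions U \<Longrightarrow>
      (LINT z:U|lebesgue. f z * wirt s (frechet_derivative \<phi> (at z))) = - (LINT z:U|lebesgue. g z * \<phi> z)" for s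
    unfolding weak_wirt_def
  proof (intro ballI allI impI)
    fix \<phi> K assume \<phi>: "\<phi> \<in> smooth_expr" and K: "compact K \<and> K \<subseteq> U \<and> (\<forall>z. z \<notin> K \<longrightarrow> \<phi> z = 0)"
    have "\<phi> \<in> test_functions U" by (rule test_function_of_smooth_expr[OF \<phi>, of K]) (use K in auto)
    note e = d[OF this]
    have "f z * wirt s (frechet_derivative \<phi> (at z)) = 0" if "z \<notin> U" for z
      using that K wirt_frechet_vanish[of K \<phi> z s] by auto
    then have l: "(LINT z:U|lebesgue. f z * wirt s (frechet_derivative \<phi> (at z))) = (LINT z|lebesgue. f z * wirt s (frechet_derivative \<phi> (at z)))"
      by (rule set_integral_eq_integral)
    have "indicator U z *\<^sub>R (g z * \<phi> z) = (if z \<in> U then g z else 0) * \<phi> z" for z by simp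
    then have "(LINT z:U|lebesgue. g z * \<phi> z) = (LINT z|lebesgue. (if z \<in> U then g z else 0) * \<phi> z)"
      unfolding set_lebesgue_integral_def by (intro Bochner_Integration.integral_cong refl)
    with e l show "(LINT z|lebesgue. f z * wirt s (frechet_derivative \<phi> (at z))) =
        - (LINT z|lebesgue. (if z \<in> U then g z else 0) * \<phi> z)" by simp
  qed
  show "distributional_dz U f g \<Longrightarrow> weak_wirt (- \<i>) U f (\<lambda>z. if z \<in> U then g z else 0)"
    by (rule gen) (simp add: distributional_dz_def wirtinger_dz_eq)
  show "distributional_dzbar U f g \<Longrightarrow> weak_wirt \<i> U f (\<lambda>z. if z \<in> U then g z else 0)"
    by (rule gen) (simp add: distributional_dzbar_def wirtinger_dzbar_eq)
qed

lemma loc_L2_of_locally_L2: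
  assumes "locally_L2 U g" "open U"
  shows "loc_L2 U (\<lambda>z. if z \<in> U then g z else 0)"
  unfolding loc_L2_def
proof (intro conjI allI impI)
  have "U \<in> sets lebesgue" using assms(2) by auto
  then show "(\<lambda>z. if z \<in> U then g z else 0) \<in> borel_measurable lebesgue"
    using assms(1) by (simp add: locally_L2_def borel_measurable_if)
  fix K assume K: "compact K \<and> K \<subseteq> U"
  then have "integrable lebesgue (\<lambda>z. indicator K z *\<^sub>R (norm (g z))\<^sup>2)"
    using assms(1) by (auto simp: locally_L2_def set_integrable_def)
  moreover have eq: "(\<lambda>z. indicator K z *\<^sub>R (norm (g z))\<^sup>2) = (\<lambda>z. indicator K z * (norm (if z \<in> U then g z else 0))\<^sup>2)"
    using K by (auto simp: indicator_def fun_eq_iff)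
  ultimately show "integrable lebesgue (\<lambda>z. indicator K z * (norm (if z \<in> U then g z else 0))\<^sup>2)"
    by (simp only: eq)
qed

lemma loc_lip_holomorphic:
  assumes "f holomorphic_on U" "open U"
  shows "loc_lip U f"
proof (rule loc_lip_C1[where D = "\<lambda>z v. deriv f z * v"])
  show "(f has_derivative (\<lambda>v. deriv f z * v)) (at z)" if "z \<in> U" for z
    using holomorphic_derivI[OF assms that] by (simp add: has_field_derivative_def)
  have "continuous_on U (deriv f)" using assms by (intro holomorphic_on_imp_continuous_on holomorphic_deriv)
  then show "continuous_on U (\<lambda>z. deriv f z * 1)" "continuous_on U (\<lambda>z. deriv f z * \<i>)"
    by (auto intro!: continuous_intros)
qed fact

lemma wirt_mult: "wirt (- \<i>) (\<lambda>v. a * v) = a" "wirt \<i> (\<lambda>v. a * v) = 0"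
  using wirt_linear_form[of a 0] by simp_all

section \<open>Expansions in the disc and continuous maps of the sphere\<close>

text \<open>The identity theorem with one point \<open>q\<close> left out. It makes the coefficients of functions with a pole in the disc
unique, although the expansion is only required off the pole.\<close>

lemma power_series_coeff_eq_0:
  fixes d :: "nat \<Rightarrow> complex"
  assumes sm: "\<And>z. z \<in> ball 0 1 - {q} \<Longrightarrow> (\<lambda>n. d n * z ^ n) sums 0"
  shows "d n = 0"
proof -
  have summ: "summable (\<lambda>n. d n * z ^ n)" if z: "z \<in> ball 0 1" for z
  proof -
    define w :: complex where "w = of_real ((norm z + 1) / 2)"
    have w: "norm z < norm w" "norm w < 1" "w \<noteq> 0"
      using z by (simp_all add: w_def norm_divide flip: of_real_add of_real_divide) (use norm_ge_zero[of z] in linarith)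
    \<comment> \<open>On every circle around 0 there is a point other than q, so the series converges in the whole disc.\<close>
    have "w \<noteq> q \<or> - w \<noteq> q" using w(3) by auto
    then obtain w' where w': "w' \<noteq> q" "norm w' = norm w" using norm_minus_cancel by metis
    then have "summable (\<lambda>n. d n * w' ^ n)" using sm[of w'] w by (auto simp: sums_iff)
    then show ?thesis by (rule powser_inside) (use w w' in simp)
  qed
  define g where "g z = (\<Sum>n. d n * z ^ n)" for z
  have g: "(\<lambda>n. d n * (z - 0) ^ n) sums g z" if "z \<in> ball 0 1" for z
    using summ[OF that] by (simp add: g_def summable_sums)
  then have "g holomorphic_on ball 0 1" by (rule power_series_holomorphic)
  then have cont: "continuous_on (ball 0 1) g" by (rule holomorphic_on_imp_continuous_on)
  have g0: "g z = 0" if "z \<in> ball 0 1 - {q}" for z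
    using sm[OF that] by (simp add: g_def sums_iff)
  have gz: "g z = 0" if z: "z \<in> ball 0 1" for z
  proof (cases "z = q")
    case True
    have "(g \<longlongrightarrow> g q) (at q)"
      using cont z True by (simp add: continuous_on_eq_continuous_at isCont_def)
    moreover have "(g \<longlongrightarrow> 0) (at q)"
    proof (rule tendsto_eventually)
      have "eventually (\<lambda>w. w \<in> ball 0 1 - {q}) (at q)"
        using z True by (intro eventually_at_in_open) auto
      then show "eventually (\<lambda>w. g w = 0) (at q)" by eventually_elim (rule g0)
    qed
    ultimately show ?thesis using True tendsto_unique[OF at_neq_bot] by blast
  qed (use g0 z in auto)
  have s0: "(\<lambda>n. d n * (z - 0) ^ n) sums 0" if "norm (z - 0) < 1" for z
    using g[of z] gz[of z] that by simp
  show ?thesis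
  proof (cases "n = 0")
    case True
    have "(\<lambda>n. d n * 0 ^ n) sums d 0" by (rule powser_sums_zero)
    then show ?thesis using s0[of 0] sums_unique2 True by auto
  next
    case False
    show ?thesis
    proof (rule ccontr)
      assume "d n \<noteq> 0"
      then obtain s where s: "0 < s" "\<And>z::complex. z \<in> cball 0 s - {0} \<Longrightarrow> (0::complex) \<noteq> 0"
        using powser_0_nonzero[of 1 0 d "\<lambda>_. 0" n] s0 False by auto
      then show False using s(2)[of "of_real s"] by simp
    qed
  qed
qed

text \<open>A simple pole of residue 1 means that \<open>(z - p) f(z)\<close> tends to 1, so \<open>1 / (z - p)\<close> may be subtracted and the
singularity of the difference is removable. By uniqueness of the coefficients the description that defines
\<open>Sigma_coeff\<close> picks the Taylor coefficients of this regular part.\<close>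

lemma Sigma_class_expansion:
  assumes p: "p \<in> {0..<1}" and f: "f \<in> Sigma_class p"
  shows "\<exists>\<omega>. \<omega> holomorphic_on ball 0 1 \<and>
    (\<forall>z\<in>ball 0 1 - {of_real p}. f z = Some (1 / (z - of_real p) + \<omega> z)) \<and>
    (\<forall>z\<in>ball 0 1. (\<lambda>n. Sigma_coeff p f n * z ^ n) sums \<omega> z)"
proof -
  let ?p = "complex_of_real p"
  define g where "g z = the (f z)" for z
  have pD: "?p \<in> ball 0 1" using p by simp
  have mero: "meromorphic_into_sphere f (ball 0 1)" and inj: "inj_on f (ball 0 1)" and fp: "f ?p = None"
    and ord: "zorder g ?p = -1" and res: "residue g ?p = 1"
    using f by (auto simp: Sigma_class_def g_def[abs_def])
  have some: "f z = Some (g z)" if "z \<in> ball 0 1 - {?p}" for z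
    using inj_onD[OF inj, of z ?p] that pD fp by (cases "f z") (auto simp: g_def)
  have "g analytic_on {z}" if "z \<in> ball 0 1 - {?p}" for z
  proof -
    have "f z \<noteq> None" using some[OF that] by simp
    then show ?thesis using bspec[OF mero[unfolded meromorphic_into_sphere_def], of z] that by (simp add: g_def[abs_def])
  qed
  then have "g analytic_on (ball 0 1 - {?p})" by (subst analytic_on_analytic_at) blast
  then have hol: "g holomorphic_on (ball 0 1 - {?p})" by (rule analytic_imp_holomorphic)
  have pole: "is_pole g ?p"
    using bspec[OF mero[unfolded meromorphic_into_sphere_def] pD] fp by (simp add: g_def[abs_def])
  have iso: "isolated_singularity_at g ?p"
    using pD by (intro isolated_singularity_at_holomorphic[OF hol]) auto
  have "eventually (\<lambda>w. zor_poly g ?p w = g w * (w - ?p)) (at ?p)"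
    using zor_poly_pole_eq[OF iso pole] by (simp add: ord)
  moreover have "(zor_poly g ?p \<longlongrightarrow> 1) (at ?p)"
  proof -
    obtain r where r: "r > 0" "zor_poly g ?p holomorphic_on cball ?p r"
      using zorder_exist_pole[OF hol open_ball pD pole] by blast
    then have "isCont (zor_poly g ?p) ?p"
      by (meson ball_subset_cball centre_in_ball continuous_on_eq_continuous_at continuous_on_subset holomorphic_on_imp_continuous_on open_ball)
    then show ?thesis using residue_simple_pole[OF iso pole ord] res by (simp add: isCont_def)
  qed
  ultimately have lim: "((\<lambda>w. g w * (w - ?p)) \<longlongrightarrow> 1) (at ?p)"
    by (rule Lim_transform_eventually[rotated])
  have h: "(\<lambda>z. g z - 1 / (z - ?p)) holomorphic_on (ball 0 1 - {?p})"
    by (intro holomorphic_intros hol) auto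
  have "((\<lambda>z. g z * (z - ?p) - 1) \<longlongrightarrow> 1 - 1) (at ?p)" by (intro tendsto_intros lim)
  then have l: "((\<lambda>z. g z * (z - ?p) - 1) \<longlongrightarrow> 0) (at ?p)" by simp
  have ev: "eventually (\<lambda>z. g z * (z - ?p) - 1 = (z - ?p) * (g z - 1 / (z - ?p))) (at ?p)"
    by (auto simp: eventually_at_filter field_simps)
  have "((\<lambda>z. (z - ?p) * (g z - 1 / (z - ?p))) \<longlongrightarrow> 0) (at ?p)"
    by (rule Lim_transform_eventually[OF l ev])
  then obtain \<omega> where \<omega>: "\<omega> holomorphic_on ball 0 1" "\<And>z. z \<in> ball 0 1 - {?p} \<Longrightarrow> \<omega> z = g z - 1 / (z - ?p)"
    using holomorphic_on_extend_lim[OF h] pD by (auto simp: interior_open)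
  define a where "a n = (deriv ^^ n) \<omega> 0 / fact n" for n
  have a: "(\<lambda>n. a n * z ^ n) sums \<omega> z" if "z \<in> ball 0 1" for z
    using holomorphic_power_series[OF \<omega>(1) that] by (simp add: a_def)
  have "Sigma_coeff p f = a"
    unfolding Sigma_coeff_def
  proof (rule the_equality)
    show "\<forall>z\<in>ball 0 1 - {?p}. (\<lambda>n. a n * z ^ n) sums (the (f z) - 1 / (z - ?p))"
    proof
      fix z assume z: "z \<in> ball 0 1 - {?p}"
      then show "(\<lambda>n. a n * z ^ n) sums (the (f z) - 1 / (z - ?p))"
        using a[of z] \<omega>(2)[OF z] by (simp add: g_def)
    qed
    fix b assume b: "\<forall>z\<in>ball 0 1 - {?p}. (\<lambda>n. b n * z ^ n) sums (the (f z) - 1 / (z - ?p))"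
    have "b n - a n = 0" for n
    proof (rule power_series_coeff_eq_0[where q = ?p])
      fix z assume z: "z \<in> ball 0 1 - {?p}"
      have "(\<lambda>n. b n * z ^ n - a n * z ^ n) sums ((the (f z) - 1 / (z - ?p)) - \<omega> z)"
        using b z a[of z] by (intro sums_diff) auto
      then show "(\<lambda>n. (b n - a n) * z ^ n) sums 0"
        using \<omega>(2)[OF z] by (simp add: g_def algebra_simps)
    qed
    then show "b = a" by auto
  qed
  then show ?thesis using \<omega> a some by (intro exI[of _ \<omega>]) auto
qed

lemma sphere_map_finite_part:
  assumes F: "continuous_map riemann_sphere riemann_sphere F"
  shows "open {z. F (Some z) \<noteq> None}"
    and "continuous_on {z. F (Some z) \<noteq> None} (\<lambda>z. the (F (Some z)))"
    and "F None = Some c \<Longrightarrow> ((\<lambda>z. the (F (Some z))) \<longlongrightarrow> c) at_infinity"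
proof -
  have pre: "openin riemann_sphere {x. F x \<in> Some ` V}" if "open V" for V
  proof -
    have "openin riemann_sphere {x \<in> topspace riemann_sphere. F x \<in> Some ` V}"
      using that by (intro openin_continuous_map_preimage[OF F]) simp
    moreover have "{x \<in> topspace riemann_sphere. F x \<in> Some ` V} = {x. F x \<in> Some ` V}"
      by (auto simp: UNIV_option_conv[symmetric])
    ultimately show ?thesis by simp
  qed
  have op: "open {z. F (Some z) \<in> Some ` V}" if "open V" for V
  proof -
    have "openin euclidean {z \<in> topspace euclidean. Some z \<in> {x. F x \<in> Some ` V}}"
      by (rule openin_continuous_map_preimage[OF continuous_map_Some pre[OF that]])
    then show ?thesis by simp
  qed
  have U: "{z. F (Some z) \<noteq> None} = {z. F (Some z) \<in> Some ` UNIV}" by (auto simp: image_iff)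
  show 1: "open {z. F (Some z) \<noteq> None}" unfolding U by (rule op) simp
  show "continuous_on {z. F (Some z) \<noteq> None} (\<lambda>z. the (F (Some z)))"
    unfolding continuous_on_open_vimage[OF 1]
  proof (intro allI impI)
    fix B :: "complex set" assume "open B"
    have "(\<lambda>z. the (F (Some z))) -` B \<inter> {z. F (Some z) \<noteq> None} = {z. F (Some z) \<in> Some ` B}" by auto
    then show "open ((\<lambda>z. the (F (Some z))) -` B \<inter> {z. F (Some z) \<noteq> None})" using op[OF \<open>open B\<close>] by simp
  qed
  show "((\<lambda>z. the (F (Some z))) \<longlongrightarrow> c) at_infinity" if c: "F None = Some c"
  proof (rule topological_tendstoI)
    fix V assume V: "open V" "c \<in> V"
    have None: "None \<in> {x. F x \<in> Some ` V}" using c V by auto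
    with pre[OF V(1)] obtain C where C: "compact C" "{x. F x \<in> Some ` V} = insert None (Some ` (UNIV - C))"
      unfolding openin_Alexandroff_compactification by auto
    obtain B where B: "\<And>z. z \<in> C \<Longrightarrow> norm z \<le> B" using compact_imp_bounded[OF C(1)] by (auto simp: bounded_iff)
    have "the (F (Some z)) \<in> V" if "norm z \<ge> B + 1" for z
    proof -
      have "z \<notin> C" using B[of z] that by auto
      then have "Some z \<in> {x. F x \<in> Some ` V}" unfolding C(2) by blast
      then show ?thesis by auto
    qed
    then show "eventually (\<lambda>z. the (F (Some z)) \<in> V) at_infinity"
      unfolding eventually_at_infinity by blast
  qed
qed

text \<open>A segment from inside to outside meets the unit circle, and distances add up along the segment.\<close>

lemma lipschitz_on_glue_disc:
  fixes f :: "complex \<Rightarrow> complex"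
  assumes i: "L-lipschitz_on (cball 0 1) f" and o: "L-lipschitz_on {z. norm z \<ge> 1} f"
  shows "L-lipschitz_on UNIV f"
proof (rule lipschitz_onI)
  have mixed: "dist (f z) (f w) \<le> L * dist z w" if le: "norm z \<le> 1" "norm w \<ge> 1" for z w
  proof -
    obtain q where q: "q \<in> closed_segment z w" "norm q = 1"
    proof (cases "norm w = 1")
      case False
      have "closed_segment z w \<inter> frontier (cball (0::complex) 1) \<noteq> {}"
      proof (rule connected_Int_frontier)
        have "z \<in> closed_segment z w \<inter> cball 0 1" using le by simp
        then show "closed_segment z w \<inter> cball 0 1 \<noteq> {}" by blast
        have "w \<in> closed_segment z w - cball 0 1" using le False by simp
        then show "closed_segment z w - cball 0 1 \<noteq> {}" by blast
      qed simp
      then show ?thesis using that by auto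
    next
      case True
      show ?thesis by (rule that[of w]) (use True in auto)
    qed
    have "dist (f z) (f w) \<le> dist (f z) (f q) + dist (f q) (f w)" by (rule dist_triangle)
    also have "\<dots> \<le> L * dist z q + L * dist q w"
      using le q by (intro add_mono lipschitz_onD[OF i] lipschitz_onD[OF o]) auto
    also have "\<dots> = L * dist z w"
      using q(1) between[of z w q] by (simp add: between_mem_segment distrib_left)
    finally show ?thesis .
  qed
  fix z w
  show "dist (f z) (f w) \<le> L * dist z w"
  proof (cases "norm z \<le> 1"; cases "norm w \<le> 1")
    assume "norm z \<le> 1" "norm w \<le> 1"
    then show ?thesis by (intro lipschitz_onD[OF i]) auto
  next
    assume "norm z \<le> 1" "\<not> norm w \<le> 1"
    then show ?thesis by (intro mixed) auto
  next
    assume "\<not> norm z \<le> 1" "norm w \<le> 1"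
    then show ?thesis using mixed[of w z] by (simp add: dist_commute)
  next
    assume "\<not> norm z \<le> 1" "\<not> norm w \<le> 1"
    then show ?thesis by (intro lipschitz_onD[OF o]) auto
  qed
qed (rule lipschitz_on_nonneg[OF i])

section \<open>The reflected Cauchy kernel\<close>

text \<open>
The function \<open>1 / (z - p)\<close> outside the disc, continued inside by composing it with the reflection
\<open>z \<mapsto> 1 / cnj z\<close>. It is continuous, holomorphic outside and antiholomorphic inside, so that its two Wirtinger
derivatives have disjoint supports, and outside the disc it cannot be told from the polar part.
\<close>

definition refl_kernel :: "real \<Rightarrow> complex \<Rightarrow> complex" where
  "refl_kernel p z = (if norm z < 1 then cnj (z / (1 - of_real p * z)) else 1 / (z - of_real p))"

definition refl_kernel_dz :: "real \<Rightarrow> complex \<Rightarrow> complex" where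
  "refl_kernel_dz p z = (if norm z < 1 then 0 else - (1 / (z - of_real p)\<^sup>2))"

definition refl_kernel_dzbar :: "real \<Rightarrow> complex \<Rightarrow> complex" where
  "refl_kernel_dzbar p z = (if norm z < 1 then cnj (1 / (1 - of_real p * z)\<^sup>2) else 0)"

context
  fixes p :: real
  assumes p: "0 \<le> p" "p < 1"
begin

lemma norm_one_minus_ge: "norm z \<le> 1 \<Longrightarrow> norm (1 - of_real p * z) \<ge> 1 - p" for z :: complex
proof -
  assume "norm z \<le> 1"
  then have "norm (of_real p * z) \<le> p" using p by (simp add: norm_mult mult_left_le)
  then show ?thesis using norm_triangle_ineq2[of 1 "of_real p * z"] by simp
qed

lemma norm_minus_pole_ge: "norm z \<ge> 1 \<Longrightarrow> norm (z - of_real p) \<ge> 1 - p" for z :: complex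
  using norm_triangle_ineq2[of z "of_real p"] p by simp

lemma one_minus_nonzero: "norm z \<le> 1 \<Longrightarrow> 1 - of_real p * z \<noteq> 0" for z :: complex
  using norm_one_minus_ge[of z] p by auto

lemma minus_pole_nonzero: "norm z \<ge> 1 \<Longrightarrow> z - of_real p \<noteq> 0" for z :: complex
  using norm_minus_pole_ge[of z] p by auto

lemma refl_kernel_closed: "norm z \<le> 1 \<Longrightarrow> refl_kernel p z = cnj (z / (1 - of_real p * z))"
proof (cases "norm z < 1")
  case False
  assume "norm z \<le> 1"
  then have z: "norm z = 1" using False by simp
  then have zz: "z * cnj z = 1" by (simp add: complex_norm_square[symmetric])
  have "1 - of_real p * cnj z \<noteq> 0" using one_minus_nonzero[of "cnj z"] z by simp
  moreover have "z - of_real p \<noteq> 0" using minus_pole_nonzero[of z] z by simp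
  moreover have "cnj z * (z - of_real p) = 1 - of_real p * cnj z"
    using zz by (simp add: algebra_simps)
  ultimately have "1 / (z - of_real p) = cnj z / (1 - of_real p * cnj z)"
    by (simp add: frac_eq_eq)
  then show ?thesis using z by (simp add: refl_kernel_def)
qed (simp add: refl_kernel_def)

lemma refl_kernel_lipschitz: "(1 / (1 - p)\<^sup>2)-lipschitz_on UNIV (refl_kernel p)"
proof (rule lipschitz_on_glue_disc; rule lipschitz_onI)
  fix z w :: complex assume zw: "z \<in> cball 0 1" "w \<in> cball 0 1"
  have nz: "1 - of_real p * z \<noteq> 0" "1 - of_real p * w \<noteq> 0" using one_minus_nonzero zw by auto
  have "z / (1 - of_real p * z) - w / (1 - of_real p * w) = (z - w) / ((1 - of_real p * z) * (1 - of_real p * w))"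
    using nz by (simp add: field_simps)
  then have "dist (refl_kernel p z) (refl_kernel p w) = norm (z - w) / (norm (1 - of_real p * z) * norm (1 - of_real p * w))"
  proof -
    assume eq: "z / (1 - of_real p * z) - w / (1 - of_real p * w) = (z - w) / ((1 - of_real p * z) * (1 - of_real p * w))"
    have "refl_kernel p z = cnj (z / (1 - of_real p * z))" "refl_kernel p w = cnj (w / (1 - of_real p * w))"
      by (rule refl_kernel_closed, use zw in simp)+
    then show ?thesis
      by (simp only: dist_norm complex_cnj_diff[symmetric] complex_mod_cnj eq norm_divide norm_mult)
  qed
  also have "\<dots> \<le> norm (z - w) / ((1 - p) * (1 - p))"
    using zw p nz by (intro divide_left_mono mult_mono norm_one_minus_ge mult_pos_pos) auto
  finally show "dist (refl_kernel p z) (refl_kernel p w) \<le> 1 / (1 - p)\<^sup>2 * dist z w"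
    by (simp add: dist_norm power2_eq_square)
next
  fix z w :: complex assume zw: "z \<in> {z. norm z \<ge> 1}" "w \<in> {z. norm z \<ge> 1}"
  have nz: "z - of_real p \<noteq> 0" "w - of_real p \<noteq> 0" using minus_pole_nonzero zw by auto
  have "1 / (z - of_real p) - 1 / (w - of_real p) = (w - z) / ((z - of_real p) * (w - of_real p))"
    using nz by (simp add: diff_frac_eq)
  then have "dist (refl_kernel p z) (refl_kernel p w) = norm (z - w) / (norm (z - of_real p) * norm (w - of_real p))"
    using zw by (simp add: refl_kernel_def dist_norm norm_mult norm_divide norm_minus_commute)
  also have "\<dots> \<le> norm (z - w) / ((1 - p) * (1 - p))"
    using zw p nz by (intro divide_left_mono mult_mono norm_minus_pole_ge mult_pos_pos) auto
  finally show "dist (refl_kernel p z) (refl_kernel p w) \<le> 1 / (1 - p)\<^sup>2 * dist z w"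
    by (simp add: dist_norm power2_eq_square)
qed (use p in auto)

lemma refl_kernel_has_derivative:
  assumes "norm z \<noteq> 1"
  shows "(refl_kernel p has_derivative (\<lambda>v. refl_kernel_dz p z * v + refl_kernel_dzbar p z * cnj v)) (at z)"
proof (cases "norm z < 1")
  case True
  have nz: "1 - of_real p * z \<noteq> 0" using one_minus_nonzero True by auto
  have "((\<lambda>z. z / (1 - of_real p * z)) has_field_derivative 1 / (1 - of_real p * z)\<^sup>2) (at z)"
    using nz by (auto intro!: derivative_eq_intros simp: power2_eq_square field_simps)
  then have "((\<lambda>z. cnj (z / (1 - of_real p * z))) has_derivative (\<lambda>v. cnj (1 / (1 - of_real p * z)\<^sup>2 * v))) (at z)"
    by (intro has_derivative_cnj) (simp only: has_field_derivative_def)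
  then have "(refl_kernel p has_derivative (\<lambda>v. cnj (1 / (1 - of_real p * z)\<^sup>2 * v))) (at z)"
    by (rule has_derivative_transform_within_open[where s = "ball 0 1"]) (use True in \<open>auto simp: refl_kernel_def\<close>)
  then show ?thesis using True by (simp add: refl_kernel_dz_def refl_kernel_dzbar_def)
next
  case False
  have nz: "z - of_real p \<noteq> 0" using minus_pole_nonzero False by auto
  have "((\<lambda>z. 1 / (z - of_real p)) has_field_derivative - (1 / (z - of_real p)\<^sup>2)) (at z)"
    using nz by (auto intro!: derivative_eq_intros simp: power2_eq_square)
  then have "((\<lambda>z. 1 / (z - of_real p)) has_derivative (\<lambda>v. - (1 / (z - of_real p)\<^sup>2) * v)) (at z)"
    by (simp only: has_field_derivative_def)
  then have "(refl_kernel p has_derivative (\<lambda>v. - (1 / (z - of_real p)\<^sup>2) * v)) (at z)"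
  proof (rule has_derivative_transform_within_open[where s = "- cball 0 1"])
    show "z \<in> - cball 0 1" using False assms by simp
  qed (auto simp: refl_kernel_def)
  then show ?thesis using False by (simp add: refl_kernel_dz_def refl_kernel_dzbar_def)
qed

lemma refl_kernel_dz_measurable: "refl_kernel_dz p \<in> borel_measurable lebesgue"
proof -
  have "(\<lambda>z. if z \<in> ball 0 1 then 0 else - (1 / (z - complex_of_real p)\<^sup>2)) \<in> borel_measurable borel"
    using minus_pole_nonzero
    by (intro borel_measurable_continuous_on_if continuous_intros) auto
  moreover have "refl_kernel_dz p = (\<lambda>z. if z \<in> ball 0 1 then 0 else - (1 / (z - of_real p)\<^sup>2))"
    by (auto simp: refl_kernel_dz_def fun_eq_iff)
  ultimately show ?thesis by (intro measurable_completion) simp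
qed

lemma refl_kernel_dzbar_measurable: "refl_kernel_dzbar p \<in> borel_measurable lebesgue"
proof -
  have "(\<lambda>z. if z \<in> ball 0 1 then cnj (1 / (1 - complex_of_real p * z)\<^sup>2) else 0) \<in> borel_measurable borel"
    using one_minus_nonzero
    by (intro borel_measurable_continuous_on_if continuous_intros) auto
  moreover have "refl_kernel_dzbar p = (\<lambda>z. if z \<in> ball 0 1 then cnj (1 / (1 - of_real p * z)\<^sup>2) else 0)"
    by (auto simp: refl_kernel_dzbar_def fun_eq_iff)
  ultimately show ?thesis by (intro measurable_completion) simp
qed

lemma refl_kernel_derivative_bounds:
  "norm (refl_kernel_dz p z) \<le> 1 / (1 - p)\<^sup>2" "norm (refl_kernel_dzbar p z) \<le> 1 / (1 - p)\<^sup>2"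
proof -
  have "1 / (norm (z - of_real p))\<^sup>2 \<le> 1 / (1 - p)\<^sup>2" if "norm z \<ge> 1"
    using norm_minus_pole_ge[OF that] p minus_pole_nonzero[OF that] by (intro divide_left_mono power_mono mult_pos_pos) auto
  then show "norm (refl_kernel_dz p z) \<le> 1 / (1 - p)\<^sup>2"
    by (auto simp: refl_kernel_dz_def norm_divide norm_power)
  have "1 / (norm (1 - of_real p * z))\<^sup>2 \<le> 1 / (1 - p)\<^sup>2" if "norm z \<le> 1"
    using norm_one_minus_ge[OF that] p one_minus_nonzero[OF that] by (intro divide_left_mono power_mono mult_pos_pos) auto
  moreover have "norm (cnj (1 / (1 - of_real p * z)\<^sup>2)) = 1 / (norm (1 - of_real p * z))\<^sup>2"
    by (simp only: complex_mod_cnj norm_divide norm_power norm_one)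
  ultimately show "norm (refl_kernel_dzbar p z) \<le> 1 / (1 - p)\<^sup>2"
    using p unfolding refl_kernel_dzbar_def by (simp only: split: if_split) simp
qed

lemma refl_kernel_loc_L2: "loc_L2 UNIV (refl_kernel_dz p)" "loc_L2 UNIV (refl_kernel_dzbar p)"
  using refl_kernel_derivative_bounds
  by (auto intro!: loc_L2_bounded refl_kernel_dz_measurable refl_kernel_dzbar_measurable)

lemma refl_kernel_continuous: "continuous_on UNIV (refl_kernel p)"
  by (rule lipschitz_on_continuous_on[OF refl_kernel_lipschitz])

lemma refl_kernel_tendsto: "(refl_kernel p \<longlongrightarrow> 0) at_infinity"
proof -
  have "filterlim (\<lambda>z. z - complex_of_real p) at_infinity at_infinity"
    using tendsto_add_filterlim_at_infinity'[OF filterlim_ident tendsto_const[of "- complex_of_real p"]] by simp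
  then have "((\<lambda>z. 1 / (z - of_real p)) \<longlongrightarrow> (0::complex)) at_infinity"
    by (intro tendsto_divide_0[OF tendsto_const])
  moreover have "eventually (\<lambda>z. 1 / (z - of_real p) = refl_kernel p z) at_infinity"
    unfolding eventually_at_infinity by (intro exI[of _ 1]) (auto simp: refl_kernel_def)
  ultimately show ?thesis by (rule Lim_transform_eventually)
qed

text \<open>The conjugate kernel is needed as well, because the energy inequality is used in both directions.\<close>

lemma refl_kernel_weak:
  "weak_wirt (- \<i>) UNIV (refl_kernel p) (refl_kernel_dz p)"
  "weak_wirt \<i> UNIV (refl_kernel p) (refl_kernel_dzbar p)"
  "weak_wirt (- \<i>) UNIV (\<lambda>z. cnj (refl_kernel p z)) (\<lambda>z. cnj (refl_kernel_dzbar p z))"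
  "weak_wirt \<i> UNIV (\<lambda>z. cnj (refl_kernel p z)) (\<lambda>z. cnj (refl_kernel_dz p z))"
proof -
  have N: "sphere (0::complex) 1 \<in> null_sets lebesgue"
    using negligible_sphere negligible_iff_null_sets by blast
  have lip: "loc_lip UNIV (refl_kernel p)"
    unfolding loc_lip_def using lipschitz_on_subset[OF refl_kernel_lipschitz subset_UNIV] zero_less_one by blast
  have "C-lipschitz_on A (\<lambda>z. cnj (refl_kernel p z))" if "C-lipschitz_on A (refl_kernel p)" for C A
    using that by (simp add: lipschitz_on_def dist_norm flip: complex_cnj_diff)
  then have lipc: "loc_lip UNIV (\<lambda>z. cnj (refl_kernel p z))"
    using lip unfolding loc_lip_def by meson
  have der: "(refl_kernel p has_derivative (\<lambda>v. refl_kernel_dz p z * v + refl_kernel_dzbar p z * cnj v)) (at z)"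
    if "z \<in> UNIV - sphere 0 1" for z
    using that by (intro refl_kernel_has_derivative) auto
  have derc: "((\<lambda>z. cnj (refl_kernel p z)) has_derivative (\<lambda>v. cnj (refl_kernel_dzbar p z) * v + cnj (refl_kernel_dz p z) * cnj v)) (at z)"
    if "z \<in> UNIV - sphere 0 1" for z
    using has_derivative_cnj[OF der[OF that]] by (simp add: add.commute)
  show "weak_wirt (- \<i>) UNIV (refl_kernel p) (refl_kernel_dz p)"
    by (rule weak_wirt_piecewise[OF open_UNIV lip N der]) (simp_all only: wirt_linear_form)
  show "weak_wirt \<i> UNIV (refl_kernel p) (refl_kernel_dzbar p)"
    by (rule weak_wirt_piecewise[OF open_UNIV lip N der]) (simp_all only: wirt_linear_form)
  show "weak_wirt (- \<i>) UNIV (\<lambda>z. cnj (refl_kernel p z)) (\<lambda>z. cnj (refl_kernel_dzbar p z))"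
    by (rule weak_wirt_piecewise[OF open_UNIV lipc N derc]) (simp_all only: wirt_linear_form)
  show "weak_wirt \<i> UNIV (\<lambda>z. cnj (refl_kernel p z)) (\<lambda>z. cnj (refl_kernel_dz p z))"
    by (rule weak_wirt_piecewise[OF open_UNIV lipc N derc]) (simp_all only: wirt_linear_form)
qed

text \<open>Inside, the conjugate of the derivative is \<open>1 / (1 - p z)\<^sup>2 = \<Sum> (n + 1) p\<^sup>n z\<^sup>n\<close>, whose energy over the disc is a power
series in \<open>p\<^sup>2\<close>. The energy outside is the same: the energy inequality applies to the kernel and to its
conjugate, which exchanges the roles of the two derivatives.\<close>

lemma refl_kernel_energy:
  "integrable lebesgue (\<lambda>z. (norm (refl_kernel_dz p z))\<^sup>2)"
  "integrable lebesgue (\<lambda>z. (norm (refl_kernel_dzbar p z))\<^sup>2)"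
  "(LINT z|lebesgue. (norm (refl_kernel_dz p z))\<^sup>2) = pi / (1 - p\<^sup>2)\<^sup>2"
  "(LINT z|lebesgue. (norm (refl_kernel_dzbar p z))\<^sup>2) = pi / (1 - p\<^sup>2)\<^sup>2"
proof -
  define b where "b n = of_nat (Suc n) * complex_of_real p ^ n" for n
  have nb: "norm (b n) = real (Suc n) * p ^ n" for n
    using p unfolding b_def norm_mult norm_of_nat norm_power by simp
  have sb: "summable (\<lambda>n. norm (b n) * 1 ^ n)"
    unfolding nb using geometric_deriv_sums[of p] p by (simp add: sums_iff)
  have val: "(\<Sum>n. b n * z ^ n) = 1 / (1 - of_real p * z)\<^sup>2" if "z \<in> ball 0 1" for z
  proof -
    have "norm (of_real p * z) < 1"
    proof -
      have "norm (of_real p * z) = p * norm z" using p by (simp add: norm_mult)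
      also have "\<dots> \<le> 1 * norm z" using p by (intro mult_right_mono) auto
      finally show ?thesis using that by simp
    qed
    then have "(\<lambda>n. of_nat (Suc n) * (of_real p * z) ^ n) sums (1 / (1 - of_real p * z)\<^sup>2)"
      by (rule geometric_deriv_sums)
    then show ?thesis by (simp add: b_def power_mult_distrib sums_iff mult.assoc)
  qed
  have eq: "indicator (ball 0 1) z *\<^sub>R (norm (\<Sum>n. b n * z ^ n))\<^sup>2 = (norm (refl_kernel_dzbar p z))\<^sup>2" for z
  proof (cases "z \<in> ball 0 1")
    case True
    then have "norm z < 1" by simp
    then show ?thesis using True
      by (simp only: val[OF True] refl_kernel_dzbar_def if_True complex_mod_cnj indicator_simps scaleR_one)
  qed (simp add: refl_kernel_dzbar_def)
  note D = disc_integral_power_series[OF zero_less_one sb, unfolded set_integrable_def set_lebesgue_integral_def eq]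
  show iw: "integrable lebesgue (\<lambda>z. (norm (refl_kernel_dzbar p z))\<^sup>2)" by (rule D(2))
  have "(\<lambda>n. pi * (of_nat (Suc n) * (p\<^sup>2) ^ n)) sums (pi * (1 / (1 - p\<^sup>2)\<^sup>2))"
    using p by (intro sums_mult geometric_deriv_sums) (simp add: power_less_one_iff abs_square_less_1)
  moreover have "pi * 1 ^ (2 * n + 2) / real (n + 1) * (norm (b n))\<^sup>2 = pi * (of_nat (Suc n) * (p\<^sup>2) ^ n)" for n
    unfolding nb by (simp add: power_mult_distrib power2_eq_square power_mult[symmetric] field_simps)
  ultimately show B: "(LINT z|lebesgue. (norm (refl_kernel_dzbar p z))\<^sup>2) = pi / (1 - p\<^sup>2)\<^sup>2"
    using D(1) by (simp add: sums_iff)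
  note E = dz_energy_le_dzbar_energy[OF refl_kernel_continuous refl_kernel_tendsto
      refl_kernel_loc_L2(1) refl_kernel_weak(1) refl_kernel_loc_L2(2) refl_kernel_weak(2), of 0, OF _ _ iw]
  show iv: "integrable lebesgue (\<lambda>z. (norm (refl_kernel_dz p z))\<^sup>2)" using E(1) by simp
  have le: "(LINT z|lebesgue. (norm (refl_kernel_dz p z))\<^sup>2) \<le> (LINT z|lebesgue. (norm (refl_kernel_dzbar p z))\<^sup>2)"
    using E(3) by simp
  have cm: "cnj \<in> borel_measurable borel" by (intro borel_measurable_continuous_onI continuous_intros)
  have lc: "loc_L2 UNIV (\<lambda>z. cnj (refl_kernel_dz p z))" "loc_L2 UNIV (\<lambda>z. cnj (refl_kernel_dzbar p z))"
    using refl_kernel_loc_L2 measurable_compose[OF _ cm] by (auto simp: loc_L2_def)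
  have "((\<lambda>z. cnj (refl_kernel p z)) \<longlongrightarrow> cnj 0) at_infinity"
    by (intro tendsto_cnj refl_kernel_tendsto)
  then have "((\<lambda>z. cnj (refl_kernel p z)) \<longlongrightarrow> 0) at_infinity" by simp
  note E' = dz_energy_le_dzbar_energy[OF continuous_on_cnj[OF refl_kernel_continuous] this
      lc(2) refl_kernel_weak(3) lc(1) refl_kernel_weak(4), of 0, OF _ _ iv]
  have "(LINT z|lebesgue. (norm (refl_kernel_dzbar p z))\<^sup>2) \<le> (LINT z|lebesgue. (norm (refl_kernel_dz p z))\<^sup>2)"
    using E'(3) by simp
  then show "(LINT z|lebesgue. (norm (refl_kernel_dz p z))\<^sup>2) = pi / (1 - p\<^sup>2)\<^sup>2"
    using le B by simp
qed

end

section \<open>The area theorem for quasiconformal extensions\<close>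

lemma loc_L2_cong_AE:
  assumes g: "loc_L2 U g" and h: "h \<in> borel_measurable lebesgue"
    and ae: "AE z in lebesgue. z \<in> U \<longrightarrow> h z = g z"
  shows "loc_L2 U h"
  unfolding loc_L2_def
proof (intro conjI allI impI h)
  fix K assume K: "compact K \<and> K \<subseteq> U"
  have [measurable]: "K \<in> sets lebesgue" "g \<in> borel_measurable lebesgue" "h \<in> borel_measurable lebesgue"
    using K loc_L2_measurable[OF g] h by (auto intro: lmeasurable_compact fmeasurableD)
  have ae': "AE z in lebesgue. indicator K z * (norm (g z))\<^sup>2 = indicator K z * (norm (h z))\<^sup>2"
    using ae by eventually_elim (use K in \<open>auto simp: indicator_def\<close>)
  have "integrable lebesgue (\<lambda>z. indicator K z * (norm (g z))\<^sup>2)" using g K by (simp add: loc_L2_def)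
  moreover have "integrable lebesgue (\<lambda>z. indicator K z * (norm (g z))\<^sup>2) \<longleftrightarrow> integrable lebesgue (\<lambda>z. indicator K z * (norm (h z))\<^sup>2)"
    by (rule integrable_cong_AE[OF _ _ ae']) measurable
  ultimately show "integrable lebesgue (\<lambda>z. indicator K z * (norm (h z))\<^sup>2)" by simp
qed

lemma loc_L2_glue_point:
  assumes g: "loc_L2 (- {a}) g" "loc_L2 A g" and a: "a \<in> A" "open A"
  shows "loc_L2 UNIV g"
  unfolding loc_L2_def
proof (intro conjI allI impI)
  show [measurable]: "g \<in> borel_measurable lebesgue" using loc_L2_measurable[OF g(1)] .
  fix K :: "complex set" assume K: "compact K \<and> K \<subseteq> UNIV"
  obtain r where r: "r > 0" "cball a r \<subseteq> A" using a open_contains_cball by blast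
  have c: "compact (K \<inter> cball a r)" "compact (K - ball a r)" using K by (auto intro: compact_Int compact_diff)
  have [measurable]: "K \<in> sets lebesgue" using K by (auto intro: lmeasurable_compact fmeasurableD)
  have "integrable lebesgue (\<lambda>z. indicator (K \<inter> cball a r) z * (norm (g z))\<^sup>2 + indicator (K - ball a r) z * (norm (g z))\<^sup>2)"
    using g c r by (intro Bochner_Integration.integrable_add) (auto simp: loc_L2_def)
  then show "integrable lebesgue (\<lambda>z. indicator K z * (norm (g z))\<^sup>2)"
  proof (rule Bochner_Integration.integrable_bound)
    have "norm (indicator K z * (norm (g z))\<^sup>2) \<le>
        norm (indicator (K \<inter> cball a r) z * (norm (g z))\<^sup>2 + indicator (K - ball a r) z * (norm (g z))\<^sup>2)" for z
      by (auto simp: indicator_def)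
    then show "AE z in lebesgue. norm (indicator K z * (norm (g z))\<^sup>2) \<le>
        norm (indicator (K \<inter> cball a r) z * (norm (g z))\<^sup>2 + indicator (K - ball a r) z * (norm (g z))\<^sup>2)" by simp
  qed measurable
qed

text \<open>Needed because a quasiconformal map comes with some choice of weak derivatives, whereas in the disc the
classical derivative is wanted.\<close>

lemma weak_wirt_unique_AE:
  assumes U: "open U" and g: "loc_L2 U g" "weak_wirt s U u g" and h: "loc_L2 U h" "weak_wirt s U u h"
  shows "AE z in lebesgue. z \<in> U \<longrightarrow> g z = h z"
proof -
  have L: "loc_L2 U (\<lambda>z. g z + (-1) * h z)" by (rule loc_L2_linear[OF g(1) h(1)])
  have "AE z in lebesgue. z \<in> U \<longrightarrow> g z + (-1) * h z = 0"
  proof (rule AE_eq_0_of_orthogonal_to_smooth[OF U L])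
    fix \<phi> K assume \<phi>: "\<phi> \<in> smooth_expr" "compact K" "K \<subseteq> U" "\<And>z. z \<notin> K \<Longrightarrow> \<phi> z = 0"
    have K: "compact K \<and> K \<subseteq> U \<and> (\<forall>z. z \<notin> K \<longrightarrow> \<phi> z = 0)" using \<phi> by simp
    have "(LINT z|lebesgue. u z * wirt s (frechet_derivative \<phi> (at z))) = - (LINT z|lebesgue. g z * \<phi> z)"
      "(LINT z|lebesgue. u z * wirt s (frechet_derivative \<phi> (at z))) = - (LINT z|lebesgue. h z * \<phi> z)"
      using g(2) h(2) \<phi>(1) K unfolding weak_wirt_def by blast+
    then have "(LINT z|lebesgue. g z * \<phi> z) = (LINT z|lebesgue. h z * \<phi> z)" by simp
    moreover have "integrable lebesgue (\<lambda>z. g z * \<phi> z)" "integrable lebesgue (\<lambda>z. h z * \<phi> z)"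
      using integrable_loc_L2_test[OF g(1) \<phi>] integrable_loc_L2_test[OF h(1) \<phi>] by auto
    moreover have "(g z + (-1) * h z) * \<phi> z = g z * \<phi> z - h z * \<phi> z" for z by (simp add: algebra_simps)
    ultimately show "(LINT z|lebesgue. (g z + (-1) * h z) * \<phi> z) = 0" by simp
  qed
  then show ?thesis by eventually_elim auto
qed

lemma borel_measurable_on_disc:
  fixes f :: "complex \<Rightarrow> complex"
  assumes "continuous_on (ball 0 1) f" "g \<in> borel_measurable lebesgue"
  shows "(\<lambda>z. if z \<in> ball 0 1 then f z else g z) \<in> borel_measurable lebesgue"
proof -
  have "(\<lambda>z. if z \<in> ball 0 1 then f z else 0) \<in> borel_measurable borel"
    by (intro borel_measurable_continuous_on_if assms continuous_intros) auto
  then have [measurable]: "(\<lambda>z. if z \<in> ball 0 1 then f z else 0) \<in> borel_measurable lebesgue"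
    by (intro measurable_completion) simp
  have [measurable]: "g \<in> borel_measurable lebesgue" "ball (0::complex) 1 \<in> sets lebesgue" using assms by auto
  have "(\<lambda>z. if z \<in> ball 0 1 then (if z \<in> ball 0 1 then f z else 0) else g z) \<in> borel_measurable lebesgue"
    by measurable
  then show ?thesis by (simp cong: if_cong)
qed

text \<open>Let \<open>F\<close> be the extension, \<open>H\<close> its difference with \<open>1 / (z - p) + F(\<infinity>)\<close>, and let \<open>X\<close>, \<open>Y\<close> be the energies of the
derivatives \<open>v = \<partial>H\<close> and \<open>w\<close> (the conjugate one), \<open>A\<close> the part of \<open>X\<close> from the disc, \<open>B\<close> the energy of the kernel
\<open>G\<close>, and \<open>x\<close> the real part of the scalar product of \<open>\<partial>H\<close> and \<open>\<partial>G\<close>. In the disc \<open>H\<close> is holomorphic, so \<open>w = 0\<close>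
there; outside, \<open>\<partial>F = v + \<partial>G\<close>. Hence the Beltrami inequality reads \<open>Y \<le> k\<^sup>2 (X - A + 2 x + B)\<close>.

The energy inequality for \<open>H + t G\<close> says \<open>X + 2 t x + t\<^sup>2 B \<le> Y + t\<^sup>2 B\<close>, since the conjugate derivatives of
\<open>H\<close> and \<open>G\<close> have disjoint supports. With \<open>t = 0\<close> this is \<open>X \<le> Y\<close>, and large \<open>t\<close> force \<open>x \<le> 0\<close>. Together
\<open>(1 - k\<^sup>2) X \<le> k\<^sup>2 (B - A)\<close>, and \<open>A \<le> X\<close> gives \<open>A \<le> k\<^sup>2 B\<close>.\<close>

lemma qc_disc_energy_le:
  assumes p: "p \<in> {0..<1}" and k: "k \<in> {0..<1}" and f: "f \<in> Sigma_qc_class k p"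
    and \<omega>: "\<omega> holomorphic_on ball 0 1" "\<And>z. z \<in> ball 0 1 - {of_real p} \<Longrightarrow> f z = Some (1 / (z - of_real p) + \<omega> z)"
  shows "integrable lebesgue (\<lambda>z. indicator (ball 0 1) z * (norm (deriv \<omega> z))\<^sup>2)"
    and "(LINT z|lebesgue. indicator (ball 0 1) z * (norm (deriv \<omega> z))\<^sup>2) \<le> k\<^sup>2 * (pi / (1 - p\<^sup>2)\<^sup>2)"
proof -
  let ?p = "complex_of_real p"
  let ?D = "ball (0::complex) 1"
  have p': "0 \<le> p" "p < 1" using p by auto
  have pD: "?p \<in> ?D" using p by simp
  define U where "U = - {?p}"
  have U: "open U" unfolding U_def by (intro open_Compl closed_singleton)
  obtain F where F: "quasiconformal k F" and Ff: "\<And>z. z \<in> ?D \<Longrightarrow> F (Some z) = f z" 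
    and fS: "f \<in> Sigma_class p"
    using f by (auto simp: Sigma_qc_class_def)
  have hom: "homeomorphic_map riemann_sphere riemann_sphere F" using F by (simp add: quasiconformal_def)
  have Fcont: "continuous_map riemann_sphere riemann_sphere F" by (rule homeomorphic_imp_continuous_map[OF hom])
  have top: "topspace riemann_sphere = UNIV" by (auto simp: UNIV_option_conv)
  have Finj: "inj F" using homeomorphic_imp_injective_map[OF hom] by (simp only: top)
  have Fp: "F (Some ?p) = None" using Ff[OF pD] fS by (simp add: Sigma_class_def)
  have FU: "{z. F (Some z) \<noteq> None} = U"
  proof -
    have "F (Some z) \<noteq> None" if "z \<noteq> ?p" for z
      using Fp injD[OF Finj, of "Some z" "Some ?p"] that by auto
    then show ?thesis using Fp by (auto simp: U_def)
  qed
  have "F None \<noteq> None" using Fp injD[OF Finj, of None "Some ?p"] by auto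
  then obtain c where c: "F None = Some c" by auto
  define F0 where "F0 z = the (F (Some z))" for z
  have F0_cont: "continuous_on U F0" 
    using sphere_map_finite_part(2)[OF Fcont] unfolding FU F0_def[abs_def] .
  have F0_lim: "(F0 \<longlongrightarrow> c) at_infinity"
    using sphere_map_finite_part(3)[OF Fcont c] unfolding F0_def[abs_def] .
  have F0_D: "F0 z = 1 / (z - ?p) + \<omega> z" if "z \<in> ?D - {?p}" for z
    using \<omega>(2)[OF that] Ff[of z] that by (simp add: F0_def)
  obtain Fz0 Fzb0 where Fz0: "locally_L2 U Fz0" "distributional_dz U F0 Fz0"
    and Fzb0: "locally_L2 U Fzb0" "distributional_dzbar U F0 Fzb0"
    and belt0: "AE z in lebesgue_on U. norm (Fzb0 z) \<le> k * norm (Fz0 z)"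
    using F unfolding quasiconformal_def Let_def FU F0_def[abs_def] by blast
  define Fz where "Fz z = (if z \<in> U then Fz0 z else 0)" for z
  define Fzb where "Fzb z = (if z \<in> U then Fzb0 z else 0)" for z
  have Fz: "loc_L2 U Fz" "weak_wirt (- \<i>) U F0 Fz"
    unfolding Fz_def[abs_def] using loc_L2_of_locally_L2[OF Fz0(1) U] weak_wirt_of_distributional(1)[OF Fz0(2)] by auto
  have Fzb: "loc_L2 U Fzb" "weak_wirt \<i> U F0 Fzb"
    unfolding Fzb_def[abs_def] using loc_L2_of_locally_L2[OF Fzb0(1) U] weak_wirt_of_distributional(2)[OF Fzb0(2)] by auto
  have belt: "AE z in lebesgue. z \<in> U \<longrightarrow> norm (Fzb z) \<le> k * norm (Fz z)"
  proof -
    have "U \<in> sets lebesgue" using U by auto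
    then have "AE z in lebesgue. z \<in> U \<longrightarrow> norm (Fzb0 z) \<le> k * norm (Fz0 z)"
      using belt0 by (simp add: AE_restrict_space_iff)
    then show ?thesis by eventually_elim (simp add: Fz_def Fzb_def)
  qed
  \<comment> \<open>The polar part and the value at infinity, to be subtracted from the extension.\<close>
  define R where "R z = 1 / (z - ?p) + c" for z
  define R' where "R' z = - (1 / (z - ?p)\<^sup>2)" for z
  have R_der: "(R has_field_derivative R' z) (at z)" if "z \<in> U" for z
    unfolding R_def R'_def using that by (auto intro!: derivative_eq_intros simp: U_def power2_eq_square)
  have R_hol: "R holomorphic_on U" 
    unfolding R_def by (intro holomorphic_intros) (auto simp: U_def)
  have R'_meas: "R' \<in> borel_measurable lebesgue"
  proof -
    have "R' \<in> borel_measurable borel" unfolding R'_def by measurable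
    then show ?thesis by (intro measurable_completion) simp
  qed
  have R'_cont: "continuous_on U R'"
    unfolding R'_def by (intro continuous_intros) (auto simp: U_def)
  have R'_L2: "loc_L2 U R'"
  proof (rule loc_L2_bounded[OF R'_meas])
    fix K assume "compact K" "K \<subseteq> U"
    then have "bounded (R' ` K)" by (intro compact_imp_bounded compact_continuous_image continuous_on_subset[OF R'_cont])
    then show "\<exists>B. \<forall>z\<in>K. norm (R' z) \<le> B" by (auto simp: bounded_iff)
  qed
  have R_weak: "weak_wirt (- \<i>) U R R'" "weak_wirt \<i> U R (\<lambda>_. 0)"
  proof -
    have d: "(R has_derivative (\<lambda>v. R' z * v)) (at z)" if "z \<in> U - {}" for z
      using R_der[of z] that by (simp add: has_field_derivative_def)
    show "weak_wirt (- \<i>) U R R'"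
      by (rule weak_wirt_piecewise[OF U loc_lip_holomorphic[OF R_hol U] null_sets.empty_sets d]) (simp_all only: wirt_mult)
    show "weak_wirt \<i> U R (\<lambda>_. 0)"
      by (rule weak_wirt_piecewise[OF U loc_lip_holomorphic[OF R_hol U] null_sets.empty_sets d]) (simp_all only: wirt_mult)
  qed
  have zero_L2: "loc_L2 V (\<lambda>_. 0)" for V by (rule loc_L2_bounded) auto
  define H0 where "H0 z = F0 z + (-1) * R z" for z
  have H0_weak: "weak_wirt (- \<i>) U H0 (\<lambda>z. Fz z + (-1) * R' z)" "weak_wirt \<i> U H0 (\<lambda>z. Fzb z + (-1) * 0)"
    unfolding H0_def
    by (rule weak_wirt_linear[OF F0_cont Fz holomorphic_on_imp_continuous_on[OF R_hol] R'_L2 R_weak(1)])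
       (rule weak_wirt_linear[OF F0_cont Fzb holomorphic_on_imp_continuous_on[OF R_hol] zero_L2 R_weak(2)])
  have H0_L2: "loc_L2 U (\<lambda>z. Fz z + (-1) * R' z)" "loc_L2 U (\<lambda>z. Fzb z + (-1) * 0)"
    by (rule loc_L2_linear[OF Fz(1) R'_L2]) (rule loc_L2_linear[OF Fzb(1) zero_L2])
  have \<omega>c_hol: "(\<lambda>z. \<omega> z - c) holomorphic_on ?D" by (intro holomorphic_intros \<omega>)
  have H0_D: "H0 z = \<omega> z - c" if "z \<in> ?D - {?p}" for z using F0_D[OF that] by (simp add: H0_def R_def)
  \<comment> \<open>The difference is known off p only; in the disc the regular part fills the gap, and there the
      chosen weak derivatives are replaced by the classical ones.\<close>
  define H where "H z = (if z \<in> ?D then \<omega> z - c else H0 z)" for z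
  define v where "v z = (if z \<in> ?D then deriv \<omega> z else Fz z + (-1) * R' z)" for z
  define w where "w z = (if z \<in> ?D then 0 else Fzb z)" for z
  have HU: "H z = H0 z" if "z \<in> U" for z using H0_D that by (auto simp: H_def U_def)
  have d\<omega>_cont: "continuous_on ?D (deriv \<omega>)"
    by (intro holomorphic_on_imp_continuous_on holomorphic_deriv \<omega> open_ball)
  have d\<omega>c: "deriv (\<lambda>z. \<omega> z - c) z = deriv \<omega> z" if "z \<in> ?D" for z
    using holomorphic_on_imp_differentiable_at[OF \<omega>(1) open_ball that] by simp
  have v_meas: "v \<in> borel_measurable lebesgue"
    unfolding v_def by (intro borel_measurable_on_disc d\<omega>_cont loc_L2_measurable[OF H0_L2(1)])
  have w_meas: "w \<in> borel_measurable lebesgue"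
    unfolding w_def by (intro borel_measurable_on_disc continuous_intros loc_L2_measurable[OF Fzb(1)])
  have v_D: "loc_L2 ?D v"
  proof (rule loc_L2_bounded[OF v_meas])
    fix K assume K: "compact K" "K \<subseteq> ?D"
    then have "bounded (deriv \<omega> ` K)" by (intro compact_imp_bounded compact_continuous_image continuous_on_subset[OF d\<omega>_cont])
    then obtain B where "\<forall>x\<in>deriv \<omega> ` K. norm x \<le> B" by (auto simp: bounded_iff)
    then have "norm (v z) \<le> B" if "z \<in> K" for z using that K(2) by (auto simp: v_def)
    then show "\<exists>B. \<forall>z\<in>K. norm (v z) \<le> B" by blast
  qed
  have w_D: "loc_L2 ?D w"
    by (rule loc_L2_bounded[OF w_meas]) (auto simp: w_def subset_iff intro!: exI[of _ 0])
  have weak_D: "weak_wirt (- \<i>) ?D H v" "weak_wirt \<i> ?D H w"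
  proof -
    have m: "(\<lambda>z. if z \<in> ?D then deriv \<omega> z else 0) \<in> borel_measurable lebesgue"
      by (intro borel_measurable_on_disc d\<omega>_cont) auto
    have "((\<lambda>z. \<omega> z - c) has_derivative (\<lambda>x. deriv \<omega> z * x)) (at z)" if "z \<in> ?D - {}" for z
      using holomorphic_derivI[OF \<omega>c_hol open_ball, of z] d\<omega>c[of z] that by (simp add: has_field_derivative_def)
    note pw = weak_wirt_piecewise[OF open_ball loc_lip_holomorphic[OF \<omega>c_hol open_ball] null_sets.empty_sets this]
    have 1: "weak_wirt (- \<i>) ?D (\<lambda>z. \<omega> z - c) v"
      by (rule pw) (auto simp only: wirt_mult v_def if_True Diff_empty)
    have 2: "weak_wirt \<i> ?D (\<lambda>z. \<omega> z - c) w"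
      by (rule pw) (auto simp only: wirt_mult w_def if_True Diff_empty)
    show "weak_wirt (- \<i>) ?D H v" by (rule weak_wirt_cong[OF 1 _ v_meas v_meas]) (auto simp: H_def)
    show "weak_wirt \<i> ?D H w" by (rule weak_wirt_cong[OF 2 _ w_meas w_meas]) (auto simp: H_def)
  qed
  \<comment> \<open>In the punctured disc both descriptions of the derivatives apply, hence they agree almost everywhere.\<close>
  have A: "open (?D - {?p})" "?D - {?p} \<subseteq> U" "?D - {?p} \<subseteq> ?D" by (auto simp: U_def)
  have H0H: "H0 z = H z" if "z \<in> ?D - {?p}" for z using HU[of z] subsetD[OF A(2) that] by simp
  have HA: "weak_wirt (- \<i>) (?D - {?p}) H0 v" "weak_wirt \<i> (?D - {?p}) H0 w"
    by (rule weak_wirt_cong[OF weak_wirt_mono[OF weak_D(1) A(3)] H0H v_meas v_meas], assumption, simp)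
       (rule weak_wirt_cong[OF weak_wirt_mono[OF weak_D(2) A(3)] H0H w_meas w_meas], assumption, simp)
  have ae_v: "AE z in lebesgue. z \<in> U \<longrightarrow> v z = Fz z + (-1) * R' z"
    using weak_wirt_unique_AE[OF A(1) loc_L2_mono[OF v_D A(3)] HA(1) loc_L2_mono[OF H0_L2(1) A(2)] weak_wirt_mono[OF H0_weak(1) A(2)]]
    by eventually_elim (auto simp: v_def U_def)
  have ae_w: "AE z in lebesgue. z \<in> U \<longrightarrow> w z = Fzb z + (-1) * 0"
    using weak_wirt_unique_AE[OF A(1) loc_L2_mono[OF w_D A(3)] HA(2) loc_L2_mono[OF H0_L2(2) A(2)] weak_wirt_mono[OF H0_weak(2) A(2)]]
    by eventually_elim (auto simp: w_def U_def)
  have U_weak: "weak_wirt (- \<i>) U H v" "weak_wirt \<i> U H w"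
    using weak_wirt_cong[OF H0_weak(1) HU loc_L2_measurable[OF H0_L2(1)] v_meas ae_v]
      weak_wirt_cong[OF H0_weak(2) HU loc_L2_measurable[OF H0_L2(2)] w_meas ae_w] by auto
  have L2: "loc_L2 UNIV v" "loc_L2 UNIV w"
    using loc_L2_glue_point[OF _ v_D pD open_ball] loc_L2_glue_point[OF _ w_D pD open_ball]
      loc_L2_cong_AE[OF H0_L2(1) v_meas ae_v] loc_L2_cong_AE[OF H0_L2(2) w_meas ae_w] by (auto simp: U_def)
  have H_cont: "continuous_on UNIV H"
  proof -
    have "continuous_on U H0" unfolding H0_def
      by (intro continuous_intros F0_cont holomorphic_on_imp_continuous_on[OF R_hol])
    then have "continuous_on U H" by (rule continuous_on_eq) (simp add: HU)
    moreover have "continuous_on ?D H"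
      by (rule continuous_on_eq[OF holomorphic_on_imp_continuous_on[OF \<omega>c_hol]]) (simp add: H_def)
    moreover have "U \<union> ?D = UNIV" using pD by (auto simp: U_def)
    ultimately show ?thesis using continuous_on_open_Un[OF U open_ball] by metis
  qed
  have weak: "weak_wirt (- \<i>) UNIV H v" "weak_wirt \<i> UNIV H w"
    using weak_wirt_glue_point[OF H_cont L2(1) pD open_ball _ weak_D(1)] 
      weak_wirt_glue_point[OF H_cont L2(2) pD open_ball _ weak_D(2)] U_weak by (auto simp: U_def)
  have H_lim: "(H \<longlongrightarrow> 0) at_infinity"
  proof -
    have "filterlim (\<lambda>z. z - ?p) at_infinity at_infinity"
      using tendsto_add_filterlim_at_infinity'[OF filterlim_ident tendsto_const[of "- ?p"]] by simp
    then have "((\<lambda>z. 1 / (z - ?p)) \<longlongrightarrow> 0) at_infinity" by (intro tendsto_divide_0[OF tendsto_const])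
    then have "((\<lambda>z. F0 z + (-1) * R z) \<longlongrightarrow> c + (-1) * (0 + c)) at_infinity"
      unfolding R_def by (intro tendsto_intros F0_lim)
    then have l: "(H0 \<longlongrightarrow> 0) at_infinity" by (simp add: H0_def[abs_def])
    have "eventually (\<lambda>z. H0 z = H z) at_infinity"
      unfolding eventually_at_infinity by (intro exI[of _ 1]) (auto simp: H_def)
    then show ?thesis by (rule Lim_transform_eventually[OF l])
  qed
  define kz where "kz = refl_kernel_dz p"
  define kzb where "kzb = refl_kernel_dzbar p"
  have kz_eq: "kz z = (if z \<in> ?D then 0 else R' z)" for z by (simp add: kz_def refl_kernel_dz_def R'_def)
  have kzb_eq: "kzb z = 0" if "z \<notin> ?D" for z using that by (simp add: kzb_def refl_kernel_dzbar_def)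
  have kz_meas: "kz \<in> borel_measurable lebesgue" and kzb_meas: "kzb \<in> borel_measurable lebesgue"
    unfolding kz_def kzb_def by (intro refl_kernel_dz_measurable[OF p'] refl_kernel_dzbar_measurable[OF p'])+
  note [measurable] = v_meas w_meas kz_meas kzb_meas
  define B where "B = pi / (1 - p\<^sup>2)\<^sup>2"
  have ik: "integrable lebesgue (\<lambda>z. (norm (kz z))\<^sup>2)" "integrable lebesgue (\<lambda>z. (norm (kzb z))\<^sup>2)"
    and Bk: "(LINT z|lebesgue. (norm (kz z))\<^sup>2) = B" "(LINT z|lebesgue. (norm (kzb z))\<^sup>2) = B"
    using refl_kernel_energy[OF p'] unfolding kz_def kzb_def B_def by auto
  have beltrami: "AE z in lebesgue. norm (w z) \<le> k * norm (v z + kz z) \<and> (z \<in> ?D \<longrightarrow> w z = 0)"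
    using belt
  proof eventually_elim
    case (elim z)
    show ?case
    proof (cases "z \<in> ?D")
      case True
      then show ?thesis using k by (simp add: w_def)
    next
      case False
      then have "z \<in> U" using pD by (auto simp: U_def)
      then show ?thesis using elim False by (simp add: w_def v_def kz_eq)
    qed
  qed
  \<comment> \<open>A preliminary estimate, with s so small that k^2 (1 + s) < 1: it supplies the hypothesis
      of the energy inequality and thereby finite energies.\<close>
  define s where "s = (1 - k\<^sup>2) / 2"
  have k2: "0 \<le> k\<^sup>2" "k\<^sup>2 < 1" using k by (auto simp: abs_square_less_1)
  have s: "s > 0" using k2 by (simp add: s_def)
  have ks: "k\<^sup>2 * (1 + s) < 1"
  proof -
    have "k\<^sup>2 * (1 + s) = 1 - (1 - k\<^sup>2) * (1 - k\<^sup>2 / 2)" by (simp add: s_def field_simps)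
    moreover have "(1 - k\<^sup>2) * (1 - k\<^sup>2 / 2) > 0" using k2 by (intro mult_pos_pos) auto
    ultimately show ?thesis by linarith
  qed
  have le_H: "AE z in lebesgue. (norm (w z))\<^sup>2 \<le> (k\<^sup>2 * (1 + s)) * (norm (v z))\<^sup>2 + k\<^sup>2 * (1 + 1 / s) * (norm (kz z))\<^sup>2"
    using beltrami
  proof eventually_elim
    case (elim z)
    have "(norm (w z))\<^sup>2 \<le> (k * norm (v z + kz z))\<^sup>2" using elim by (intro power_mono) auto
    also have "\<dots> = k\<^sup>2 * (norm (v z + kz z))\<^sup>2" by (simp add: power_mult_distrib)
    also have "\<dots> \<le> k\<^sup>2 * ((1 + s) * (norm (v z))\<^sup>2 + (1 + 1 / s) * (norm (kz z))\<^sup>2)"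
      by (intro mult_left_mono young_sq[OF s]) auto
    finally show ?case by (simp add: algebra_simps)
  qed
  have ih: "integrable lebesgue (\<lambda>z. k\<^sup>2 * (1 + 1 / s) * (norm (kz z))\<^sup>2)" by (intro integrable_mult_right ik)
  have th0: "0 \<le> k\<^sup>2 * (1 + s)" using s by simp
  note EH = dz_energy_le_dzbar_energy[OF H_cont H_lim L2(1) weak(1) L2(2) weak(2) th0 ks ih le_H]
  define X where "X = (LINT z|lebesgue. (norm (v z))\<^sup>2)"
  define Y where "Y = (LINT z|lebesgue. (norm (w z))\<^sup>2)"
  have XY: "X \<le> Y" using EH(3) by (simp add: X_def Y_def)
  define q where "q z = Re (v z * cnj (kz z))" for z
  define x where "x = (LINT z|lebesgue. q z)"
  have ix: "integrable lebesgue q"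
    unfolding q_def[abs_def]
  proof (rule Bochner_Integration.integrable_bound)
    show "integrable lebesgue (\<lambda>z. (norm (v z))\<^sup>2 + (norm (kz z))\<^sup>2)" using EH(1) ik by auto
    have "norm (Re (v z * cnj (kz z))) \<le> norm ((norm (v z))\<^sup>2 + (norm (kz z))\<^sup>2)" for z
    proof -
      have "norm (Re (v z * cnj (kz z))) \<le> norm (v z) * norm (kz z)"
        using abs_Re_le_cmod[of "v z * cnj (kz z)"] by (simp add: norm_mult)
      also have "\<dots> \<le> (norm (v z))\<^sup>2 + (norm (kz z))\<^sup>2"
      proof -
        have "2 * (norm (v z) * norm (kz z)) \<le> (norm (v z))\<^sup>2 + (norm (kz z))\<^sup>2"
          using zero_le_power2[of "norm (v z) - norm (kz z)"] by (simp add: power2_diff)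
        moreover have "0 \<le> norm (v z) * norm (kz z)" by simp
        ultimately show ?thesis by linarith
      qed
      finally show ?thesis by simp
    qed
    then show "AE z in lebesgue. norm (Re (v z * cnj (kz z))) \<le> norm ((norm (v z))\<^sup>2 + (norm (kz z))\<^sup>2)" by simp
  next
    have "cnj \<in> borel_measurable borel" by (intro borel_measurable_continuous_onI continuous_intros)
    from measurable_compose[OF kz_meas this] have [measurable]: "(\<lambda>z. cnj (kz z)) \<in> borel_measurable lebesgue" .
    show "(\<lambda>z. Re (v z * cnj (kz z))) \<in> borel_measurable lebesgue" by measurable
  qed
  have norm_add_sq: "(norm (a + of_real t * b))\<^sup>2 = (norm a)\<^sup>2 + 2 * t * Re (a * cnj b) + t\<^sup>2 * (norm b)\<^sup>2" for a b t
    unfolding cmod_power2 by (simp add: power2_eq_square algebra_simps)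
  have x_le: "x \<le> 0"
  proof (rule ccontr)
    assume "\<not> x \<le> 0"
    then have x: "x > 0" by simp
    \<comment> \<open>For this t the inequality X + 2 t x \<le> Y fails by 1.\<close>
    define t where "t = (Y - X + 1) / (2 * x)"
    define T where "T = complex_of_real t"
    have cont: "continuous_on UNIV (\<lambda>z. H z + T * refl_kernel p z)"
      by (intro continuous_intros H_cont refl_kernel_continuous[OF p'])
    have "((\<lambda>z. H z + T * refl_kernel p z) \<longlongrightarrow> 0 + T * 0) at_infinity"
      by (intro tendsto_intros H_lim refl_kernel_tendsto[OF p'])
    then have lim: "((\<lambda>z. H z + T * refl_kernel p z) \<longlongrightarrow> 0) at_infinity" by simp
    have L: "loc_L2 UNIV (\<lambda>z. v z + T * kz z)" "loc_L2 UNIV (\<lambda>z. w z + T * kzb z)"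
      unfolding kz_def kzb_def by (rule loc_L2_linear[OF L2(1) refl_kernel_loc_L2(1)[OF p']])
        (rule loc_L2_linear[OF L2(2) refl_kernel_loc_L2(2)[OF p']])
    have W: "weak_wirt (- \<i>) UNIV (\<lambda>z. H z + T * refl_kernel p z) (\<lambda>z. v z + T * kz z)"
      "weak_wirt \<i> UNIV (\<lambda>z. H z + T * refl_kernel p z) (\<lambda>z. w z + T * kzb z)"
      unfolding kz_def kzb_def
      by (rule weak_wirt_linear[OF H_cont L2(1) weak(1) refl_kernel_continuous[OF p'] refl_kernel_loc_L2(1)[OF p'] refl_kernel_weak(1)[OF p']])
         (rule weak_wirt_linear[OF H_cont L2(2) weak(2) refl_kernel_continuous[OF p'] refl_kernel_loc_L2(2)[OF p'] refl_kernel_weak(2)[OF p']])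
    have wk: "(norm (w z + T * kzb z))\<^sup>2 = (norm (w z))\<^sup>2 + t\<^sup>2 * (norm (kzb z))\<^sup>2" for z
      by (cases "z \<in> ?D") (simp_all add: w_def kzb_eq T_def norm_mult power_mult_distrib)
    have iwk: "integrable lebesgue (\<lambda>z. (norm (w z + T * kzb z))\<^sup>2)"
      unfolding wk using EH(2) ik by auto
    have "(LINT z|lebesgue. (norm (v z + T * kz z))\<^sup>2) \<le> (LINT z|lebesgue. (norm (w z + T * kzb z))\<^sup>2)"
      by (rule dz_energy_le_dzbar_energy(3)[OF cont lim L(1) W(1) L(2) W(2), of 0, OF _ _ iwk]) auto
    moreover have "(LINT z|lebesgue. (norm (w z + T * kzb z))\<^sup>2) = Y + t\<^sup>2 * B"
      unfolding wk Y_def Bk(2)[symmetric] using EH(2) ik by simp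
    moreover have "(LINT z|lebesgue. (norm (v z + T * kz z))\<^sup>2) = X + 2 * t * x + t\<^sup>2 * B"
      unfolding T_def norm_add_sq q_def[symmetric] X_def x_def Bk(1)[symmetric] using EH(1) ik ix by simp
    ultimately have "X + 2 * t * x \<le> Y" by simp
    moreover have "2 * t * x = Y - X + 1" using x by (simp add: t_def)
    ultimately show False by simp
  qed
  define A where "A = (LINT z|lebesgue. indicator ?D z * (norm (deriv \<omega> z))\<^sup>2)"
  have v_disc: "indicator ?D z * (norm (deriv \<omega> z))\<^sup>2 = indicator ?D z * (norm (v z))\<^sup>2" for z
    by (simp add: v_def indicator_def)
  have [measurable]: "?D \<in> sets lebesgue" by simp
  show iA: "integrable lebesgue (\<lambda>z. indicator ?D z * (norm (deriv \<omega> z))\<^sup>2)"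
    unfolding v_disc
  proof (rule Bochner_Integration.integrable_bound[OF EH(1)])
    show "(\<lambda>z. indicator ?D z * (norm (v z))\<^sup>2) \<in> borel_measurable lebesgue" by measurable
  qed (auto simp: indicator_def)
  have AX: "A \<le> X"
    unfolding A_def X_def v_disc
    by (rule integral_mono[OF iA[unfolded v_disc] EH(1)]) (auto simp: indicator_def)
  have Y_le: "Y \<le> k\<^sup>2 * (X - A + 2 * x + B)"
  proof -
    let ?m = "\<lambda>z. k\<^sup>2 * ((norm (v z))\<^sup>2 - indicator ?D z * (norm (v z))\<^sup>2 + 2 * q z + (norm (kz z))\<^sup>2)"
    have "Y \<le> (LINT z|lebesgue. ?m z)"
      unfolding Y_def
    proof (rule integral_mono_AE[OF EH(2)])
      show "integrable lebesgue ?m"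
        by (intro integrable_mult_right Bochner_Integration.integrable_add Bochner_Integration.integrable_diff
            EH(1) iA[unfolded v_disc] ix ik)
      show "AE z in lebesgue. (norm (w z))\<^sup>2 \<le> ?m z"
        using beltrami
      proof eventually_elim
        case (elim z)
        show ?case
        proof (cases "z \<in> ?D")
          case True
          then show ?thesis using elim by (simp add: kz_eq q_def)
        next
          case False
          have "(norm (w z))\<^sup>2 \<le> (k * norm (v z + kz z))\<^sup>2" using elim by (intro power_mono) auto
          also have "\<dots> = k\<^sup>2 * ((norm (v z))\<^sup>2 + 2 * q z + (norm (kz z))\<^sup>2)"
            using norm_add_sq[of "v z" 1 "kz z"] by (simp add: power_mult_distrib q_def)
          finally show ?thesis using False by simp
        qed
      qed
    qed
    also have "\<dots> = k\<^sup>2 * (X - A + 2 * x + B)"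
      unfolding X_def A_def x_def Bk(1)[symmetric] v_disc using EH(1) iA[unfolded v_disc] ix ik by simp
    finally show ?thesis .
  qed
  have "X \<le> k\<^sup>2 * (X - A + B)"
  proof -
    have "k\<^sup>2 * (X - A + 2 * x + B) \<le> k\<^sup>2 * (X - A + B)" using x_le by (intro mult_left_mono) auto
    then show ?thesis using XY Y_le by linarith
  qed
  then have "(1 - k\<^sup>2) * X \<le> k\<^sup>2 * B - k\<^sup>2 * A" by (simp add: algebra_simps)
  moreover have "(1 - k\<^sup>2) * A \<le> (1 - k\<^sup>2) * X" using AX k2 by (intro mult_left_mono) auto
  ultimately have "A \<le> k\<^sup>2 * B" by (simp add: algebra_simps)
  then show "(LINT z|lebesgue. indicator ?D z * (norm (deriv \<omega> z))\<^sup>2) \<le> k\<^sup>2 * (pi / (1 - p\<^sup>2)\<^sup>2)"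
    by (simp add: A_def B_def)
qed

text \<open>The energy in the disc is the limit for \<open>r \<rightarrow> 1\<close> of the energies in discs of radius \<open>r\<close>, where the expansion of the
derivative converges absolutely and the area integral is a sum over the coefficients.\<close>

theorem Sigma_qc_area:
  assumes p: "p \<in> {0..<1}" and k: "k \<in> {0..<1}" and f: "f \<in> Sigma_qc_class k p"
  shows "(\<Sum>n<N. real (Suc n) * (norm (Sigma_coeff p f (Suc n)))\<^sup>2) \<le> k\<^sup>2 / (1 - p\<^sup>2)\<^sup>2"
proof -
  define a where "a = Sigma_coeff p f"
  obtain \<omega> where \<omega>: "\<omega> holomorphic_on ball 0 1" "\<And>z. z \<in> ball 0 1 - {of_real p} \<Longrightarrow> f z = Some (1 / (z - of_real p) + \<omega> z)"
    "\<And>z. z \<in> ball 0 1 \<Longrightarrow> (\<lambda>n. a n * z ^ n) sums \<omega> z"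
    using Sigma_class_expansion[OF p, of f] f unfolding a_def Sigma_qc_class_def by blast
  note E = qc_disc_energy_le[OF p k f \<omega>(1,2)]
  define b where "b n = of_nat (Suc n) * a (Suc n)" for n
  have summ: "summable (\<lambda>n. a n * z ^ n)" if "norm z < 1" for z using \<omega>(3)[of z] that by (simp add: sums_iff)
  have der: "deriv \<omega> z = (\<Sum>n. b n * z ^ n)" if z: "norm z < 1" for z
  proof -
    have "((\<lambda>z. \<Sum>n. a n * z ^ n) has_field_derivative (\<Sum>n. diffs a n * z ^ n)) (at z)"
      by (rule termdiffs_strong'[of 1]) (use summ z in auto)
    then have "(\<omega> has_field_derivative (\<Sum>n. diffs a n * z ^ n)) (at z)"
    proof (rule has_field_derivative_transform_within_open[where S = "ball 0 1"])
      show "(\<Sum>n. a n * x ^ n) = \<omega> x" if "x \<in> ball 0 1" for x using \<omega>(3)[OF that] by (simp add: sums_iff)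
    qed (use z in auto)
    then have "deriv \<omega> z = (\<Sum>n. diffs a n * z ^ n)" by (rule DERIV_imp_deriv)
    then show ?thesis by (simp add: diffs_def b_def)
  qed
  have main: "(\<Sum>n<N. pi * r ^ (2 * n + 2) / (n + 1) * (norm (b n))\<^sup>2) \<le> k\<^sup>2 * (pi / (1 - p\<^sup>2)\<^sup>2)" if r: "0 < r" "r < 1" for r
  proof -
    have "summable (\<lambda>n. norm (diffs a n * of_real r ^ n))"
    proof -
      define \<rho> where "\<rho> = (1 + r) / 2"
      have \<rho>: "r < \<rho>" "\<rho> < 1" using r by (auto simp: \<rho>_def)
      have "summable (\<lambda>n. diffs a n * (of_real \<rho>) ^ n)"
        by (rule termdiff_converges[of _ 1]) (use \<rho> r summ in auto)
      then show ?thesis by (rule powser_insidea) (use \<rho> r in auto)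
    qed
    then have sb: "summable (\<lambda>n. norm (b n) * r ^ n)"
      using r by (simp add: diffs_def b_def norm_mult norm_power)
    note D = disc_integral_power_series[OF r(1) sb]
    have "(\<Sum>n<N. pi * r ^ (2 * n + 2) / (n + 1) * (norm (b n))\<^sup>2) \<le> (LINT z:ball 0 r|lebesgue. (norm (\<Sum>n. b n * z ^ n))\<^sup>2)"
      unfolding sums_unique[OF D(1)]
      by (rule sum_le_suminf[OF sums_summable[OF D(1)]]) (use r in auto)
    also have "\<dots> \<le> (LINT z|lebesgue. indicator (ball 0 1) z * (norm (deriv \<omega> z))\<^sup>2)"
      unfolding set_lebesgue_integral_def
    proof (rule integral_mono[OF D(2)[unfolded set_integrable_def] E(1)])
      fix z :: complex
      show "indicator (ball 0 r) z *\<^sub>R (norm (\<Sum>n. b n * z ^ n))\<^sup>2 \<le> indicator (ball 0 1) z * (norm (deriv \<omega> z))\<^sup>2"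
        using der[of z] r by (auto simp: indicator_def)
    qed
    also note E(2)
    finally show ?thesis .
  qed
  have "((\<lambda>r. \<Sum>n<N. pi * r ^ (2 * n + 2) / (n + 1) * (norm (b n))\<^sup>2) \<longlongrightarrow> (\<Sum>n<N. pi * 1 ^ (2 * n + 2) / (n + 1) * (norm (b n))\<^sup>2)) (at_left (1::real))"
    by (intro tendsto_intros) auto
  moreover have "eventually (\<lambda>r. (\<Sum>n<N. pi * r ^ (2 * n + 2) / (n + 1) * (norm (b n))\<^sup>2) \<le> k\<^sup>2 * (pi / (1 - p\<^sup>2)\<^sup>2)) (at_left (1::real))"
    using eventually_at_left_real[OF zero_less_one] by eventually_elim (use main in auto)
  ultimately have "(\<Sum>n<N. pi * 1 ^ (2 * n + 2) / (n + 1) * (norm (b n))\<^sup>2) \<le> k\<^sup>2 * (pi / (1 - p\<^sup>2)\<^sup>2)"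
    by (rule tendsto_upperbound) simp
  moreover have "pi * 1 ^ (2 * n + 2) / (n + 1) * (norm (b n))\<^sup>2 = pi * (real (Suc n) * (norm (a (Suc n)))\<^sup>2)" for n
    unfolding b_def norm_mult norm_of_nat by (simp add: power_mult_distrib power2_eq_square field_simps)
  ultimately have "pi * (\<Sum>n<N. real (Suc n) * (norm (a (Suc n)))\<^sup>2) \<le> pi * (k\<^sup>2 / (1 - p\<^sup>2)\<^sup>2)"
    by (simp add: sum_distrib_left mult.commute)
  then show ?thesis unfolding a_def by (simp only: mult_le_cancel_left_pos[OF pi_gt_zero])
qed

section \<open>Extension by reflection\<close>

definition disc_fold :: "complex \<Rightarrow> complex" where
  "disc_fold z = (if norm z \<le> 1 then z else 1 / cnj z)"

lemma norm_disc_fold_le: "norm (disc_fold z) \<le> 1"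
  by (auto simp: disc_fold_def norm_divide divide_le_eq)

text \<open>For points on different sides of the circle this is \<open>|1 - z cnj w| \<le> |z - w|\<close>, which follows from
\<open>|z - w|\<^sup>2 - |1 - z cnj w|\<^sup>2 = (1 - |z|\<^sup>2) (|w|\<^sup>2 - 1)\<close>.\<close>

lemma norm_disc_fold_diff_le: "norm (disc_fold z - disc_fold w) \<le> norm (z - w) / (max 1 (norm z) * max 1 (norm w))"
proof -
  have mixed: "norm (disc_fold z - disc_fold w) \<le> norm (z - w) / (max 1 (norm z) * max 1 (norm w))"
    if "norm z \<le> 1" "norm w > 1" for z w
  proof -
    have w: "w \<noteq> 0" using that by auto
    have "(norm (z - w))\<^sup>2 - (norm (1 - z * cnj w))\<^sup>2 = (1 - (norm z)\<^sup>2) * ((norm w)\<^sup>2 - 1)"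
      unfolding cmod_power2 by (simp add: power2_eq_square algebra_simps)
    also have "\<dots> \<ge> 0" using that by (intro mult_nonneg_nonneg) (auto simp: power_le_one one_le_power less_imp_le)
    finally have "(norm (1 - z * cnj w))\<^sup>2 \<le> (norm (z - w))\<^sup>2" by simp
    then have "norm (1 - z * cnj w) \<le> norm (z - w)" by (rule power2_le_imp_le) simp
    moreover have "z - 1 / cnj w = - ((1 - z * cnj w) / cnj w)" using w by (simp add: field_simps)
    then have "norm (z - 1 / cnj w) = norm (1 - z * cnj w) / norm w"
      by (simp only: norm_minus_cancel norm_divide complex_mod_cnj)
    ultimately show ?thesis using that by (simp add: disc_fold_def max_def divide_right_mono)
  qed
  show ?thesis
  proof (cases "norm z \<le> 1"; cases "norm w \<le> 1")
    assume "norm z \<le> 1" "norm w \<le> 1"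
    then show ?thesis by (simp add: disc_fold_def max_def)
  next
    assume "norm z \<le> 1" "\<not> norm w \<le> 1"
    then show ?thesis using mixed by simp
  next
    assume "\<not> norm z \<le> 1" "norm w \<le> 1"
    then show ?thesis using mixed[of w z] by (simp add: norm_minus_commute mult.commute)
  next
    assume zw: "\<not> norm z \<le> 1" "\<not> norm w \<le> 1"
    then have "z \<noteq> 0" "w \<noteq> 0" by auto
    then have "1 / cnj z - 1 / cnj w = cnj (w - z) / (cnj z * cnj w)" by (simp add: field_simps)
    then have "norm (1 / cnj z - 1 / cnj w) = norm (w - z) / (norm z * norm w)"
      by (simp only: norm_divide norm_mult complex_mod_cnj)
    then show ?thesis using zw by (simp add: disc_fold_def max_def norm_minus_commute)
  qed
qed

text \<open>In the coordinate \<open>1 / (z - p)\<close> distances are \<open>|z - w| / (|z - p| |w - p|)\<close>, and \<open>|z - p| \<le> (1 + p) max 1 |z|\<close>.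
The second inequality is the first one with \<open>w\<close> at infinity, where the fold has the value 0.\<close>

lemma disc_fold_pole_chart:
  assumes p: "0 \<le> p" "p < 1" and z: "z \<noteq> of_real p" and w: "w \<noteq> of_real p"
  shows "norm (disc_fold z - disc_fold w) \<le> (1 + p)\<^sup>2 * norm (1 / (z - of_real p) - 1 / (w - of_real p))"
    and "norm (disc_fold z) \<le> (1 + p)\<^sup>2 * norm (1 / (z - of_real p))"
proof -
  have m: "norm (z - of_real p) \<le> (1 + p) * max 1 (norm z)" for z :: complex
  proof -
    have "norm (z - of_real p) \<le> norm z + p" using norm_triangle_ineq4[of z "of_real p"] p by simp
    also have "\<dots> \<le> max 1 (norm z) + p * max 1 (norm z)"
      using p mult_left_mono[of 1 "max 1 (norm z)" p] by (intro add_mono) auto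
    finally show ?thesis by (simp add: algebra_simps)
  qed
  have pos: "norm (z - of_real p) > 0" "norm (w - of_real p) > 0" using z w by auto
  have "1 / (z - of_real p) - 1 / (w - of_real p) = (w - z) / ((z - of_real p) * (w - of_real p))"
    using z w by (simp add: diff_frac_eq)
  then have e: "norm (1 / (z - of_real p) - 1 / (w - of_real p)) = norm (z - w) / (norm (z - of_real p) * norm (w - of_real p))"
    by (simp only: norm_divide norm_mult norm_minus_commute[of w z])
  have "norm (disc_fold z - disc_fold w) \<le> norm (z - w) / (max 1 (norm z) * max 1 (norm w))"
    by (rule norm_disc_fold_diff_le)
  also have "\<dots> = (1 + p)\<^sup>2 * (norm (z - w) / (((1 + p) * max 1 (norm z)) * ((1 + p) * max 1 (norm w))))"
    using p by (simp add: power2_eq_square)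
  also have "\<dots> \<le> (1 + p)\<^sup>2 * (norm (z - w) / (norm (z - of_real p) * norm (w - of_real p)))"
    using pos p m by (intro mult_left_mono divide_left_mono mult_mono mult_pos_pos) (auto simp: less_max_iff_disj)
  finally show "norm (disc_fold z - disc_fold w) \<le> (1 + p)\<^sup>2 * norm (1 / (z - of_real p) - 1 / (w - of_real p))"
    by (simp only: e)
  have "norm (disc_fold z) * norm (z - of_real p) \<le> (1 + p)\<^sup>2"
  proof -
    have "norm (disc_fold z) * norm (z - of_real p) \<le> norm (disc_fold z) * ((1 + p) * max 1 (norm z))"
      by (intro mult_left_mono m) auto
    also have "\<dots> = (1 + p) * (norm (disc_fold z) * max 1 (norm z))" by simp
    also have "norm (disc_fold z) * max 1 (norm z) \<le> 1"
      by (auto simp: disc_fold_def norm_divide max_def)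
    then have "(1 + p) * (norm (disc_fold z) * max 1 (norm z)) \<le> (1 + p) * 1" using p by (intro mult_left_mono) auto
    also have "(1 + p) * 1 \<le> (1 + p)\<^sup>2" using p by (simp add: power2_eq_square algebra_simps)
    finally show ?thesis by simp
  qed
  then show "norm (disc_fold z) \<le> (1 + p)\<^sup>2 * norm (1 / (z - of_real p))"
    using pos by (simp add: norm_divide pos_le_divide_eq)
qed

lemma disc_fold_lipschitz: "1-lipschitz_on UNIV disc_fold"
proof (rule lipschitz_onI)
  fix z w :: complex
  have "norm (z - w) / (max 1 (norm z) * max 1 (norm w)) \<le> norm (z - w) / 1"
  proof (rule divide_left_mono)
    show "1 \<le> max 1 (norm z) * max 1 (norm w)" using mult_mono[of 1 "max 1 (norm z)" 1 "max 1 (norm w)"] by simp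
  qed (auto simp: less_max_iff_disj)
  then show "dist (disc_fold z) (disc_fold w) \<le> 1 * dist z w"
    using norm_disc_fold_diff_le[of z w] by (simp add: dist_norm)
qed simp

lemma loc_lip_add:
  assumes "loc_lip U f" "loc_lip U g"
  shows "loc_lip U (\<lambda>z. f z + g z)"
  unfolding loc_lip_def
proof
  fix z assume "z \<in> U"
  then obtain r C r' C' where *: "r > 0" "C-lipschitz_on (ball z r) f" "r' > 0" "C'-lipschitz_on (ball z r') g"
    using assms unfolding loc_lip_def by metis
  have "C-lipschitz_on (ball z (min r r')) f" "C'-lipschitz_on (ball z (min r r')) g"
    by (rule lipschitz_on_subset[OF *(2)], simp add: subset_ball) (rule lipschitz_on_subset[OF *(4)], simp add: subset_ball)
  then have "(C + C')-lipschitz_on (ball z (min r r')) (\<lambda>z. f z + g z)" by (rule lipschitz_on_add)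
  then show "\<exists>r>0. \<exists>C. C-lipschitz_on (ball z r) (\<lambda>z. f z + g z)" using * by (intro exI[of _ "min r r'"]) auto
qed

text \<open>A pole is a point where the map tends to infinity, so continuity at each of the two exceptional points is one of
the limit hypotheses; elsewhere it is continuity in the plane.\<close>

lemma continuous_map_sphereI:
  assumes f0: "continuous_on (- {q}) f0" and lim: "(f0 \<longlongrightarrow> c) at_infinity" and pole: "is_pole f0 q"
    and F: "F None = Some c" "F (Some q) = None" "\<And>z. z \<noteq> q \<Longrightarrow> F (Some z) = Some (f0 z)"
  shows "continuous_map riemann_sphere riemann_sphere F"
  unfolding continuous_map_def
proof (intro conjI allI impI)
  have top: "topspace riemann_sphere = UNIV" by (auto simp: UNIV_option_conv)
  show "F \<in> topspace riemann_sphere \<rightarrow> topspace riemann_sphere" by (simp only: top) simp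
  fix T assume T: "openin riemann_sphere T"
  define V where "V = {v. Some v \<in> T}"
  have V: "open V" "None \<in> T \<Longrightarrow> compact (- V)"
  proof -
    consider U where "open U" "T = Some ` U" | C where "compact C" "closed C" "T = insert None (Some ` (- C))"
      using T unfolding openin_Alexandroff_compactification by (auto simp: Compl_eq_Diff_UNIV)
    then have "open V \<and> (None \<in> T \<longrightarrow> compact (- V))"
    proof cases
      case 1
      then have "V = U" by (auto simp: V_def)
      then show ?thesis using 1 by auto
    next
      case 2
      then have "V = - C" by (auto simp: V_def)
      then show ?thesis using 2 by (simp add: open_Compl)
    qed
    then show "open V" "None \<in> T \<Longrightarrow> compact (- V)" by auto
  qed
  define S' where "S' = f0 -` V \<inter> (- {q})"
  have S': "open S'" 
    using f0 V(1) continuous_on_open_vimage[of "- {q}" f0] open_Compl[OF closed_singleton[of q]] by (simp add: S'_def)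
  define S where "S = {z. F (Some z) \<in> T}"
  have S_eq: "S = (if None \<in> T then insert q S' else S')"
  proof (rule set_eqI)
    show "z \<in> S \<longleftrightarrow> z \<in> (if None \<in> T then insert q S' else S')" for z
      using F(2) F(3)[of z] by (cases "z = q") (auto simp: S_def S'_def V_def)
  qed
  have S: "open S"
  proof (cases "None \<in> T")
    case True
    obtain B where B: "\<And>v. v \<in> - V \<Longrightarrow> norm v \<le> B" using compact_imp_bounded[OF V(2)[OF True]] by (auto simp: bounded_iff)
    have "eventually (\<lambda>z. norm (f0 z) \<ge> B + 1) (at q)"
      using filterlim_at_infinity_imp_norm_at_top[OF pole[unfolded is_pole_def]] unfolding filterlim_at_top by blast
    then obtain d where d: "d > 0" "\<And>z. z \<in> ball q d \<Longrightarrow> z \<noteq> q \<Longrightarrow> norm (f0 z) \<ge> B + 1"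
      unfolding eventually_at by (auto simp: dist_commute)
    have "ball q d - {q} \<subseteq> S'"
    proof
      fix z assume z: "z \<in> ball q d - {q}"
      then have "norm (f0 z) \<ge> B + 1" using d(2)[of z] by simp
      then have "f0 z \<in> V" using B[of "f0 z"] by (cases "f0 z \<in> V") auto
      then show "z \<in> S'" using z by (simp add: S'_def)
    qed
    then have "insert q S' = S' \<union> ball q d" using d(1) by auto
    then show ?thesis using S' True by (simp add: S_eq open_Un)
  qed (simp add: S_eq S')
  have pre: "{x \<in> topspace riemann_sphere. F x \<in> T} = (if c \<in> V then insert None (Some ` S) else Some ` S)"
  proof -
    have "x \<in> (if c \<in> V then insert None (Some ` S) else Some ` S) \<longleftrightarrow> F x \<in> T" for x
    proof (cases x)
      case None
      then show ?thesis using F(1) by (simp add: V_def image_iff)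
    next
      case (Some z)
      then show ?thesis by (simp add: S_def image_iff)
    qed
    then show ?thesis unfolding top by (intro set_eqI) (simp only: mem_Collect_eq UNIV_I simp_thms)
  qed
  show "openin riemann_sphere {x \<in> topspace riemann_sphere. F x \<in> T}"
  proof (cases "c \<in> V")
    case False
    then show ?thesis unfolding pre using S by simp
  next
    case True
    have "eventually (\<lambda>z. f0 z \<in> V) at_infinity" by (rule topological_tendstoD[OF lim V(1) True])
    then obtain b where b: "\<And>z. norm z \<ge> b \<Longrightarrow> f0 z \<in> V" unfolding eventually_at_infinity by blast
    have "norm z \<le> max b (norm q)" if "z \<in> - S" for z
    proof (rule ccontr)
      assume "\<not> ?thesis"
      then have "z \<noteq> q" "f0 z \<in> V" using b[of z] by auto
      then show False using that by (auto simp: S_eq S'_def split: if_splits)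
    qed
    then have "bounded (- S)" unfolding bounded_iff by blast
    then have "compact (- S)" using S by (simp add: compact_eq_bounded_closed closed_Compl)
    then show ?thesis
      unfolding pre openin_Alexandroff_compactification using True S
      by (intro disjI2 exI[of _ "- S"]) (auto simp: closed_Compl)
  qed
qed

lemma test_function_C1:
  assumes "\<phi> \<in> test_functions U"
  shows "(\<phi> has_derivative frechet_derivative \<phi> (at z)) (at z)"
    and "continuous_on UNIV (\<lambda>z. frechet_derivative \<phi> (at z) v)"
    and "compact (closure (support_on UNIV \<phi>))" "closure (support_on UNIV \<phi>) \<subseteq> U"
    and "z \<notin> closure (support_on UNIV \<phi>) \<Longrightarrow> \<phi> z = 0"
proof -
  have ck: "\<And>n. Ck_function n \<phi>" using assms by (simp add: test_functions_def)
  have c1: "Ck_function (Suc 0) \<phi>" by (rule ck)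
  then show "(\<phi> has_derivative frechet_derivative \<phi> (at z)) (at z)" by (simp add: frechet_derivative_works)
  show "continuous_on UNIV (\<lambda>z. frechet_derivative \<phi> (at z) v)" using c1 by simp
  show "compact (closure (support_on UNIV \<phi>))" "closure (support_on UNIV \<phi>) \<subseteq> U"
    using assms by (auto simp: test_functions_def)
  show "z \<notin> closure (support_on UNIV \<phi>) \<Longrightarrow> \<phi> z = 0"
    using closure_subset[of "support_on UNIV \<phi>"] by (auto simp: support_on_def)
qed

lemma locally_L2_of_loc_L2: "loc_L2 U g \<Longrightarrow> locally_L2 U g"
  unfolding loc_L2_def locally_L2_def set_integrable_def
  by (auto intro: measurable_restrict_space1)

text \<open>In the coordinate \<open>\<zeta> = 1 / (z - p)\<close> the map is \<open>\<zeta> \<mapsto> \<zeta> + \<Omega>(\<kappa>(\<zeta>))\<close> with the fold \<open>\<kappa>\<close> read in this coordinate. The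
Lipschitz constants of \<open>\<Omega>\<close> and \<open>\<kappa>\<close> multiply to \<open>\<alpha> < 1\<close>, so for each \<open>y\<close> the equation \<open>\<zeta> + \<Omega>(\<kappa>(\<zeta>)) = y\<close> has
exactly one solution. A continuous bijection of the compact Hausdorff sphere is a homeomorphism. The map is
locally Lipschitz off \<open>p\<close> and differentiable off the unit circle, so its weak derivatives are the classical ones:
the polar part contributes only to \<open>\<partial>\<close>, and outside the disc \<open>\<Omega>(1 / cnj z)\<close> contributes only to the conjugate.\<close>

lemma reflection_extension_quasiconformal:
  fixes \<Omega> :: "complex \<Rightarrow> complex"
  assumes p: "0 \<le> p" "p < 1" and \<alpha>: "0 \<le> \<alpha>" "\<alpha> < 1"
    and lip: "(\<alpha> / (1 + p)\<^sup>2)-lipschitz_on (cball 0 1) \<Omega>"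
    and hol: "\<Omega> holomorphic_on ball 0 1"
    and der: "\<And>z. z \<in> ball 0 1 \<Longrightarrow> norm (deriv \<Omega> z) \<le> \<alpha> / (1 + p)\<^sup>2"
    and F: "F = (\<lambda>x. case x of None \<Rightarrow> Some (\<Omega> 0)
        | Some z \<Rightarrow> if z = of_real p then None else Some (1 / (z - of_real p) + \<Omega> (disc_fold z)))"
  shows "quasiconformal \<alpha> F" and "inj F"
proof -
  let ?p = "complex_of_real p"
  let ?L = "\<alpha> / (1 + p)\<^sup>2"
  define f0 where "f0 z = 1 / (z - ?p) + \<Omega> (disc_fold z)" for z
  have F_simps: "F None = Some (\<Omega> 0)" "F (Some ?p) = None" "\<And>z. z \<noteq> ?p \<Longrightarrow> F (Some z) = Some (f0 z)"
    by (auto simp: F f0_def)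
  have L0: "?L \<ge> 0" using \<alpha> by simp
  have \<Omega>: "norm (\<Omega> z - \<Omega> w) \<le> ?L * norm (z - w)" if "norm z \<le> 1" "norm w \<le> 1" for z w
    using lipschitz_onD[OF lip, of z w] that by (simp add: dist_norm)
  define \<kappa> where "\<kappa> \<zeta> = (if \<zeta> = 0 then 0 else disc_fold (?p + 1 / \<zeta>))" for \<zeta>
  have \<kappa>1: "norm (\<kappa> \<zeta>) \<le> 1" for \<zeta> by (simp add: \<kappa>_def norm_disc_fold_le)
  have \<kappa>_diff: "norm (\<kappa> \<zeta> - \<kappa> \<eta>) \<le> (1 + p)\<^sup>2 * norm (\<zeta> - \<eta>)" for \<zeta> \<eta>
  proof (cases "\<zeta> = 0"; cases "\<eta> = 0")
    assume "\<zeta> \<noteq> 0" "\<eta> \<noteq> 0"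
    then show ?thesis using disc_fold_pole_chart(1)[OF p, of "?p + 1 / \<zeta>" "?p + 1 / \<eta>"] by (simp add: \<kappa>_def)
  next
    assume "\<zeta> = 0" "\<eta> \<noteq> 0"
    then show ?thesis using disc_fold_pole_chart(2)[OF p, of "?p + 1 / \<eta>" "?p + 1 / \<eta>"] by (simp add: \<kappa>_def)
  next
    assume "\<zeta> \<noteq> 0" "\<eta> = 0"
    then show ?thesis using disc_fold_pole_chart(2)[OF p, of "?p + 1 / \<zeta>" "?p + 1 / \<zeta>"] by (simp add: \<kappa>_def)
  qed simp
  have contr: "norm (\<Omega> (\<kappa> \<zeta>) - \<Omega> (\<kappa> \<eta>)) \<le> \<alpha> * norm (\<zeta> - \<eta>)" for \<zeta> \<eta>
  proof -
    have "norm (\<Omega> (\<kappa> \<zeta>) - \<Omega> (\<kappa> \<eta>)) \<le> ?L * norm (\<kappa> \<zeta> - \<kappa> \<eta>)" by (intro \<Omega> \<kappa>1)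
    also have "\<dots> \<le> ?L * ((1 + p)\<^sup>2 * norm (\<zeta> - \<eta>))" by (intro mult_left_mono \<kappa>_diff L0)
    also have "\<dots> = \<alpha> * norm (\<zeta> - \<eta>)" using p by simp
    finally show ?thesis .
  qed
  have unique: "\<exists>!\<zeta>. \<zeta> + \<Omega> (\<kappa> \<zeta>) = y" for y
  proof -
    have "\<exists>!\<zeta>. y - \<Omega> (\<kappa> \<zeta>) = \<zeta>"
    proof (rule banach_fix_type[OF \<alpha>])
      show "\<forall>x z. dist (y - \<Omega> (\<kappa> x)) (y - \<Omega> (\<kappa> z)) \<le> \<alpha> * dist x z"
        using contr by (simp add: dist_norm norm_minus_commute)
    qed
    moreover have "(y - \<Omega> (\<kappa> \<zeta>) = \<zeta>) = (\<zeta> + \<Omega> (\<kappa> \<zeta>) = y)" for \<zeta> by (auto simp: algebra_simps)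
    ultimately show ?thesis by (simp only:)
  qed
  define m where "m x = (case x of None \<Rightarrow> Some 0 | Some z \<Rightarrow> if z = ?p then None else Some (1 / (z - ?p)))" for x
  define T where "T \<zeta> = \<zeta> + \<Omega> (\<kappa> \<zeta>)" for \<zeta>
  have F_chart: "F x = map_option T (m x)" for x
    by (cases x) (auto simp: F m_def T_def \<kappa>_def)
  have injm: "inj m"
    by (rule injI) (auto simp: m_def split: option.splits if_splits)
  have injT: "inj T" using unique unfolding T_def by (intro injI) metis
  have "F = map_option T \<circ> m" using F_chart by (simp add: fun_eq_iff)
  then show inj: "inj F" using inj_compose[OF option.inj_map[OF injT] injm] by simp
  have surj: "surj F"
  proof -
    have "\<exists>x. F x = y" for y
    proof (cases y)
      case None
      then show ?thesis using F_simps(2) by blast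
    next
      case (Some v)
      obtain \<zeta> where \<zeta>: "T \<zeta> = v" using unique[of v] unfolding T_def by blast
      have "m (if \<zeta> = 0 then None else Some (?p + 1 / \<zeta>)) = Some \<zeta>" by (simp add: m_def)
      then show ?thesis using \<zeta> Some by (intro exI[of _ "if \<zeta> = 0 then None else Some (?p + 1 / \<zeta>)"]) (simp add: F_chart)
    qed
    then show ?thesis by (metis surjI)
  qed
  have fold_L: "?L-lipschitz_on UNIV (\<lambda>z. \<Omega> (disc_fold z))"
  proof (rule lipschitz_onI[OF _ L0])
    fix z w
    have "norm (\<Omega> (disc_fold z) - \<Omega> (disc_fold w)) \<le> ?L * norm (disc_fold z - disc_fold w)" by (intro \<Omega> norm_disc_fold_le)
    also have "\<dots> \<le> ?L * norm (z - w)"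
      using lipschitz_onD[OF disc_fold_lipschitz, of z w] by (intro mult_left_mono L0) (simp add: dist_norm)
    finally show "dist (\<Omega> (disc_fold z)) (\<Omega> (disc_fold w)) \<le> ?L * dist z w" by (simp add: dist_norm)
  qed
  have \<Omega>fold_cont: "continuous_on A (\<lambda>z. \<Omega> (disc_fold z))" for A
    using lipschitz_on_continuous_on[OF fold_L] continuous_on_subset by blast
  have f0_cont: "continuous_on (- {?p}) f0"
    unfolding f0_def by (intro continuous_intros \<Omega>fold_cont) auto
  have inv_pole: "is_pole (\<lambda>z. 1 / (z - ?p)) ?p"
    using is_pole_basic[of "\<lambda>_. 1" UNIV ?p 1] by simp
  have pole: "is_pole f0 ?p"
    unfolding f0_def is_pole_def
  proof (rule tendsto_add_filterlim_at_infinity'[OF inv_pole[unfolded is_pole_def]])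
    show "((\<lambda>z. \<Omega> (disc_fold z)) \<longlongrightarrow> \<Omega> (disc_fold ?p)) (at ?p)"
      using \<Omega>fold_cont[of UNIV] by (simp add: continuous_on_def)
  qed
  have f0_lim: "(f0 \<longlongrightarrow> \<Omega> 0) at_infinity"
  proof -
    have "filterlim (\<lambda>z. z - ?p) at_infinity at_infinity"
      using tendsto_add_filterlim_at_infinity'[OF filterlim_ident tendsto_const[of "- ?p"]] by simp
    then have inv: "((\<lambda>z. 1 / (z - ?p)) \<longlongrightarrow> 0) at_infinity" by (intro tendsto_divide_0[OF tendsto_const])
    have "((\<lambda>z. \<alpha> * norm (1 / (z - ?p))) \<longlongrightarrow> \<alpha> * norm (0::complex)) at_infinity"
      by (intro tendsto_mult tendsto_const tendsto_norm inv)
    then have z: "((\<lambda>z. \<alpha> * norm (1 / (z - ?p))) \<longlongrightarrow> 0) at_infinity" by simp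
    have "eventually (\<lambda>z. norm (\<Omega> (disc_fold z) - \<Omega> 0) \<le> \<alpha> * norm (1 / (z - ?p))) at_infinity"
      unfolding eventually_at_infinity
    proof (intro exI[of _ 1] allI impI)
      fix z :: complex assume "1 \<le> norm z"
      then have zp: "z \<noteq> ?p" using p by auto
      have "norm (\<Omega> (disc_fold z) - \<Omega> 0) \<le> ?L * norm (disc_fold z - 0)" by (intro \<Omega> norm_disc_fold_le) simp
      also have "\<dots> \<le> ?L * ((1 + p)\<^sup>2 * norm (1 / (z - ?p)))"
        using disc_fold_pole_chart(2)[OF p zp zp] by (intro mult_left_mono L0) simp
      also have "\<dots> = \<alpha> * norm (1 / (z - ?p))" using p by simp
      finally show "norm (\<Omega> (disc_fold z) - \<Omega> 0) \<le> \<alpha> * norm (1 / (z - ?p))" .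
    qed
    from Lim_null_comparison[OF this z] have "((\<lambda>z. \<Omega> (disc_fold z)) \<longlongrightarrow> \<Omega> 0) at_infinity"
      by (rule LIM_zero_cancel)
    from tendsto_add[OF inv this] show ?thesis by (simp add: f0_def[abs_def])
  qed
  have top: "topspace riemann_sphere = UNIV" by (auto simp: UNIV_option_conv)
  have hom: "homeomorphic_map riemann_sphere riemann_sphere F"
  proof (rule continuous_imp_homeomorphic_map)
    show "continuous_map riemann_sphere riemann_sphere F"
      by (rule continuous_map_sphereI[OF f0_cont f0_lim pole F_simps])
    show "compact_space riemann_sphere" by simp
    show "Hausdorff_space riemann_sphere"
      by (simp add: Hausdorff_space_Alexandroff_compactification locally_compact_space_euclidean)
    show "F ` topspace riemann_sphere = topspace riemann_sphere" using surj by (simp only: top)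
    show "inj_on F (topspace riemann_sphere)" using inj by (simp only: top)
  qed
  define U where "U = - {?p}"
  have U: "open U" unfolding U_def by (intro open_Compl closed_singleton)
  have FU: "{z. F (Some z) \<noteq> None} = U" using F_simps(2,3) by (auto simp: U_def)
  \<comment> \<open>The two Wirtinger derivatives; on the circle, a null set, their values are arbitrary.\<close>
  define A where "A z = - (1 / (z - ?p)\<^sup>2) + (if z \<in> ball 0 1 then deriv \<Omega> z else 0)" for z
  define B where "B z = (if z \<in> cball 0 1 then 0 else - (deriv \<Omega> (1 / cnj z) / (cnj z)\<^sup>2))" for z
  have d\<Omega>_cont: "continuous_on (ball 0 1) (deriv \<Omega>)"
    by (intro holomorphic_on_imp_continuous_on holomorphic_deriv hol open_ball)
  have A_meas: "A \<in> borel_measurable lebesgue"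
  proof -
    have "(\<lambda>z. - (1 / (z - ?p)\<^sup>2)) \<in> borel_measurable borel" by measurable
    then have [measurable]: "(\<lambda>z. - (1 / (z - ?p)\<^sup>2)) \<in> borel_measurable lebesgue" by (intro measurable_completion) simp
    have [measurable]: "(\<lambda>z. if z \<in> ball 0 1 then deriv \<Omega> z else 0) \<in> borel_measurable lebesgue"
      by (intro borel_measurable_on_disc d\<Omega>_cont) auto
    show ?thesis unfolding A_def by measurable
  qed
  have out: "norm (1 / cnj z) < 1" "z \<noteq> 0" if "z \<in> - cball 0 1" for z
    using that by (auto simp: norm_divide divide_less_eq)
  have B_meas: "B \<in> borel_measurable lebesgue"
  proof -
    have "B \<in> borel_measurable borel"
      unfolding B_def using out
      by (intro borel_measurable_continuous_on_if continuous_intros continuous_on_compose2[OF d\<Omega>_cont]) auto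
    then show ?thesis by (intro measurable_completion) simp
  qed
  have B_bound: "norm (B z) \<le> ?L / (max 1 (norm z))\<^sup>2" for z
  proof (cases "z \<in> cball 0 1")
    case False
    then have "norm (deriv \<Omega> (1 / cnj z)) \<le> ?L" using out[of z] by (intro der) auto
    from divide_right_mono[OF this, of "(norm z)\<^sup>2"] show ?thesis using False by (simp add: B_def norm_divide norm_power max_def)
  qed (use L0 in \<open>simp add: B_def\<close>)
  have A_L2: "loc_L2 U A"
  proof (rule loc_L2_bounded[OF A_meas])
    fix K assume K: "compact K" "K \<subseteq> U"
    have "bounded ((\<lambda>z. - (1 / (z - ?p)\<^sup>2)) ` K)"
      using K by (intro compact_imp_bounded compact_continuous_image continuous_intros) (auto simp: U_def)
    then obtain b where "\<forall>x\<in>(\<lambda>z. - (1 / (z - ?p)\<^sup>2)) ` K. norm x \<le> b" by (auto simp: bounded_iff)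
    then have b: "norm (- (1 / (z - ?p)\<^sup>2)) \<le> b" if "z \<in> K" for z using that by blast
    have "norm (A z) \<le> b + ?L" if "z \<in> K" for z
      unfolding A_def using b[OF that] der[of z] L0 by (intro norm_triangle_le add_mono) auto
    then show "\<exists>b. \<forall>z\<in>K. norm (A z) \<le> b" by blast
  qed
  have B_L2: "loc_L2 U B"
  proof (rule loc_L2_bounded[OF B_meas])
    have "norm (B z) \<le> ?L" for z
    proof -
      have "?L / (max 1 (norm z))\<^sup>2 \<le> ?L / 1" using L0 by (intro divide_left_mono) (auto simp: one_le_power)
      then show ?thesis using B_bound[of z] by simp
    qed
    then show "\<exists>b. \<forall>z\<in>K. norm (B z) \<le> b" for K by blast
  qed
  \<comment> \<open>Outside the disc compare |z|^(-2) with |z - p|^(-2) by means of |z - p| \<le> (1 + p) |z|.\<close>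
  have beltrami: "norm (B z) \<le> \<alpha> * norm (A z)" for z
  proof (cases "z \<in> cball 0 1")
    case True
    then show ?thesis using \<alpha> by (simp add: B_def)
  next
    case False
    then have z: "norm z > 1" by simp
    then have zp: "z - ?p \<noteq> 0" using p by auto
    have "norm (z - ?p) \<le> norm z + p" using norm_triangle_ineq4[of z ?p] p by simp
    also have "\<dots> \<le> (1 + p) * norm z" using z p mult_left_mono[of 1 "norm z" p] by (simp add: algebra_simps)
    finally have "(norm (z - ?p))\<^sup>2 \<le> ((1 + p) * norm z)\<^sup>2" by (intro power_mono) auto
    have "norm (B z) \<le> ?L / (norm z)\<^sup>2" using B_bound[of z] z by (simp add: max_def)
    also have "\<dots> = \<alpha> * (1 / ((1 + p) * norm z)\<^sup>2)" by (simp add: power_mult_distrib)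
    also have "\<dots> \<le> \<alpha> * (1 / (norm (z - ?p))\<^sup>2)"
      using \<open>(norm (z - ?p))\<^sup>2 \<le> ((1 + p) * norm z)\<^sup>2\<close> zp \<alpha> p z by (intro mult_left_mono divide_left_mono mult_pos_pos zero_less_power) auto
    also have "1 / (norm (z - ?p))\<^sup>2 = norm (A z)" using False by (simp add: A_def norm_divide norm_power)
    finally show ?thesis .
  qed
  have f0_lip: "loc_lip U f0"
    unfolding f0_def
  proof (rule loc_lip_add)
    show "loc_lip U (\<lambda>z. 1 / (z - ?p))"
      by (rule loc_lip_holomorphic[OF _ U]) (auto intro!: holomorphic_intros simp: U_def)
    show "loc_lip U (\<lambda>z. \<Omega> (disc_fold z))"
      unfolding loc_lip_def using lipschitz_on_subset[OF fold_L subset_UNIV] zero_less_one by blast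
  qed
  have N: "sphere (0::complex) 1 \<in> null_sets lebesgue"
    using negligible_sphere negligible_iff_null_sets by blast
  have f0_der: "(f0 has_derivative (\<lambda>v. A z * v + B z * cnj v)) (at z)" if z: "z \<in> U - sphere 0 1" for z
  proof -
    have zp: "z - ?p \<noteq> 0" using z by (simp add: U_def)
    have "((\<lambda>z. 1 / (z - ?p)) has_field_derivative - (1 / (z - ?p)\<^sup>2)) (at z)"
      using zp by (auto intro!: derivative_eq_intros simp: power2_eq_square)
    then have d1: "((\<lambda>z. 1 / (z - ?p)) has_derivative (\<lambda>v. - (1 / (z - ?p)\<^sup>2) * v)) (at z)"
      by (simp only: has_field_derivative_def)
    show ?thesis
    proof (cases "z \<in> ball 0 1")
      case True
      have "(\<Omega> has_derivative (\<lambda>v. deriv \<Omega> z * v)) (at z)"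
        using holomorphic_derivI[OF hol open_ball True] by (simp add: has_field_derivative_def)
      then have "((\<lambda>z. \<Omega> (disc_fold z)) has_derivative (\<lambda>v. deriv \<Omega> z * v)) (at z)"
        by (rule has_derivative_transform_within_open[OF _ open_ball True]) (auto simp: disc_fold_def)
      from has_derivative_add[OF d1 this] show ?thesis
        using True by (simp add: f0_def[abs_def] A_def B_def algebra_simps)
    next
      case False
      then have zo: "z \<in> - cball 0 1" using z by auto
      note o = out[OF zo]
      have "((\<lambda>z. 1 / z) has_field_derivative - (1 / (cnj z)\<^sup>2)) (at (cnj z))"
        using o(2) by (auto intro!: derivative_eq_intros simp: power2_eq_square)
      moreover have "(\<Omega> has_field_derivative deriv \<Omega> (1 / cnj z)) (at (1 / cnj z))"
        using o(1) by (intro holomorphic_derivI[OF hol open_ball]) simp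
      ultimately have "((\<lambda>z. \<Omega> (1 / z)) has_field_derivative deriv \<Omega> (1 / cnj z) * - (1 / (cnj z)\<^sup>2)) (at (cnj z))"
        by (intro DERIV_chain2)
      then have "((\<lambda>z. \<Omega> (1 / z)) has_derivative (\<lambda>v. deriv \<Omega> (1 / cnj z) * - (1 / (cnj z)\<^sup>2) * v)) (at (cnj z))"
        by (simp only: has_field_derivative_def)
      from has_derivative_compose[OF has_derivative_cnj[OF has_derivative_ident] this]
      have "((\<lambda>z. \<Omega> (1 / cnj z)) has_derivative (\<lambda>v. deriv \<Omega> (1 / cnj z) * - (1 / (cnj z)\<^sup>2) * cnj v)) (at z)" .
      then have "((\<lambda>z. \<Omega> (disc_fold z)) has_derivative (\<lambda>v. deriv \<Omega> (1 / cnj z) * - (1 / (cnj z)\<^sup>2) * cnj v)) (at z)"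
        by (rule has_derivative_transform_within_open[OF _ _ zo]) (auto simp: disc_fold_def)
      from has_derivative_add[OF d1 this] show ?thesis
        using False zo by (simp add: f0_def[abs_def] A_def B_def)
    qed
  qed
  have weak: "(LINT z:U|lebesgue. f0 z * wirt s (frechet_derivative \<phi> (at z))) = - (LINT z:U|lebesgue. g z * \<phi> z)"
    if "\<phi> \<in> test_functions U" "\<And>z. g z = wirt s (\<lambda>v. A z * v + B z * cnj v)" for \<phi> s g
    by (rule weak_derivative_piecewise(1)[OF U f0_lip N f0_der that(2) test_function_C1(1,2)[OF that(1)] test_function_C1(2-5)[OF that(1)]])
  have dist: "distributional_dz U f0 A" "distributional_dzbar U f0 B"
    unfolding distributional_dz_def distributional_dzbar_def wirtinger_dz_eq wirtinger_dzbar_eq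
    by (auto intro!: weak simp: wirt_linear_form)
  have f0_F: "distributional_dz U (\<lambda>z. the (F (Some z))) A" "distributional_dzbar U (\<lambda>z. the (F (Some z))) B"
  proof -
    have e: "(LINT z:U|lebesgue. the (F (Some z)) * h z) = (LINT z:U|lebesgue. f0 z * h z)" for h :: "complex \<Rightarrow> complex"
      using U F_simps(3) by (intro set_lebesgue_integral_cong) (auto simp: U_def)
    show "distributional_dz U (\<lambda>z. the (F (Some z))) A" "distributional_dzbar U (\<lambda>z. the (F (Some z))) B"
      using dist unfolding distributional_dz_def distributional_dzbar_def e by auto
  qed
  show "quasiconformal \<alpha> F"
    unfolding quasiconformal_def Let_def FU
    using hom locally_L2_of_loc_L2[OF A_L2] locally_L2_of_loc_L2[OF B_L2] f0_F beltrami
    by (intro conjI exI[of _ A] exI[of _ B]) auto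
qed

section \<open>The Hadamard product\<close>

lemma power_series_lipschitz_closed_disc:
  fixes c :: "nat \<Rightarrow> complex"
  assumes bd: "\<And>N. (\<Sum>n<N. real n * norm (c n)) \<le> L"
  shows "L-lipschitz_on (cball 0 1) (\<lambda>z. \<Sum>n. c n * z ^ n)"
    and "(\<lambda>z. \<Sum>n. c n * z ^ n) holomorphic_on ball 0 1"
    and "z \<in> ball 0 1 \<Longrightarrow> norm (deriv (\<lambda>z. \<Sum>n. c n * z ^ n) z) \<le> L"
proof -
  define \<Omega> where "\<Omega> z = (\<Sum>n. c n * z ^ n)" for z
  have snc: "summable (\<lambda>n. real n * norm (c n))"
    by (rule summableI_nonneg_bounded[OF _ bd]) simp
  have sc: "summable (\<lambda>n. norm (c n))"
  proof (rule summable_comparison_test_ev[OF _ snc])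
    have "norm (norm (c n)) \<le> real n * norm (c n)" if "n \<ge> 1" for n
      using mult_right_mono[of 1 "real n" "norm (c n)"] that by simp
    then show "\<forall>\<^sub>F n in sequentially. norm (norm (c n)) \<le> real n * norm (c n)"
      by (auto intro: eventually_sequentiallyI[of 1])
  qed
  have L: "L \<ge> 0" using bd[of 0] by simp
  have le_L: "(\<Sum>n. real n * norm (c n)) \<le> L"
    using snc bd by (intro suminf_le_const) auto
  have summ: "summable (\<lambda>n. c n * z ^ n)" if "norm z \<le> 1" for z
    using that by (intro summable_comparison_test'[OF sc])
      (auto simp: norm_mult norm_power power_le_one mult_left_le)
  have lip: "norm (\<Omega> z - \<Omega> w) \<le> L * norm (z - w)" if "norm z \<le> 1" "norm w \<le> 1" for z w
  proof -
    have le: "norm (c n * z ^ n - c n * w ^ n) \<le> real n * norm (c n) * norm (z - w)" for n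
    proof -
      have "norm (c n * z ^ n - c n * w ^ n) = norm (c n) * norm (z ^ n - w ^ n)"
        by (simp only: right_diff_distrib[symmetric] norm_mult)
      also have "\<dots> \<le> norm (c n) * (real n * norm (z - w))" by (intro mult_left_mono norm_power_diff that) auto
      finally show ?thesis by (simp add: mult_ac)
    qed
    have sr: "summable (\<lambda>n. real n * norm (c n) * norm (z - w))" by (intro summable_mult2 snc)
    have "\<Omega> z - \<Omega> w = (\<Sum>n. c n * z ^ n - c n * w ^ n)"
      unfolding \<Omega>_def by (rule suminf_diff[OF summ summ]) (use that in auto)
    also have "norm \<dots> \<le> (\<Sum>n. real n * norm (c n) * norm (z - w))"
      by (rule norm_suminf_le[OF le sr])
    also have "\<dots> = (\<Sum>n. real n * norm (c n)) * norm (z - w)" by (rule suminf_mult2[OF snc, symmetric])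
    also have "\<dots> \<le> L * norm (z - w)" by (intro mult_right_mono le_L) auto
    finally show ?thesis .
  qed
  then show "L-lipschitz_on (cball 0 1) (\<lambda>z. \<Sum>n. c n * z ^ n)"
    unfolding \<Omega>_def[symmetric] by (intro lipschitz_onI L) (auto simp: dist_norm)
  have "\<Omega> holomorphic_on ball 0 1"
  proof (rule power_series_holomorphic[where a = c])
    show "(\<lambda>n. c n * (w - 0) ^ n) sums \<Omega> w" if "w \<in> ball 0 1" for w
      unfolding \<Omega>_def using summ[of w] that by (simp add: summable_sums)
  qed
  then show "(\<lambda>z. \<Sum>n. c n * z ^ n) holomorphic_on ball 0 1" unfolding \<Omega>_def .
  show "norm (deriv (\<lambda>z. \<Sum>n. c n * z ^ n) z) \<le> L" if z: "z \<in> ball 0 1"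
  proof -
    have "((\<lambda>z. \<Sum>n. c n * z ^ n) has_field_derivative (\<Sum>n. diffs c n * z ^ n)) (at z)"
      by (rule termdiffs_strong'[of 1]) (use summ z in auto)
    then have d: "deriv (\<lambda>z. \<Sum>n. c n * z ^ n) z = (\<Sum>n. diffs c n * z ^ n)" by (rule DERIV_imp_deriv)
    have sS: "summable (\<lambda>n. real (Suc n) * norm (c (Suc n)))" using snc by (simp only: summable_Suc_iff[of "\<lambda>n. real n * norm (c n)"])
    have "norm (\<Sum>n. diffs c n * z ^ n) \<le> (\<Sum>n. real (Suc n) * norm (c (Suc n)))"
    proof (rule norm_suminf_le[OF _ sS])
      fix n
      have "norm (diffs c n * z ^ n) = real (Suc n) * norm (c (Suc n)) * norm z ^ n"
        unfolding diffs_def norm_mult norm_of_nat norm_power by simp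
      also have "\<dots> \<le> real (Suc n) * norm (c (Suc n)) * 1"
        using z by (intro mult_left_mono power_le_one) auto
      finally show "norm (diffs c n * z ^ n) \<le> real (Suc n) * norm (c (Suc n))" by simp
    qed
    also have "\<dots> = (\<Sum>n. real n * norm (c n))"
      using suminf_split_head[OF snc] by simp
    finally show ?thesis using d le_L by simp
  qed
qed

text \<open>The Cauchy-Schwarz inequality for the sequences \<open>\<surd>n |a\<^sub>n|\<close> and \<open>\<surd>n |b\<^sub>n|\<close>, whose square sums the area theorem bounds.\<close>

lemma hadamard_coeff_sum_le:
  assumes p: "p \<in> {0..<1}" and k: "k1 \<in> {0..<1}" "k2 \<in> {0..<1}"
    and f: "f \<in> Sigma_qc_class k1 p" and g: "g \<in> Sigma_qc_class k2 p"
  shows "(\<Sum>n<N. real n * norm (Sigma_coeff p f n * Sigma_coeff p g n)) \<le> k1 * k2 / (1 - p\<^sup>2)\<^sup>2"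
proof -
  define a where "a n = sqrt (real (Suc n)) * norm (Sigma_coeff p f (Suc n))" for n
  define b where "b n = sqrt (real (Suc n)) * norm (Sigma_coeff p g (Suc n))" for n
  define q where "q = (1 - p\<^sup>2)"
  have q: "q > 0" using p by (simp add: q_def abs_square_less_1)
  have sum: "(\<Sum>n<N. a n * b n) \<le> k1 * k2 / q\<^sup>2" for N
  proof (rule power2_le_imp_le)
    have "(\<Sum>n<N. a n * b n)\<^sup>2 \<le> (\<Sum>n<N. (a n)\<^sup>2) * (\<Sum>n<N. (b n)\<^sup>2)"
      by (rule Cauchy_Schwarz_ineq_sum)
    also have "\<dots> \<le> (k1\<^sup>2 / q\<^sup>2) * (k2\<^sup>2 / q\<^sup>2)"
      using Sigma_qc_area[OF p k(1) f, of N] Sigma_qc_area[OF p k(2) g, of N]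
      by (intro mult_mono) (auto simp: a_def b_def q_def power_mult_distrib intro!: sum_nonneg)
    finally show "(\<Sum>n<N. a n * b n)\<^sup>2 \<le> (k1 * k2 / q\<^sup>2)\<^sup>2"
      by (simp add: power_mult_distrib power_divide power2_eq_square mult_ac)
  qed (use k in auto)
  have ab: "real (Suc n) * norm (Sigma_coeff p f (Suc n) * Sigma_coeff p g (Suc n)) = a n * b n" for n
  proof -
    have "a n * b n = (sqrt (real (Suc n)) * sqrt (real (Suc n))) * (norm (Sigma_coeff p f (Suc n)) * norm (Sigma_coeff p g (Suc n)))"
      unfolding a_def b_def by (simp only: mult_ac)
    then show ?thesis by (simp only: real_sqrt_mult_self norm_mult)
  qed
  have "(\<Sum>n<N. real n * norm (Sigma_coeff p f n * Sigma_coeff p g n)) \<le> (\<Sum>n<Suc N. real n * norm (Sigma_coeff p f n * Sigma_coeff p g n))"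
    by simp
  also have "\<dots> = (\<Sum>n<N. a n * b n)"
    unfolding sum.lessThan_Suc_shift ab by simp
  also note sum
  finally show ?thesis by (simp add: q_def)
qed

text \<open>The converse of \<open>Sigma_class_expansion\<close>: near \<open>p\<close> the function is \<open>(1 + (z - p) \<omega>(z)) / (z - p)\<close> with numerator
1 at \<open>p\<close>, which exhibits the pole, its order and its residue.\<close>

lemma Sigma_class_of_expansion:
  assumes p: "p \<in> {0..<1}" and hol: "\<omega> holomorphic_on ball 0 1"
    and h: "\<And>z. z \<in> ball 0 1 \<Longrightarrow> h z = (if z = of_real p then None else Some (1 / (z - of_real p) + \<omega> z))"
    and inj: "inj_on h (ball 0 1)"
  shows "h \<in> Sigma_class p"
proof -
  let ?p = "complex_of_real p"
  define g where "g z = the (h z)" for z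
  have pD: "?p \<in> ball 0 1" using p by simp
  have g: "g z = 1 / (z - ?p) + \<omega> z" if "z \<in> ball 0 1 - {?p}" for z
    using h[of z] that by (simp add: g_def)
  define P where "P z = 1 + (z - ?p) * \<omega> z" for z
  have P: "P holomorphic_on ball 0 1" unfolding P_def by (intro holomorphic_intros hol)
  have gP: "g z = P z / (z - ?p)" if "z \<in> ball 0 1 - {?p}" for z
    using that by (simp add: g[OF that] P_def field_simps)
  have ev: "eventually (\<lambda>z. P z / (z - ?p) = g z) (at ?p)"
  proof -
    have "eventually (\<lambda>z. z \<in> ball 0 1 - {?p}) (at ?p)" using pD by (intro eventually_at_in_open) auto
    then show ?thesis by eventually_elim (simp add: gP)
  qed
  have pole: "is_pole g ?p"
  proof -
    have "is_pole (\<lambda>z. P z / (z - ?p) ^ 1) ?p"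
      by (rule is_pole_basic[OF P open_ball pD]) (simp_all add: P_def)
    then show ?thesis using is_pole_cong[OF ev refl] by simp
  qed
  have ord: "zorder g ?p = -1"
  proof (rule zorder_eqI[OF open_ball pD P])
    show "g w = P w * (w - ?p) powi (-1)" if "w \<in> ball 0 1" "w \<noteq> ?p" for w
      using gP[of w] that by (simp add: power_int_minus divide_inverse)
  qed (simp add: P_def)
  have res: "residue g ?p = 1"
    using residue_cong[OF ev refl] residue_simple[OF open_ball pD P] by (simp add: P_def)
  have "(\<lambda>z. 1 / (z - ?p) + \<omega> z) holomorphic_on (ball 0 1 - {?p})"
    by (intro holomorphic_intros holomorphic_on_subset[OF hol]) auto
  then have "g holomorphic_on (ball 0 1 - {?p})" by (rule holomorphic_transform) (simp add: g)
  then have an: "g analytic_on {z}" if "z \<in> ball 0 1 - {?p}" for z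
    using that by (meson analytic_on_open analytic_on_subset empty_subsetI insert_subset open_ball open_delete)
  have "meromorphic_into_sphere h (ball 0 1)"
    unfolding meromorphic_into_sphere_def g_def[symmetric, abs_def]
    using h pole an by auto
  then show ?thesis
    unfolding Sigma_class_def using inj h[OF pD] ord res by (simp add: g_def[abs_def])
qed

theorem theorem3:
  fixes k1 k2 p \<alpha> :: real
    and f g :: "complex \<Rightarrow> complex option"
  assumes "k1 \<in> {0..<1}" and "k2 \<in> {0..<1}" and "p \<in> {0..<1}"
    and "f \<in> Sigma_qc_class k1 p" and "g \<in> Sigma_qc_class k2 p"
    and "\<alpha> = k1 * k2 / (1 - p)\<^sup>2" and "\<alpha> < 1"
  shows "modified_hadamard p f g \<in> Sigma_qc_class \<alpha> p"
proof -
  have p: "0 \<le> p" "p < 1" using assms(3) by auto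
  have \<alpha>0: "0 \<le> \<alpha>" using assms(1,2,6) by simp
  define c where "c n = Sigma_coeff p f n * Sigma_coeff p g n" for n
  define \<Omega> where "\<Omega> z = (\<Sum>n. c n * z ^ n)" for z
  \<comment> \<open>The extension needs a bound by \<alpha> / (1 + p)^2, and this is what the area theorem supplies.\<close>
  have "k1 * k2 / (1 - p\<^sup>2)\<^sup>2 = \<alpha> / (1 + p)\<^sup>2"
  proof -
    have "1 - p\<^sup>2 = (1 - p) * (1 + p)" by (simp add: power2_eq_square algebra_simps)
    then show ?thesis by (simp add: assms(6) power_mult_distrib)
  qed
  then have bd: "(\<Sum>n<N. real n * norm (c n)) \<le> \<alpha> / (1 + p)\<^sup>2" for N
    using hadamard_coeff_sum_le[OF assms(3,1,2,4,5), of N] by (simp add: c_def)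
  note \<Omega> = power_series_lipschitz_closed_disc[of c, OF bd, folded \<Omega>_def]
  \<comment> \<open>The reflection sends infinity to 0, which explains the value there.\<close>
  define F where "F = (\<lambda>x. case x of None \<Rightarrow> Some (\<Omega> 0)
        | Some z \<Rightarrow> if z = of_real p then None else Some (1 / (z - of_real p) + \<Omega> (disc_fold z)))"
  have F: "quasiconformal \<alpha> F" "inj F"
    using reflection_extension_quasiconformal[OF p \<alpha>0 assms(7) \<Omega> F_def] by auto
  define h where "h = modified_hadamard p f g"
  have h: "h z = (if z = of_real p then None else Some (1 / (z - of_real p) + \<Omega> z))" for z
    by (simp add: h_def modified_hadamard_def \<Omega>_def c_def)
  have Fh: "F (Some z) = h z" if "z \<in> ball 0 1" for z
    using that by (simp add: F_def h disc_fold_def)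
  have "inj_on h (ball 0 1)"
  proof (rule inj_onI)
    fix z w assume "z \<in> ball 0 1" "w \<in> ball 0 1" "h z = h w"
    then have "F (Some z) = F (Some w)" by (simp add: Fh)
    then show "z = w" using injD[OF F(2)] by blast
  qed
  then have "h \<in> Sigma_class p" by (intro Sigma_class_of_expansion[OF assms(3) \<Omega>(2)]) (auto simp: h)
  then show ?thesis
    unfolding Sigma_qc_class_def using F(1) Fh by (auto simp: h_def)
qed

end
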